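(* Let $p_1,q_1,r_1\in C([0,T],\mathfrak{gl}(n,\mathbb{C}))$ with $p_1$ of class $C^1$, $p_1(t)=p_1(t)^*$ invertible and $r_1(t)=r_1(t)^*$ for all $t$. Let $R\subset\mathbb{C}^{2n}$ be a linear subspace, $H_R=\{x\in H^1([0,T],\mathbb{C}^n);(x(0),x(T))\in R\}$, and $$\mathcal{I}_1(x,y)=\int_0^T\big((p_1\dot x+q_1x,\dot y)+(q_1^*\dot x,y)+(r_1x,y)\big)dt,\quad x,y\in H_R.$$ Let $a\in C^1([0,T],\mathrm{Gl}(n,\mathbb{C}))$ and $R'=\{(x,y)\in\mathbb{C}^{2n};(a(0)x,a(T)y)\in R\}$. The form $(x,y)\mapsto\mathcal{I}_1(ax,ay)$ on $H_{R'}=\{x\in H^1([0,T],\mathbb{C}^n);(x(0),x(T))\in R'\}$ is given by $$\mathcal{I}_1(ax,ay)=\int_0^T\big((p_1'\dot x+q_1'x,\dot y)+(q_1'^*\dot x,y)+(r_1'x,y)\big)dt,\quad x,y\in H_{R'},$$ with coefficients $$p_1'=a^*p_1a,\quad q_1'=a^*p_1\dot a+a^*q_1a,\quad r_1'=\dot a^*p_1\dot a+\dot a^*q_1a+a^*q_1^*\dot a+a^*r_1a .$$ Let $\gamma_1$ (resp. $\gamma_1'$) be the fundamental solution, equal to $I$ at $t=0$, of $\dot u=Jb_1(t)u$ (resp. $\dot u=Jb_1'(t)u$), where $J=\begin{pmatrix}0&-I_n\\ I_n&0\end{pmatrix}$ and $$b_1=\begin{pmatrix}p_1^{-1}&-p_1^{-1}q_1\\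 -q_1^*p_1^{-1}&q_1^*p_1^{-1}q_1-r_1\end{pmatrix},$$ and $b_1'$ is given by the same formula with $p_1',q_1',r_1'$. Then $$i_{W(R')}(\gamma_1')-i_{W(R)}(\gamma_1)=\dim_{\mathbb{C}}(\mathrm{Gr}(I)\cap R')-\dim_{\mathbb{C}}(\mathrm{Gr}(I)\cap R),$$ where $\mathrm{Gr}(I)=\{(x,x);x\in\mathbb{C}^n\}$ and $W(R)=\{(x,y,z,u)\in\mathbb{C}^{4n};(x,-z)\in R^{\perp},(y,u)\in R\}$.
   Context: $(\cdot,\cdot)$ is the standard Hermitian inner product (also $(x,y)$ denotes the concatenated vector), $^*$ the conjugate transpose, $\perp$ the Hermitian orthogonal complement in $\mathbb{C}^{2n}$. Maslov index. Let $(X,\omega)$ be a finite-dimensional symplectic Hilbert space with $\omega(x,y)=(\mathcal{J}x,y)$, $\mathcal{J}^*=-\mathcal{J}$, $\mathcal{J}^2=-I$. Put $X_1=\ker(\mathcal{J}-\sqrt{-1}I)$, $X_2=\ker(\mathcal{J}+\sqrt{-1}I)$. Lagrange subspaces ($\Lambda=\Lambda^\omega$) are exactly the graphs $\mathrm{Gr}(U)$ of unitary isomorphisms $U:X_1\to X_2$. For continuous curves $\Lambda(s)=\mathrm{Gr}(U(s))$, $\Lambda'(s)=\mathrm{Gr}(U'(s))$, the Maslov index is $i(\Lambda,\Lambda')=-\mathrm{sf}_l\{U'(s)^{-1}U(s)\}$, where $\mathrm{sf}_l$ counts, with multiplicity, the eigenvalues $e^{\sqrt{-1}\theta}$ near $1$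 crossing from $\theta<0$ to $\theta\ge0$ minus those crossing from $\theta\ge0$ to $\theta<0$. Maslov-type index. $\mathbb{C}^{2n}$ carries $\omega(x,y)=(Jx,y)$, and $\mathbb{C}^{4n}=\mathbb{C}^{2n}\oplus\mathbb{C}^{2n}$ carries $(-\omega)\oplus\omega$, for which $W(R)$ is a Lagrange subspace. For a continuous path $\gamma$ in $\mathrm{Sp}(2n,\mathbb{C})=\{M; M^*JM=J\}$ and a Lagrange subspace $W$ of $\mathbb{C}^{4n}$, $i_W(\gamma):=i(\mathrm{Gr}(\gamma(t)),W)$, with $\mathrm{Gr}(M)=\{(v,Mv)\}$. *)

theory Defs
  imports "HOL-Analysis.Analysis"
begin

definition cinner :: "complex ^ 'm::finite \<Rightarrow> complex ^ 'm \<Rightarrow> complex" where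
  "cinner x y = (\<Sum>i\<in>UNIV. x $ i * cnj (y $ i))"

definition adjoint_mat :: "complex ^ 'n ^ 'm \<Rightarrow> complex ^ 'm ^ 'n" where
  "adjoint_mat A = (\<chi> i j. cnj (A $ j $ i))"

definition orth_compl :: "(complex ^ 'm::finite) set \<Rightarrow> (complex ^ 'm) set" where
  "orth_compl R = {w. \<forall>v\<in>R. cinner w v = 0}"

text \<open>\<open>\<complex>\<^sup>k \<oplus> \<complex>\<^sup>l\<close> is indexed by the disjoint sum of the two index types.\<close>

definition vjoin :: "'a ^ 'k \<Rightarrow> 'a ^ 'l \<Rightarrow> 'a ^ ('k + 'l)" where
  "vjoin x y = (\<chi> i. case i of Inl j \<Rightarrow> x $ j | Inr j \<Rightarrow> y $ j)"

definition block_mat ::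
  "'a ^ 'k ^ 'k \<Rightarrow> 'a ^ 'l ^ 'k \<Rightarrow> 'a ^ 'k ^ 'l \<Rightarrow> 'a ^ 'l ^ 'l \<Rightarrow> 'a ^ ('k + 'l) ^ ('k + 'l)" where
  "block_mat A B C D =
     (\<chi> i j. case i of
        Inl i' \<Rightarrow> (case j of Inl j' \<Rightarrow> A $ i' $ j' | Inr j' \<Rightarrow> B $ i' $ j')
      | Inr i' \<Rightarrow> (case j of Inl j' \<Rightarrow> C $ i' $ j' | Inr j' \<Rightarrow> D $ i' $ j'))"

definition Gr :: "complex ^ 'k ^ 'k \<Rightarrow> (complex ^ ('k::finite + 'k)) set" where
  "Gr M = {vjoin v (M *v v) | v. True}"

definition unitary_iso ::
  "(complex ^ 'm::finite) set \<Rightarrow> (complex ^ 'm) set \<Rightarrow> (complex ^ 'm \<Rightarrow> complex ^ 'm) \<Rightarrow> bool" where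
  "unitary_iso X Y U \<longleftrightarrow>
     bij_betw U X Y \<and>
     (\<forall>x\<in>X. \<forall>y\<in>X. U (x + y) = U x + U y) \<and>
     (\<forall>c. \<forall>x\<in>X. U (c *s x) = c *s U x) \<and>
     (\<forall>x\<in>X. \<forall>y\<in>X. cinner (U x) (U y) = cinner x y)"

text \<open>
  The number, with multiplicity, of eigenvalues \<open>cis \<theta>\<close>, \<open>0 \<le> \<theta> < \<epsilon>\<close>, of an operator \<open>V\<close> on the
  subspace \<open>X\<close>. It is applied to unitary operators only, so that algebraic and geometric
  multiplicities agree.
\<close>

definition arc_count ::
  "(complex ^ 'm::finite) set \<Rightarrow> (complex ^ 'm \<Rightarrow> complex ^ 'm) \<Rightarrow> real \<Rightarrow> nat" where
  "arc_count X V \<epsilon> =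
     (\<Sum>\<mu>\<in>{cis \<theta> | \<theta>. 0 \<le> \<theta> \<and> \<theta> < \<epsilon> \<and> (\<exists>x\<in>X. x \<noteq> 0 \<and> V x = cis \<theta> *s x)}.
        vec.dim {x\<in>X. V x = \<mu> *s x})"

text \<open>
  Crossings are counted along a partition: while no eigenvalue equals \<open>cis (\<epsilon> j)\<close>, the number of
  eigenvalues on the arc \<open>0 \<le> \<theta> < \<epsilon> j\<close> can only change by eigenvalues passing
  from \<open>\<theta> < 0\<close> to \<open>\<theta> \<ge> 0\<close> (counted positively) or back (counted negatively). For a continuous
  path of unitary operators such a partition exists and the total does not depend on it.
\<close>

definition has_spectral_flow_l ::
  "(complex ^ 'm::finite) set \<Rightarrow> (real \<Rightarrow> complex ^ 'm \<Rightarrow> complex ^ 'm) \<Rightarrow> real \<Rightarrow> real \<Rightarrow> int \<Rightarrow> bool"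
  where
  "has_spectral_flow_l X V a b k \<longleftrightarrow>
     (\<exists>(N::nat) (s::nat \<Rightarrow> real) (\<epsilon>::nat \<Rightarrow> real).
        s 0 = a \<and> s N = b \<and> (\<forall>j<N. s j \<le> s (Suc j)) \<and>
        (\<forall>j<N. 0 < \<epsilon> j \<and> \<epsilon> j < pi \<and>
           (\<forall>t\<in>{s j..s (Suc j)}. \<forall>x\<in>X. V t x = cis (\<epsilon> j) *s x \<longrightarrow> x = 0)) \<and>
        k = (\<Sum>j<N. int (arc_count X (V (s (Suc j))) (\<epsilon> j)) - int (arc_count X (V (s j)) (\<epsilon> j))))"

definition spectral_flow_l ::
  "(complex ^ 'm::finite) set \<Rightarrow> (real \<Rightarrow> complex ^ 'm \<Rightarrow> complex ^ 'm) \<Rightarrow> real \<Rightarrow> real \<Rightarrow> int" where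
  "spectral_flow_l X V a b = (THE k. has_spectral_flow_l X V a b k)"

text \<open>
  \<open>\<J>\<close> is the matrix of the symplectic structure \<open>\<omega>(x,y) = (\<J>x,y)\<close>; it is meant to satisfy
  \<open>\<J>\<^sup>* = -\<J>\<close> and \<open>\<J>\<^sup>2 = -I\<close>.
\<close>

definition X1 :: "complex ^ 'm ^ 'm \<Rightarrow> (complex ^ 'm::finite) set" where
  "X1 \<J> = {x. (\<J> - mat \<i>) *v x = 0}"

definition X2 :: "complex ^ 'm ^ 'm \<Rightarrow> (complex ^ 'm::finite) set" where
  "X2 \<J> = {x. (\<J> + mat \<i>) *v x = 0}"

text \<open>
  The unitary isomorphism whose graph is the Lagrange subspace \<open>\<Lambda>\<close>;
  only its values on \<open>X1 \<J>\<close> are determined, and only these are used.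
\<close>

definition lagrange_unitary ::
  "complex ^ 'm ^ 'm \<Rightarrow> (complex ^ 'm::finite) set \<Rightarrow> complex ^ 'm \<Rightarrow> complex ^ 'm" where
  "lagrange_unitary \<J> \<Lambda> =
     (SOME U. unitary_iso (X1 \<J>) (X2 \<J>) U \<and> \<Lambda> = {x + U x | x. x \<in> X1 \<J>})"

definition maslov_index ::
  "complex ^ 'm ^ 'm \<Rightarrow> (real \<Rightarrow> (complex ^ 'm::finite) set) \<Rightarrow> (real \<Rightarrow> (complex ^ 'm) set) \<Rightarrow>
   real \<Rightarrow> real \<Rightarrow> int" where
  "maslov_index \<J> \<Lambda> \<Lambda>' a b =
     - spectral_flow_l (X1 \<J>)
         (\<lambda>s. inv_into (X1 \<J>) (lagrange_unitary \<J> (\<Lambda>' s)) \<circ> lagrange_unitary \<J> (\<Lambda> s)) a b"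

definition Jmat :: "complex ^ ('n::finite + 'n) ^ ('n + 'n)" where
  "Jmat = block_mat 0 (- mat 1) (mat 1) 0"

definition maslov_type_index ::
  "real \<Rightarrow> (complex ^ (('n::finite + 'n) + ('n + 'n))) set \<Rightarrow>
   (real \<Rightarrow> complex ^ ('n + 'n) ^ ('n + 'n)) \<Rightarrow> int" where
  "maslov_type_index T W \<gamma> =
     maslov_index (block_mat (- Jmat) 0 0 Jmat) (\<lambda>t. Gr (\<gamma> t)) (\<lambda>_. W) 0 T"

definition WR :: "(complex ^ ('n::finite + 'n)) set \<Rightarrow> (complex ^ (('n + 'n) + ('n + 'n))) set" where
  "WR R = {vjoin (vjoin x y) (vjoin z u) | x y z u. vjoin x (- z) \<in> orth_compl R \<and> vjoin y u \<in> R}"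

text \<open>
  Elements of \<open>H\<^sup>1([0,T])\<close> are represented by their absolutely continuous representative;
  values outside \<open>[0,T]\<close> are irrelevant.
\<close>

definition has_L2_derivative ::
  "real \<Rightarrow> (real \<Rightarrow> complex ^ 'n::finite) \<Rightarrow> (real \<Rightarrow> complex ^ 'n) \<Rightarrow> bool" where
  "has_L2_derivative T x g \<longleftrightarrow>
     set_borel_measurable lebesgue {0..T} g \<and>
     set_integrable lebesgue {0..T} (\<lambda>t. (norm (g t))\<^sup>2) \<and>
     (\<forall>t\<in>{0..T}. x t = x 0 + (LINT s:{0..t}|lebesgue. g s))"

text \<open>The derivative is determined almost everywhere on \<open>[0,T]\<close>.\<close>

definition L2_derivative ::
  "real \<Rightarrow> (real \<Rightarrow> complex ^ 'n::finite) \<Rightarrow> real \<Rightarrow> complex ^ 'n" where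
  "L2_derivative T x = (SOME g. has_L2_derivative T x g)"

definition H1 :: "real \<Rightarrow> (real \<Rightarrow> complex ^ 'n::finite) set" where
  "H1 T = {x. \<exists>g. has_L2_derivative T x g}"

definition H1_bc :: "real \<Rightarrow> (complex ^ ('n::finite + 'n)) set \<Rightarrow> (real \<Rightarrow> complex ^ 'n) set" where
  "H1_bc T R = {x \<in> H1 T. vjoin (x 0) (x T) \<in> R}"

definition index_form ::
  "real \<Rightarrow> (real \<Rightarrow> complex ^ 'n ^ 'n) \<Rightarrow> (real \<Rightarrow> complex ^ 'n ^ 'n) \<Rightarrow> (real \<Rightarrow> complex ^ 'n ^ 'n) \<Rightarrow>
   (real \<Rightarrow> complex ^ 'n::finite) \<Rightarrow> (real \<Rightarrow> complex ^ 'n) \<Rightarrow> complex" where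
  "index_form T p q r x y =
     (LINT t:{0..T}|lebesgue.
        cinner (p t *v L2_derivative T x t + q t *v x t) (L2_derivative T y t)
      + cinner (adjoint_mat (q t) *v L2_derivative T x t) (y t)
      + cinner (r t *v x t) (y t))"

text \<open>Derivatives at the end points of \<open>S\<close> are one-sided.\<close>

definition C1_on :: "real set \<Rightarrow> (real \<Rightarrow> 'a::real_normed_vector) \<Rightarrow> bool" where
  "C1_on S f \<longleftrightarrow>
     (\<forall>t\<in>S. f differentiable (at t within S)) \<and>
     continuous_on S (\<lambda>t. vector_derivative f (at t within S))"

definition hamiltonian_mat ::
  "complex ^ 'n ^ 'n \<Rightarrow> complex ^ 'n ^ 'n \<Rightarrow> complex ^ 'n ^ 'n \<Rightarrow> complex ^ ('n::finite + 'n) ^ ('n + 'n)"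
  where
  "hamiltonian_mat p q r =
     block_mat
       (matrix_inv p)                       (- (matrix_inv p ** q))
       (- (adjoint_mat q ** matrix_inv p))  (adjoint_mat q ** matrix_inv p ** q - r)"

definition fundamental_solution ::
  "real \<Rightarrow> (real \<Rightarrow> complex ^ 'k ^ 'k) \<Rightarrow> (real \<Rightarrow> complex ^ 'k::finite ^ 'k) \<Rightarrow> bool" where
  "fundamental_solution T B \<gamma> \<longleftrightarrow>
     \<gamma> 0 = mat 1 \<and>
     (\<forall>t\<in>{0..T}. (\<gamma> has_vector_derivative (B t ** \<gamma> t)) (at t within {0..T}))"

end

theory Submission
  imports Defs
begin

text \<open>
  Write \<open>D(t) = diag (a(t)\<^sup>*\<^sup>-\<^sup>1, a(t))\<close> for the symplectic matrix by which the substitution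
  \<open>x \<mapsto> a x\<close> acts on phase space (momentum, position); it is \<open>cotangent_lift (a t)\<close> below. The
  identity of the two forms is the product rule for \<open>a x\<close> together with matrix algebra
  (\<open>product_rule_absolutely_continuous\<close>, \<open>index_form_transform\<close>). The index formula rests on three
  facts.

  \<^item> \<open>\<gamma>\<^sub>1'(t) = D(t)\<^sup>-\<^sup>1 \<gamma>\<^sub>1(t) D(0)\<close>: both sides solve the same Hamiltonian system
    (\<open>fundamental_solution_transform\<close>), and a solution is determined by its initial value because the
    symplectic pairing of two solutions is constant (\<open>fundamental_solution_unique\<close>). Moreover \<open>W(R')\<close>
    is the image of \<open>W(R)\<close> under \<open>diag (D(0)\<^sup>-\<^sup>1, D(T)\<^sup>-\<^sup>1)\<close> (\<open>WR_transformed_boundary\<close>).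

  \<^item> Spectral flow is a homotopy invariant up to what happens on the two lateral edges of the parameter
    rectangle (\<open>spectral_flow_homotopy\<close>). A unitary operator has an orthonormal eigenbasis, so the
    number of eigenvalues on an arc is the positive index of a Hermitian form that is affine in the
    operator; hence it is locally constant as long as no eigenvalue meets the end points of the arc
    (\<open>half_plane_count_locally_constant\<close>). This makes the flow independent of the partition and
    ties the flows of neighbouring paths to the behaviour at their end points.

  \<^item> Deform \<open>a\<close> to the constant path \<open>mat 1\<close> inside the invertible matrices, and carry \<open>D\<close> and the boundary
    condition along. The deformed pair of Lagrange paths is \<open>(Gr \<gamma>\<^sub>1', W(R'))\<close> at one end and
    \<open>(Gr \<gamma>\<^sub>1, W(R))\<close> at the other. On the edge \<open>t = T\<close> all pairs are symplectic images of
    \<open>(Gr (\<gamma>\<^sub>1 T), W(R))\<close>, so the multiplicity of the eigenvalue \<open>1\<close> is constant and nothing crosses.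
    On the edge \<open>t = 0\<close> the first member is the diagonal; reversing momenta is an antisymplectic
    symmetry of the pair, so the spectrum is symmetric under conjugation and exactly half of the change
    of the multiplicity of \<open>1\<close> crosses. For a boundary space \<open>R\<close> that multiplicity is
    \<open>n - dim R + 2 dim (Gr (mat 1) \<inter> R)\<close> (\<open>dim_Gr_id_Int_WR\<close>), and \<open>dim R\<close> does not change during the
    deformation. What remains is the difference of the dimensions of \<open>Gr (mat 1) \<inter> R'\<close> and
    \<open>Gr (mat 1) \<inter> R\<close>.
\<close>

section \<open>Hermitian inner product, adjoints and block matrices\<close>

lemma cinner_add_left: "cinner (x + y) z = cinner x z + cinner y z"
  and cinner_add_right: "cinner z (x + y) = cinner z x + cinner z y"
  and cinner_diff_left: "cinner (x - y) z = cinner x z - cinner y z"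
  and cinner_diff_right: "cinner z (x - y) = cinner z x - cinner z y"
  and cinner_minus_left: "cinner (- x) z = - cinner x z"
  and cinner_minus_right: "cinner z (- x) = - cinner z x"
  and cinner_scale_left: "cinner (c *s x) z = c * cinner x z"
  and cinner_scale_right: "cinner z (c *s x) = cnj c * cinner z x"
  and cinner_zero_left [simp]: "cinner 0 z = 0"
  and cinner_zero_right [simp]: "cinner z 0 = 0"
  by (simp_all add: cinner_def algebra_simps sum.distrib sum_subtractf sum_negf sum_distrib_left)

lemmas cinner_simps = cinner_add_left cinner_add_right cinner_diff_left cinner_diff_right
  cinner_minus_left cinner_minus_right cinner_scale_left cinner_scale_right

lemma cinner_commute: "cinner x y = cnj (cinner y x)"
  by (simp add: cinner_def mult.commute)

lemma cinner_sum_left: "cinner (\<Sum>i\<in>A. f i) z = (\<Sum>i\<in>A. cinner (f i) z)"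
  by (induction A rule: infinite_finite_induct) (auto simp: cinner_add_left)

lemma inner_eq_Re_cinner: "inner x y = Re (cinner x y)"
  by (simp add: inner_vec_def cinner_def inner_complex_def)

lemma cinner_self: "cinner x x = of_real ((norm x)\<^sup>2)"
proof -
  have "Im (cinner x x) = 0"
    by (simp add: cinner_def)
  moreover have "Re (cinner x x) = (norm x)\<^sup>2"
    by (simp add: inner_eq_Re_cinner[symmetric] power2_norm_eq_inner)
  ultimately show ?thesis
    by (simp add: complex_eq_iff)
qed

lemma cinner_self_eq_0 [simp]: "cinner x x = 0 \<longleftrightarrow> x = 0"
  by (simp add: cinner_self)

lemma cinner_eq_0_if_Re_eq_0:
  assumes "\<And>c. Re (cinner (c *s x) y) = 0"
  shows "cinner x y = 0"
  using assms[of 1] assms[of "\<i>"] by (simp add: cinner_scale_left complex_eq_iff)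

lemma norm_scale: "norm (c *s x) = norm c * norm (x :: complex ^ 'm::finite)"
proof -
  have "cinner (c *s x) (c *s x) = c * cnj c * cinner x x"
    by (simp add: cinner_simps)
  then have "complex_of_real ((norm (c *s x))\<^sup>2) = of_real ((norm c * norm x)\<^sup>2)"
    by (simp only: cinner_self complex_norm_square[symmetric]) (simp add: power_mult_distrib)
  then have "(norm (c *s x))\<^sup>2 = (norm c * norm x)\<^sup>2"
    by (simp only: of_real_eq_iff)
  then show ?thesis by simp
qed

lemma scaleR_eq_scale: "r *\<^sub>R x = complex_of_real r *s (x :: complex ^ 'm)"
  by (simp add: vec_eq_iff complex_eq_iff)

lemma cinner_adjoint: "cinner (A *v x) y = cinner x (adjoint_mat A *v y)"
proof -
  have "cinner (A *v x) y = (\<Sum>i\<in>UNIV. \<Sum>j\<in>UNIV. A $ i $ j * x $ j * cnj (y $ i))"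
    by (simp add: cinner_def matrix_vector_mult_def sum_distrib_right)
  also have "\<dots> = (\<Sum>j\<in>UNIV. \<Sum>i\<in>UNIV. A $ i $ j * x $ j * cnj (y $ i))"
    by (rule sum.swap)
  also have "\<dots> = cinner x (adjoint_mat A *v y)"
    by (simp add: cinner_def matrix_vector_mult_def adjoint_mat_def sum_distrib_left mult_ac)
  finally show ?thesis .
qed

lemma adjoint_mat_adjoint_mat [simp]: "adjoint_mat (adjoint_mat A) = A"
  by (simp add: adjoint_mat_def vec_eq_iff)

lemma adjoint_mat_mult: "adjoint_mat (A ** B) = adjoint_mat B ** adjoint_mat A"
  by (simp add: adjoint_mat_def matrix_matrix_mult_def vec_eq_iff mult.commute)

lemma adjoint_mat_add: "adjoint_mat (A + B) = adjoint_mat A + adjoint_mat B"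
  and adjoint_mat_diff: "adjoint_mat (A - B) = adjoint_mat A - adjoint_mat B"
  and adjoint_mat_minus: "adjoint_mat (- A) = - adjoint_mat A"
  and adjoint_mat_0 [simp]: "adjoint_mat 0 = 0"
  by (simp_all add: adjoint_mat_def vec_eq_iff)

lemma adjoint_mat_mat_1 [simp]: "adjoint_mat (mat 1) = mat 1"
  by (auto simp: adjoint_mat_def vec_eq_iff mat_def)

lemma matrix_mult_minus_left: "(- A) ** B = - (A ** B :: 'a::ring_1 ^ 'n ^ 'm)"
  and matrix_mult_minus_right: "A ** (- B) = - (A ** B :: 'a::ring_1 ^ 'n ^ 'm)"
  and matrix_mult_diff_left: "(A - A') ** B = A ** B - (A' ** B :: 'a::ring_1 ^ 'n ^ 'm)"
  and matrix_mult_diff_right: "A ** (B - B') = A ** B - (A ** B' :: 'a::ring_1 ^ 'n ^ 'm)"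
  and matrix_mult_add_left: "(A + A') ** B = A ** B + (A' ** B :: 'a::ring_1 ^ 'n ^ 'm)"
  and matrix_mult_add_right: "A ** (B + B') = A ** B + (A ** B' :: 'a::ring_1 ^ 'n ^ 'm)"
  by (simp_all add: matrix_matrix_mult_def vec_eq_iff algebra_simps sum.distrib sum_subtractf sum_negf)

lemma uminus_matrix_vector_mult: "(- A) *v x = - (A *v x :: complex ^ 'm)"
  by (simp add: matrix_vector_mult_def vec_eq_iff sum_negf)

lemmas matrix_mult_simps = matrix_mult_minus_left matrix_mult_minus_right matrix_mult_diff_left
  matrix_mult_diff_right matrix_mult_add_left matrix_mult_add_right

lemma matrix_mult_0_right [simp]: "A ** (0 :: 'a::semiring_1 ^ 'n ^ 'm) = 0"
  by (simp add: matrix_matrix_mult_def vec_eq_iff)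

lemma adjoint_mat_invertible:
  assumes "invertible A"
  shows "invertible (adjoint_mat A)"
  using assms unfolding invertible_def by (metis adjoint_mat_mult adjoint_mat_mat_1)

lemma invertible_matrix_inv:
  assumes "invertible (A :: complex ^ 'n ^ 'n)"
  shows "A ** matrix_inv A = mat 1" "matrix_inv A ** A = mat 1"
proof -
  have "A ** matrix_inv A = mat 1 \<and> matrix_inv A ** A = mat 1"
    unfolding matrix_inv_def by (rule someI_ex) (use assms in \<open>simp add: invertible_def\<close>)
  then show "A ** matrix_inv A = mat 1" "matrix_inv A ** A = mat 1" by auto
qed

lemma matrix_inv_eqI:
  assumes "A ** B = mat 1"
  shows "matrix_inv A = (B :: complex ^ 'n ^ 'n)"
proof -
  have "B ** A = mat 1"
    using assms by (simp add: matrix_left_right_inverse)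
  then have "invertible A"
    using assms by (auto simp: invertible_def)
  then have "matrix_inv A ** (A ** B) = B"
    by (simp add: matrix_mul_assoc invertible_matrix_inv)
  then show ?thesis using assms by simp
qed

lemma adjoint_mat_matrix_inv:
  assumes "invertible (A :: complex ^ 'n ^ 'n)"
  shows "adjoint_mat (matrix_inv A) = matrix_inv (adjoint_mat A)"
  by (rule matrix_inv_eqI[symmetric])
     (simp add: adjoint_mat_mult[symmetric] invertible_matrix_inv[OF assms])

lemma vjoin_nth [simp]: "vjoin x y $ Inl i = x $ i" "vjoin x y $ Inr j = y $ j"
  by (simp_all add: vjoin_def)

lemma vec_sum_eq_iff:
  "x = y \<longleftrightarrow> (\<forall>i. x $ Inl i = y $ Inl i) \<and> (\<forall>j. x $ Inr j = y $ Inr j)"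
  for x y :: "'a ^ ('k::finite + 'l::finite)"
  unfolding vec_eq_iff by (metis sum.exhaust)

lemma vjoin_eq_iff [simp]: "vjoin x y = vjoin x' y' \<longleftrightarrow> x = x' \<and> y = y'"
  unfolding vec_sum_eq_iff by (simp add: vec_eq_iff)

lemma vjoin_cases [case_names vjoin]:
  obtains x y where "z = vjoin x y"
proof
  show "z = vjoin (\<chi> i. z $ Inl i) (\<chi> j. z $ Inr j)"
    by (simp add: vec_sum_eq_iff)
qed

lemma vjoin_add: "vjoin x y + vjoin x' y' = vjoin (x + x') (y + y')"
  and vjoin_minus: "- vjoin u v = vjoin (- u) (- v)"
  and vjoin_scale: "c *s vjoin p q = vjoin (c *s p) (c *s q)"
  and vjoin_zero: "vjoin 0 0 = 0"
  by (simp_all add: vec_sum_eq_iff)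

lemma vjoin_eq_0_iff [simp]: "vjoin x y = 0 \<longleftrightarrow> x = 0 \<and> y = 0"
  using vjoin_eq_iff[of x y 0 0] by (simp add: vjoin_zero del: vjoin_eq_iff)

lemma sum_UNIV_sum:
  "(\<Sum>i\<in>UNIV. f i) = (\<Sum>i\<in>UNIV. f (Inl i)) + (\<Sum>j\<in>UNIV. f (Inr j))"
  for f :: "'k::finite + 'l::finite \<Rightarrow> 'a::comm_monoid_add"
  unfolding UNIV_sum by (subst sum.union_disjoint) (auto simp: sum.reindex)

lemma cinner_vjoin: "cinner (vjoin x y) (vjoin x' y') = cinner x x' + cinner y y'"
  by (simp add: cinner_def sum_UNIV_sum)

lemma block_mat_nth [simp]:
  "block_mat A B C D $ Inl i $ Inl j = A $ i $ j"
  "block_mat A B C D $ Inl i $ Inr j' = B $ i $ j'"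
  "block_mat A B C D $ Inr i' $ Inl j = C $ i' $ j"
  "block_mat A B C D $ Inr i' $ Inr j' = D $ i' $ j'"
  by (simp_all add: block_mat_def)

lemma mat_sum_eq_iff:
  "M = N \<longleftrightarrow> (\<forall>i j. M $ Inl i $ Inl j = N $ Inl i $ Inl j) \<and> (\<forall>i j. M $ Inl i $ Inr j = N $ Inl i $ Inr j)
    \<and> (\<forall>i j. M $ Inr i $ Inl j = N $ Inr i $ Inl j) \<and> (\<forall>i j. M $ Inr i $ Inr j = N $ Inr i $ Inr j)"
  for M N :: "'a ^ ('k::finite + 'l::finite) ^ ('k + 'l)"
  unfolding vec_sum_eq_iff vec_eq_iff by (metis sum.exhaust)

lemma block_mat_vjoin: "block_mat A B C D *v vjoin x y = vjoin (A *v x + B *v y) (C *v x + D *v y)"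
  by (simp add: vec_sum_eq_iff matrix_vector_mult_def sum_UNIV_sum)

lemma block_mat_mult:
  "block_mat A B C D ** block_mat A' B' C' D' =
     block_mat (A ** A' + B ** C') (A ** B' + B ** D') (C ** A' + D ** C') (C ** B' + D ** D')"
  by (simp add: mat_sum_eq_iff matrix_matrix_mult_def sum_UNIV_sum)

lemma adjoint_block_mat:
  "adjoint_mat (block_mat A B C D) =
     block_mat (adjoint_mat A) (adjoint_mat C) (adjoint_mat B) (adjoint_mat D)"
  by (simp add: mat_sum_eq_iff adjoint_mat_def)

lemma block_mat_add: "block_mat A B C D + block_mat A' B' C' D' = block_mat (A + A') (B + B') (C + C') (D + D')"
  and block_mat_minus: "- block_mat A B C D = block_mat (- A) (- B) (- C) (- D)"
  by (simp_all add: mat_sum_eq_iff)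

lemma mat_1_block: "(mat 1 :: 'a::zero_neq_one ^ ('k::finite + 'l::finite) ^ ('k + 'l)) = block_mat (mat 1) 0 0 (mat 1)"
  by (simp add: mat_sum_eq_iff mat_def)

section \<open>Continuity and derivatives of matrix-valued functions\<close>

lemma bounded_bilinear_matrix_mult:
  "bounded_bilinear ((**) :: complex ^ 'n::finite ^ 'm::finite \<Rightarrow> complex ^ 'p::finite ^ 'n \<Rightarrow> complex ^ 'p ^ 'm)"
  unfolding bilinear_conv_bounded_bilinear[symmetric] bilinear_def
  by (auto intro!: linearI simp: matrix_matrix_mult_def vec_eq_iff algebra_simps sum.distrib scaleR_sum_right)

lemma bounded_bilinear_matrix_vector_mult:
  "bounded_bilinear ((*v) :: complex ^ 'n::finite ^ 'm::finite \<Rightarrow> complex ^ 'n \<Rightarrow> complex ^ 'm)"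
  unfolding bilinear_conv_bounded_bilinear[symmetric] bilinear_def
  by (auto intro!: linearI simp: matrix_vector_mult_def vec_eq_iff algebra_simps sum.distrib scaleR_sum_right)

lemma bounded_linear_adjoint_mat:
  "bounded_linear (adjoint_mat :: complex ^ 'n::finite ^ 'm::finite \<Rightarrow> _)"
  unfolding linear_conv_bounded_linear[symmetric]
  by (auto intro!: linearI simp: adjoint_mat_def vec_eq_iff)

lemmas continuous_on_matrix_mult [continuous_intros] =
  bounded_bilinear.continuous_on[OF bounded_bilinear_matrix_mult]
lemmas continuous_on_matrix_vector [continuous_intros] =
  bounded_bilinear.continuous_on[OF bounded_bilinear_matrix_vector_mult]
lemmas continuous_on_adjoint_mat [continuous_intros] =
  bounded_linear.continuous_on[OF bounded_linear_adjoint_mat]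

lemma continuous_on_mat_iff:
  "continuous_on S f \<longleftrightarrow> (\<forall>i j. continuous_on S (\<lambda>x. f x $ i $ j))"
  for f :: "'a::topological_space \<Rightarrow> complex ^ 'n::finite ^ 'm::finite"
proof
  assume "\<forall>i j. continuous_on S (\<lambda>x. f x $ i $ j)"
  then have "continuous_on S (\<lambda>x. \<chi> i j. f x $ i $ j)"
    by (intro continuous_on_vec_lambda) auto
  then show "continuous_on S f"
    by simp
qed (auto intro!: continuous_on_component)

lemma continuous_on_block_mat [continuous_intros]:
  assumes "continuous_on S A" "continuous_on S B" "continuous_on S C" "continuous_on S D"
  shows "continuous_on S (\<lambda>x. block_mat (A x) (B x) (C x) (D x :: complex ^ 'l::finite ^ 'l) :: complex ^ ('k::finite + 'l) ^ ('k + 'l))"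
  unfolding continuous_on_mat_iff
proof (intro allI)
  fix i j :: "'k + 'l"
  show "continuous_on S (\<lambda>x. block_mat (A x) (B x) (C x) (D x) $ i $ j)"
    using assms unfolding continuous_on_mat_iff by (cases i; cases j) auto
qed

lemma continuous_on_det [continuous_intros]:
  "continuous_on S f \<Longrightarrow> continuous_on S (\<lambda>x. det (f x :: complex ^ 'n::finite ^ 'n))"
  unfolding det_def by (auto intro!: continuous_intros continuous_on_component)

text \<open>Cramer's rule exhibits the entries of the inverse as quotients of determinants.\<close>

lemma continuous_on_matrix_inv [continuous_intros]:
  fixes f :: "'a::topological_space \<Rightarrow> complex ^ 'n::finite ^ 'n"
  assumes "continuous_on S f" and inv: "\<And>x. x \<in> S \<Longrightarrow> invertible (f x)"
  shows "continuous_on S (\<lambda>x. matrix_inv (f x))"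
  unfolding continuous_on_mat_iff
proof (intro allI)
  fix k j :: 'n
  define m where "m x = (\<chi> i l. if l = k then axis j 1 $ i else f x $ i $ l)" for x
  have "continuous_on S m"
    unfolding m_def
  proof (intro continuous_on_vec_lambda)
    show "continuous_on S (\<lambda>x. if l = k then axis j 1 $ i else f x $ i $ l)" for i l
      using assms(1) by (cases "l = k") (auto intro!: continuous_on_component)
  qed
  then have "continuous_on S (\<lambda>x. det (m x) / det (f x))"
    using inv assms(1) by (auto intro!: continuous_intros simp: invertible_det_nz)
  also have "continuous_on S (\<lambda>x. det (m x) / det (f x)) \<longleftrightarrow> continuous_on S (\<lambda>x. matrix_inv (f x) $ k $ j)"
  proof (rule continuous_on_cong)
    fix x assume x: "x \<in> S"
    have "f x *v (matrix_inv (f x) *v axis j 1) = axis j 1"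
      by (simp add: matrix_vector_mul_assoc invertible_matrix_inv inv x)
    then have "matrix_inv (f x) *v axis j 1 =
        (\<chi> k. det (\<chi> i l. if l = k then axis j 1 $ i else f x $ i $ l) / det (f x))"
      using cramer[of "f x"] inv[OF x] by (auto simp: invertible_det_nz)
    then have "(matrix_inv (f x) *v axis j 1) $ k = det (m x) / det (f x)"
      by (simp add: m_def)
    then show "det (m x) / det (f x) = matrix_inv (f x) $ k $ j"
      by (simp add: matrix_vector_mult_def axis_def if_distrib[of "(*) _"] cong: if_cong)
  qed auto
  finally show "continuous_on S (\<lambda>x. matrix_inv (f x) $ k $ j)" .
qed

lemma has_vector_derivative_iff_quotient:
  "(f has_vector_derivative f') (at x within S) \<longleftrightarrow>
     ((\<lambda>y. (f y - f x) /\<^sub>R (y - x)) \<longlongrightarrow> f') (at x within S)"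
proof -
  have "norm (f y - f x - (y - x) *\<^sub>R f') / norm (y - x) = norm ((f y - f x) /\<^sub>R (y - x) - f')"
    if "y \<noteq> x" for y
  proof -
    have "(f y - f x) /\<^sub>R (y - x) - f' = (f y - f x - (y - x) *\<^sub>R f') /\<^sub>R (y - x)"
      using that by (simp add: scaleR_diff_right)
    then show ?thesis by (simp add: divide_inverse mult.commute)
  qed
  then have "((\<lambda>y. norm (f y - f x - (y - x) *\<^sub>R f') / norm (y - x)) \<longlongrightarrow> 0) (at x within S) \<longleftrightarrow>
      ((\<lambda>y. norm ((f y - f x) /\<^sub>R (y - x) - f')) \<longlongrightarrow> 0) (at x within S)"
    by (intro tendsto_cong) (auto simp: eventually_at_filter)
  then show ?thesis
    unfolding has_vector_derivative_def has_derivative_iff_norm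
    by (simp add: bounded_linear_scaleR_left tendsto_norm_zero_iff LIM_zero_iff)
qed

text \<open>The difference quotient of the inverse is \<open>- a(s)\<^sup>-\<^sup>1 \<Delta> a(t)\<^sup>-\<^sup>1\<close> with \<open>\<Delta>\<close> the difference quotient
  of \<open>a\<close>, so continuity of the inverse suffices.\<close>

lemma has_vector_derivative_matrix_inv:
  fixes a :: "real \<Rightarrow> complex ^ 'n::finite ^ 'n"
  assumes der: "(a has_vector_derivative a') (at t within S)" and t: "t \<in> S"
    and cont: "continuous_on S a" and inv: "\<And>t. t \<in> S \<Longrightarrow> invertible (a t)"
  shows "((\<lambda>t. matrix_inv (a t)) has_vector_derivative - (matrix_inv (a t) ** a' ** matrix_inv (a t)))
           (at t within S)"
proof -
  let ?b = "\<lambda>t. matrix_inv (a t)"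
  have "continuous_on S ?b"
    by (intro continuous_intros cont inv)
  then have b: "(?b \<longlongrightarrow> ?b t) (at t within S)"
    using t by (auto simp: continuous_on_def)
  have quot: "((\<lambda>s. (a s - a t) /\<^sub>R (s - t)) \<longlongrightarrow> a') (at t within S)"
    using der by (simp add: has_vector_derivative_iff_quotient)
  have "((\<lambda>s. - (?b s ** ((a s - a t) /\<^sub>R (s - t)) ** ?b t)) \<longlongrightarrow> - (?b t ** a' ** ?b t)) (at t within S)"
    by (intro tendsto_minus bounded_bilinear.tendsto[OF bounded_bilinear_matrix_mult] b quot tendsto_const)
  moreover have "\<forall>\<^sub>F s in at t within S. - (?b s ** ((a s - a t) /\<^sub>R (s - t)) ** ?b t) = (?b s - ?b t) /\<^sub>R (s - t)"
    unfolding eventually_at_filter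
  proof (intro always_eventually allI impI)
    fix s assume s: "s \<noteq> t" "s \<in> S"
    have "?b s ** (a s - a t) ** ?b t = ?b t - ?b s"
      by (simp add: matrix_mult_simps invertible_matrix_inv inv s t flip: matrix_mul_assoc)
    moreover have "?b s ** ((a s - a t) /\<^sub>R (s - t)) ** ?b t = (?b s ** (a s - a t) ** ?b t) /\<^sub>R (s - t)"
      using bounded_bilinear.scaleR_left[OF bounded_bilinear_matrix_mult]
        bounded_bilinear.scaleR_right[OF bounded_bilinear_matrix_mult] by metis
    ultimately show "- (?b s ** ((a s - a t) /\<^sub>R (s - t)) ** ?b t) = (?b s - ?b t) /\<^sub>R (s - t)"
      by (simp flip: scaleR_minus_right)
  qed
  ultimately show ?thesis
    by (simp add: has_vector_derivative_iff_quotient tendsto_cong)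
qed

section \<open>Functions with a square integrable derivative\<close>

lemma L2_imp_absolutely_integrable:
  fixes g :: "real \<Rightarrow> 'b::euclidean_space"
  assumes "set_borel_measurable lebesgue {a..b} g" "set_integrable lebesgue {a..b} (\<lambda>t. (norm (g t))\<^sup>2)"
  shows "g absolutely_integrable_on {a..b}"
proof -
  have "(\<lambda>t. 1 + (norm (g t))\<^sup>2) absolutely_integrable_on {a..b}"
    using assms(2) by (intro set_integral_add) auto
  then have "integrable lebesgue (\<lambda>t. indicator {a..b} t *\<^sub>R (1 + (norm (g t))\<^sup>2))"
    by (simp add: set_integrable_def)
  moreover have "(\<lambda>t. indicator {a..b} t *\<^sub>R g t) \<in> borel_measurable lebesgue"
    using assms(1) by (simp add: set_borel_measurable_def)
  moreover have "norm (g t) \<le> 1 + (norm (g t))\<^sup>2" for t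
  proof -
    have "0 \<le> (norm (g t) - 1)\<^sup>2" by simp
    then show ?thesis
      using norm_ge_zero[of "g t"] by (simp add: power2_diff del: norm_ge_zero)
  qed
  then have "AE t in lebesgue. norm (indicator {a..b} t *\<^sub>R g t) \<le> norm (indicator {a..b} t *\<^sub>R (1 + (norm (g t))\<^sup>2))"
    by (auto simp: indicator_def)
  ultimately have "integrable lebesgue (\<lambda>t. indicator {a..b} t *\<^sub>R g t)"
    by (rule Bochner_Integration.integrable_bound)
  then show ?thesis
    by (simp add: set_integrable_def)
qed

lemma has_L2_derivative_absolutely_integrable:
  assumes "has_L2_derivative T x g" "0 \<le> u" "v \<le> T"
  shows "g absolutely_integrable_on {u..v}"
proof -
  have "g absolutely_integrable_on {0..T}"
    using assms(1) unfolding has_L2_derivative_def by (blast intro: L2_imp_absolutely_integrable)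
  then show ?thesis
    by (rule absolutely_integrable_on_subinterval) (use assms in auto)
qed

lemma has_L2_derivative_integral:
  assumes "has_L2_derivative T x g" "0 \<le> u" "u \<le> v" "v \<le> T"
  shows "x v - x u = integral {u..v} g"
proof -
  have abs: "g absolutely_integrable_on {s..t}" if "0 \<le> s" "t \<le> T" for s t
    using has_L2_derivative_absolutely_integrable[OF assms(1)] that by auto
  have x: "x t = x 0 + integral {0..t} g" if "0 \<le> t" "t \<le> T" for t
  proof -
    have "\<forall>t\<in>{0..T}. x t = x 0 + (LINT s:{0..t}|lebesgue. g s)"
      using assms(1) unfolding has_L2_derivative_def by blast
    moreover have "(LINT s:{0..t}|lebesgue. g s) = integral {0..t} g"
      using abs[of 0 t] that by (intro set_lebesgue_integral_eq_integral(2)) auto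
    ultimately show ?thesis
      using that by (metis atLeastAtMost_iff)
  qed
  have "integral {0..u} g + integral {u..v} g = integral {0..v} g"
    using assms abs[of 0 v] by (intro Henstock_Kurzweil_Integration.integral_combine)
      (auto intro: set_lebesgue_integral_eq_integral(1))
  then have "integral {0..v} g - integral {0..u} g = integral {u..v} g"
    by (metis add_diff_cancel_left')
  then show ?thesis
    using x[of u] x[of v] assms by simp
qed

lemma has_L2_derivative_continuous:
  assumes "has_L2_derivative T x g"
  shows "continuous_on {0..T} x"
proof -
  have "continuous_on {0..T} (\<lambda>t. integral {0..t} g)"
    using has_L2_derivative_absolutely_integrable[OF assms, of 0 T]
    by (intro indefinite_integral_continuous_1 set_lebesgue_integral_eq_integral(1)) auto
  then have "continuous_on {0..T} (\<lambda>t. x 0 + integral {0..t} g)"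
    by (intro continuous_intros)
  also have "?this \<longleftrightarrow> ?thesis"
  proof (intro continuous_on_cong refl)
    show "x 0 + integral {0..t} g = x t" if "t \<in> {0..T}" for t
      using has_L2_derivative_integral[OF assms, of 0 t] that
      by (metis add.commute atLeastAtMost_iff diff_add_cancel order_refl)
  qed
  finally show ?thesis .
qed

text \<open>The difference of two weak derivatives of \<open>x\<close> integrates to \<open>0\<close> over every interval. An indefinite
  integral is differentiable almost everywhere with the integrand as derivative, so the difference
  vanishes almost everywhere.\<close>

lemma has_L2_derivative_unique:
  assumes g: "has_L2_derivative T x g" and h: "has_L2_derivative T x h"
  shows "AE t in lebesgue. t \<in> {0..T} \<longrightarrow> g t = h t"
proof -
  define f where "f t = (if t \<in> {0..T} then g t - h t else 0)" for t
  have zero: "(f has_integral 0) {a..b}" for a b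
  proof -
    define u v where "u = max a 0" "v = min b T"
    have "((\<lambda>t. g t - h t) has_integral 0) {u..v}"
    proof (cases "u \<le> v")
      case True
      have int: "g integrable_on {u..v}" "h integrable_on {u..v}"
        using has_L2_derivative_absolutely_integrable[OF g, of u v] has_L2_derivative_absolutely_integrable[OF h, of u v]
        by (auto simp: u_v_def intro: set_lebesgue_integral_eq_integral(1))
      have "integral {u..v} g = integral {u..v} h"
        using has_L2_derivative_integral[OF g, of u v] has_L2_derivative_integral[OF h, of u v] True
        by (simp add: u_v_def)
      then show ?thesis
        using has_integral_diff[OF integrable_integral[OF int(1)] integrable_integral[OF int(2)]] by simp
    qed auto
    then have "((\<lambda>t. if t \<in> {u..v} then g t - h t else 0) has_integral 0) {a..b}"
      by (intro has_integral_restrict[THEN iffD2]) (auto simp: u_v_def)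
    then show ?thesis
      by (rule has_integral_eq[rotated]) (auto simp: f_def u_v_def)
  qed
  obtain N where N: "negligible N"
      "\<And>x e. \<lbrakk>x \<notin> N; 0 < e\<rbrakk> \<Longrightarrow> \<exists>d>0. \<forall>h. 0 < h \<and> h < d \<longrightarrow>
          norm (integral (cbox x (x + h *\<^sub>R One)) f /\<^sub>R h ^ DIM(real) - f x) < e"
  proof (rule integrable_ccontinuous_explicit[of f])
    show "f integrable_on cbox a b" for a b
      using zero[of a b] by (auto simp: has_integral_integrable)
  qed (rule that)
  have "f t = 0" if "t \<notin> N" for t
  proof (rule ccontr)
    assume "f t \<noteq> 0"
    then obtain d where d: "d > 0" "\<And>h. 0 < h \<Longrightarrow> h < d \<Longrightarrow>
        norm (integral (cbox t (t + h *\<^sub>R One)) f /\<^sub>R h ^ DIM(real) - f t) < norm (f t)"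
      using N(2)[OF \<open>t \<notin> N\<close>, of "norm (f t)"] by auto
    show False
      using d(2)[of "d / 2"] d(1) integral_unique[OF zero[of t "t + d / 2"]] by simp
  qed
  then have "{t. \<not> (t \<in> {0..T} \<longrightarrow> g t = h t)} \<subseteq> N"
    unfolding f_def by (metis (mono_tags, lifting) mem_Collect_eq right_minus_eq subsetI)
  then have "negligible {t. \<not> (t \<in> {0..T} \<longrightarrow> g t = h t)}"
    using N(1) negligible_subset by blast
  then show ?thesis
    by (auto simp: negligible_iff_null_sets intro: AE_I')
qed

lemma L2_derivative_has:
  assumes "x \<in> H1 T"
  shows "has_L2_derivative T x (L2_derivative T x)"
  using assms someI_ex[of "has_L2_derivative T x"] unfolding H1_def L2_derivative_def by blast

lemma C1_on_has_vector_derivative: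
  assumes "C1_on S a" "t \<in> S"
  shows "(a has_vector_derivative vector_derivative a (at t within S)) (at t within S)"
  using assms by (simp add: C1_on_def vector_derivative_works)

lemma C1_on_imp_continuous_on:
  assumes "C1_on S a"
  shows "continuous_on S a"
  using assms unfolding C1_on_def
  by (auto intro!: differentiable_imp_continuous_on simp: differentiable_on_def)

text \<open>The increment over \<open>[u,v]\<close> of the difference of both sides is an integral over \<open>[u,v]\<close> of
  terms containing \<open>a v - a s\<close> or \<open>x u - x s\<close>, so locally it is at most a small multiple of the
  increment of \<open>\<integral>(norm g + 1)\<close>. Such bounds add up over adjacent intervals.\<close>

lemma product_rule_absolutely_continuous:
  fixes a :: "real \<Rightarrow> complex ^ 'n::finite ^ 'm::finite" and x :: "real \<Rightarrow> complex ^ 'n"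
  assumes a: "\<And>t. t \<in> {0..T} \<Longrightarrow> (a has_vector_derivative a' t) (at t within {0..T})"
    and a': "continuous_on {0..T} a'"
    and x: "has_L2_derivative T x g"
  shows "(\<lambda>s. a' s *v x s + a s *v g s) absolutely_integrable_on {0..T}"
    and "\<And>t. t \<in> {0..T} \<Longrightarrow>
      integral {0..t} (\<lambda>s. a' s *v x s + a s *v g s) = a t *v x t - a 0 *v x 0"
proof -
  define f where "f = (\<lambda>s. a' s *v x s + a s *v g s)"
  have cont_a: "continuous_on {0..T} a"
    by (rule continuous_on_vector_derivative[OF a])
  have cont_x: "continuous_on {0..T} x"
    by (rule has_L2_derivative_continuous[OF x])
  have g: "g absolutely_integrable_on {0..T}"
    by (rule has_L2_derivative_absolutely_integrable[OF x]) auto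
  have f: "f absolutely_integrable_on {0..T}"
    unfolding f_def
  proof (rule set_integral_add(1))
    show "(\<lambda>s. a' s *v x s) absolutely_integrable_on {0..T}"
      by (intro absolutely_integrable_continuous_real continuous_intros a' cont_x)
    show "(\<lambda>s. a s *v g s) absolutely_integrable_on {0..T}"
    proof (rule absolutely_integrable_bounded_measurable_product[where h = "(*v)" and f = a, OF _ _ _ _ g])
      show "bilinear ((*v) :: complex ^ 'n ^ 'm \<Rightarrow> _)"
        using bounded_bilinear_matrix_vector_mult by (simp add: bilinear_conv_bounded_bilinear)
      show "bounded (a ` {0..T})"
        by (intro compact_imp_bounded compact_continuous_image cont_a) auto
    qed (auto intro!: continuous_imp_measurable_on_sets_lebesgue cont_a)
  qed
  then show "(\<lambda>s. a' s *v x s + a s *v g s) absolutely_integrable_on {0..T}"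
    by (simp add: f_def)
  have f_int: "f integrable_on {u..v}" and g_int: "g integrable_on {u..v}"
    and ng_int: "(\<lambda>s. norm (g s) + 1) integrable_on {u..v}" if "0 \<le> u" "v \<le> T" for u v
  proof -
    have "f absolutely_integrable_on {u..v}" "g absolutely_integrable_on {u..v}"
      by (rule absolutely_integrable_on_subinterval[OF f] absolutely_integrable_on_subinterval[OF g],
          use that in auto)+
    then show "f integrable_on {u..v}" "g integrable_on {u..v}" "(\<lambda>s. norm (g s) + 1) integrable_on {u..v}"
      by (auto simp: absolutely_integrable_on_def intro!: integrable_add)
  qed
  obtain K where K: "K > 0" "\<And>(A :: complex ^ 'n ^ 'm) y. norm (A *v y) \<le> norm A * norm y * K"
    using bounded_bilinear.pos_bounded[OF bounded_bilinear_matrix_vector_mult] by blast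
  obtain M where M: "M > 0" "\<And>s. s \<in> {0..T} \<Longrightarrow> norm (a' s) \<le> M"
  proof -
    have "bounded (a' ` {0..T})"
      by (intro compact_imp_bounded compact_continuous_image a') auto
    then show thesis
      using that by (auto simp: bounded_pos)
  qed
  define \<Delta> where "\<Delta> u v = a v *v x v - a u *v x u - integral {u..v} f" for u v
  have \<Delta>_eq: "((\<lambda>s. (a v - a s) *v g s + a' s *v (x u - x s)) has_integral \<Delta> u v) {u..v}"
    if uv: "0 \<le> u" "u \<le> v" "v \<le> T" for u v
  proof -
    have "((\<lambda>s. a v *v g s) has_integral a v *v (x v - x u)) {u..v}"
      using has_integral_linear[OF integrable_integral[OF g_int[OF uv(1,3)]],
          OF bounded_bilinear.bounded_linear_right[OF bounded_bilinear_matrix_vector_mult, of "a v"]]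
      by (simp add: has_L2_derivative_integral[OF x uv] o_def)
    moreover have "(a' has_integral a v - a u) {u..v}"
      using uv by (intro fundamental_theorem_of_calculus)
        (auto intro!: has_vector_derivative_within_subset[OF a])
    then have "((\<lambda>s. a' s *v x u) has_integral (a v - a u) *v x u) {u..v}"
      using has_integral_linear[OF _ bounded_bilinear.bounded_linear_left[OF bounded_bilinear_matrix_vector_mult, of "x u"]]
      by (force simp: o_def)
    ultimately have "((\<lambda>s. a v *v g s + a' s *v x u - f s) has_integral
        (a v *v (x v - x u) + (a v - a u) *v x u - integral {u..v} f)) {u..v}"
      by (intro has_integral_diff has_integral_add integrable_integral f_int uv)
    then show ?thesis
      by (simp add: f_def \<Delta>_def matrix_vector_mult_diff_distrib matrix_vector_mult_diff_rdistrib algebra_simps)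
  qed
  have bound: "0 \<le> u \<longrightarrow> v \<le> T \<longrightarrow> norm (\<Delta> u v) \<le> e * integral {u..v} (\<lambda>s. norm (g s) + 1)"
    if "e > 0" "u \<le> v" for e u v
    using \<open>u \<le> v\<close>
  proof (induction rule: Bolzano)
    case (trans u v w)
    show ?case
    proof (intro impI)
      assume "0 \<le> u" "w \<le> T"
      have "\<Delta> u w = \<Delta> u v + \<Delta> v w"
        using Henstock_Kurzweil_Integration.integral_combine[of u v w f] f_int[of u w] trans
          \<open>0 \<le> u\<close> \<open>w \<le> T\<close> unfolding \<Delta>_def by (simp add: algebra_simps)
      then have "norm (\<Delta> u w) \<le> norm (\<Delta> u v) + norm (\<Delta> v w)"
        by (simp add: norm_triangle_ineq)
      also have "\<dots> \<le> e * integral {u..v} (\<lambda>s. norm (g s) + 1) + e * integral {v..w} (\<lambda>s. norm (g s) + 1)"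
        using trans \<open>0 \<le> u\<close> \<open>w \<le> T\<close> by (intro add_mono) auto
      also have "\<dots> = e * integral {u..w} (\<lambda>s. norm (g s) + 1)"
        using Henstock_Kurzweil_Integration.integral_combine[of u v w "\<lambda>s. norm (g s) + 1"] ng_int[of u w] trans
          \<open>0 \<le> u\<close> \<open>w \<le> T\<close> by (simp flip: distrib_left)
      finally show "norm (\<Delta> u w) \<le> e * integral {u..w} (\<lambda>s. norm (g s) + 1)" .
    qed
  next
    case (local z)
    show ?case
    proof (cases "z \<in> {0..T}")
      case False
      then have "\<forall>a b. a \<le> z \<and> z \<le> b \<longrightarrow> \<not> (0 \<le> a \<and> b \<le> T)"
        by auto
      then show ?thesis
        by (intro exI[of _ 1]) auto
    next
      case True
      \<comment> \<open>\<open>\<eta>\<close> bounds the oscillation of \<open>a\<close> and \<open>x\<close> near \<open>z\<close>; with it both error terms below are at most \<open>e\<close>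
        times the corresponding term of \<open>norm (g s) + 1\<close>.\<close>
      define \<eta> where "\<eta> = e / (2 * K * (M + 1))"
      have "\<eta> > 0"
        using \<open>e > 0\<close> K(1) M(1) by (simp add: \<eta>_def)
      moreover have "2 * K * \<eta> + 2 * K * \<eta> * M = (2 * K * (M + 1)) * \<eta>"
        by (simp add: algebra_simps)
      then have "2 * K * \<eta> + 2 * K * \<eta> * M = e"
        using K(1) M(1) by (simp add: \<eta>_def)
      moreover have "0 \<le> 2 * K * \<eta>" "0 \<le> 2 * K * \<eta> * M"
        using K(1) M(1) \<open>\<eta> > 0\<close> by auto
      ultimately have \<eta>: "\<eta> > 0" "2 * K * \<eta> \<le> e" "2 * K * \<eta> * M \<le> e"
        by linarith+
      obtain d1 where d1: "d1 > 0" "\<And>s. s \<in> {0..T} \<Longrightarrow> dist s z < d1 \<Longrightarrow> dist (a s) (a z) < \<eta>"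
        using cont_a True \<eta>(1) unfolding continuous_on_iff by blast
      obtain d2 where d2: "d2 > 0" "\<And>s. s \<in> {0..T} \<Longrightarrow> dist s z < d2 \<Longrightarrow> dist (x s) (x z) < \<eta>"
        using cont_x True \<eta>(1) unfolding continuous_on_iff by blast
      show ?thesis
      proof (intro exI[of _ "min d1 d2"] conjI allI impI)
        fix u v assume uv: "u \<le> z \<and> z \<le> v \<and> v - u < min d1 d2" "0 \<le> u" "v \<le> T"
        have near: "norm (a v - a s) \<le> 2 * \<eta>" "norm (x u - x s) \<le> 2 * \<eta>" if s: "s \<in> {u..v}" for s
        proof -
          have *: "dist s z < min d1 d2" "dist u z < min d1 d2" "dist v z < min d1 d2"
            "s \<in> {0..T}" "u \<in> {0..T}" "v \<in> {0..T}"
            using uv s by (auto simp: dist_real_def)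
          have "dist (a v) (a z) < \<eta>" "dist (a s) (a z) < \<eta>" "dist (x u) (x z) < \<eta>" "dist (x s) (x z) < \<eta>"
            using * d1(2) d2(2) by auto
          then have "dist (a v) (a s) \<le> 2 * \<eta>" "dist (x u) (x s) \<le> 2 * \<eta>"
            using dist_triangle2[of "a v" "a s" "a z"] dist_triangle2[of "x u" "x s" "x z"] by linarith+
          then show "norm (a v - a s) \<le> 2 * \<eta>" "norm (x u - x s) \<le> 2 * \<eta>"
            by (auto simp: dist_norm)
        qed
        have \<Delta>': "((\<lambda>s. (a v - a s) *v g s + a' s *v (x u - x s)) has_integral \<Delta> u v) {u..v}"
          using uv by (intro \<Delta>_eq) auto
        have "norm (integral {u..v} (\<lambda>s. (a v - a s) *v g s + a' s *v (x u - x s)))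
            \<le> integral {u..v} (\<lambda>s. e * (norm (g s) + 1))"
        proof (rule integral_norm_bound_integral)
          fix s assume s: "s \<in> {u..v}"
          have "norm ((a v - a s) *v g s) \<le> (2 * \<eta>) * norm (g s) * K"
            by (rule order_trans[OF K(2)]) (use near[OF s] K(1) in \<open>intro mult_right_mono, auto\<close>)
          also have "\<dots> \<le> e * norm (g s)"
            using mult_right_mono[OF \<eta>(2), of "norm (g s)"] by (simp add: mult_ac)
          finally have 1: "norm ((a v - a s) *v g s) \<le> e * norm (g s)" .
          have "norm (a' s *v (x u - x s)) \<le> norm (a' s) * norm (x u - x s) * K"
            by (rule K(2))
          also have "\<dots> \<le> M * (2 * \<eta>) * K"
            using near[OF s] M(2)[of s] s uv K(1) M(1) by (intro mult_right_mono mult_mono) auto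
          also have "\<dots> \<le> e"
            using \<eta>(3) by (simp add: mult_ac)
          finally have "norm (a' s *v (x u - x s)) \<le> e" .
          with 1 show "norm ((a v - a s) *v g s + a' s *v (x u - x s)) \<le> e * (norm (g s) + 1)"
            using norm_triangle_ineq[of "(a v - a s) *v g s" "a' s *v (x u - x s)"]
            by (simp add: algebra_simps)
        qed (use \<Delta>' ng_int uv in \<open>auto simp: has_integral_integrable intro!: integrable_on_mult_right\<close>)
        then show "norm (\<Delta> u v) \<le> e * integral {u..v} (\<lambda>s. norm (g s) + 1)"
          using integral_unique[OF \<Delta>'] by simp
      qed (use d1 d2 in auto)
    qed
  qed
  show "integral {0..t} (\<lambda>s. a' s *v x s + a s *v g s) = a t *v x t - a 0 *v x 0" if t: "t \<in> {0..T}" for t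
  proof -
    have "norm (\<Delta> 0 t) \<le> 0"
    proof (rule field_le_epsilon)
      fix e :: real assume "e > 0"
      define G where "G = integral {0..t} (\<lambda>s. norm (g s) + 1)"
      have "G \<ge> 0"
        unfolding G_def using ng_int[of 0 t] t by (intro integral_nonneg) auto
      then have "norm (\<Delta> 0 t) \<le> e / (G + 1) * G"
        using bound[of "e / (G + 1)" 0 t] \<open>e > 0\<close> t by (simp add: G_def)
      also have "\<dots> \<le> e"
        using \<open>e > 0\<close> \<open>G \<ge> 0\<close> by (simp add: field_simps)
      finally show "norm (\<Delta> 0 t) \<le> 0 + e" by simp
    qed
    then show ?thesis
      by (simp add: \<Delta>_def f_def)
  qed
qed

lemma bounded_bilinear_cinner: "bounded_bilinear (cinner :: complex ^ 'n::finite \<Rightarrow> _)"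
  unfolding bilinear_conv_bounded_bilinear[symmetric] bilinear_def
  by (auto intro!: linearI simp: cinner_simps scaleR_eq_scale scaleR_conv_of_real)

lemma borel_measurable_bounded_bilinear:
  fixes prd :: "'b::{second_countable_topology,real_normed_vector} \<Rightarrow>
      'c::{second_countable_topology,real_normed_vector} \<Rightarrow> 'd::real_normed_vector"
  assumes "bounded_bilinear prd"
    and "f \<in> borel_measurable M" "g \<in> borel_measurable M"
  shows "(\<lambda>x. prd (f x) (g x)) \<in> borel_measurable M"
  by (rule borel_measurable_continuous_Pair[OF assms(2,3)])
     (intro bounded_bilinear.continuous_on[OF assms(1)] continuous_intros)

lemma set_borel_measurable_eq_lebesgue_on:
  fixes f :: "real \<Rightarrow> 'b::euclidean_space"
  shows "set_borel_measurable lebesgue {0..T} f \<longleftrightarrow> f \<in> borel_measurable (lebesgue_on {0..T})"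
  unfolding set_borel_measurable_def
  by (rule borel_measurable_restrict_space_iff[symmetric]) simp

lemma set_integral_eq_lebesgue_on:
  fixes f :: "real \<Rightarrow> 'b::euclidean_space"
  shows "(LINT t:{0..T}|lebesgue. f t) = integral\<^sup>L (lebesgue_on {0..T}) f"
  unfolding set_lebesgue_integral_def
  by (rule integral_restrict_space[symmetric]) simp

lemma has_L2_derivative_mult:
  fixes a :: "real \<Rightarrow> complex ^ 'n::finite ^ 'm::finite" and x :: "real \<Rightarrow> complex ^ 'n"
  assumes a: "\<And>t. t \<in> {0..T} \<Longrightarrow> (a has_vector_derivative a' t) (at t within {0..T})"
    and a': "continuous_on {0..T} a'"
    and x: "has_L2_derivative T x g"
  shows "has_L2_derivative T (\<lambda>t. a t *v x t) (\<lambda>t. a' t *v x t + a t *v g t)"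
proof -
  define f where "f = (\<lambda>s. a' s *v x s + a s *v g s)"
  have f: "f absolutely_integrable_on {0..T}"
    unfolding f_def by (rule product_rule_absolutely_continuous(1)[OF a a' x])
  have meas: "f \<in> borel_measurable (lebesgue_on {0..T})"
    using borel_measurable_integrable[OF f[unfolded set_integrable_def]]
    by (simp add: set_borel_measurable_eq_lebesgue_on[symmetric] set_borel_measurable_def)
  have "continuous_on {0..T} a"
    by (rule continuous_on_vector_derivative[OF a])
  then have "bounded (a ` {0..T})"
    by (intro compact_imp_bounded compact_continuous_image) auto
  then obtain A where A: "\<And>s. s \<in> {0..T} \<Longrightarrow> norm (a s) \<le> A" "A > 0"
    unfolding bounded_pos by blast
  have "continuous_on {0..T} (\<lambda>s. a' s *v x s)"
    by (intro continuous_intros a' has_L2_derivative_continuous[OF x])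
  then have "bounded ((\<lambda>s. a' s *v x s) ` {0..T})"
    by (intro compact_imp_bounded compact_continuous_image) auto
  then obtain B where B: "\<And>s. s \<in> {0..T} \<Longrightarrow> norm (a' s *v x s) \<le> B" "B > 0"
    unfolding bounded_pos by blast
  obtain K where K: "K > 0" "\<And>(A :: complex ^ 'n ^ 'm) y. norm (A *v y) \<le> norm A * norm y * K"
    using bounded_bilinear.pos_bounded[OF bounded_bilinear_matrix_vector_mult] by blast
  have bound: "(norm (f s))\<^sup>2 \<le> 2 * B\<^sup>2 + 2 * (A * K)\<^sup>2 * (norm (g s))\<^sup>2" if s: "s \<in> {0..T}" for s
  proof -
    have "norm (a s *v g s) \<le> A * norm (g s) * K"
      by (rule order_trans[OF K(2)]) (use A(1)[OF s] K(1) in \<open>intro mult_right_mono, auto\<close>)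
    then have "norm (f s) \<le> B + A * K * norm (g s)"
      using norm_triangle_ineq[of "a' s *v x s" "a s *v g s"] B(1)[OF s] by (simp add: f_def mult_ac)
    then have "(norm (f s))\<^sup>2 \<le> (B + A * K * norm (g s))\<^sup>2"
      by (intro power_mono) auto
    also have "\<dots> \<le> 2 * B\<^sup>2 + 2 * (A * K * norm (g s))\<^sup>2"
      using zero_le_power2[of "B - A * K * norm (g s)"] by (simp add: power2_sum power2_diff)
    finally show ?thesis by (simp add: power_mult_distrib)
  qed
  have "set_integrable lebesgue {0..T} (\<lambda>s. 2 * B\<^sup>2 + 2 * (A * K)\<^sup>2 * (norm (g s))\<^sup>2)"
    using x unfolding has_L2_derivative_def by (intro set_integral_add set_integrable_mult_right) auto
  then have "integrable (lebesgue_on {0..T}) (\<lambda>s. 2 * B\<^sup>2 + 2 * (A * K)\<^sup>2 * (norm (g s))\<^sup>2)"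
    by (simp add: set_integrable_def integrable_restrict_space)
  then have "integrable (lebesgue_on {0..T}) (\<lambda>s. (norm (f s))\<^sup>2)"
  proof (rule Bochner_Integration.integrable_bound)
    show "(\<lambda>s. (norm (f s))\<^sup>2) \<in> borel_measurable (lebesgue_on {0..T})"
      using meas by measurable
    show "AE s in lebesgue_on {0..T}. norm ((norm (f s))\<^sup>2) \<le> norm (2 * B\<^sup>2 + 2 * (A * K)\<^sup>2 * (norm (g s))\<^sup>2)"
      using bound by (intro AE_I2) (auto intro: order_trans)
  qed
  then have sq: "set_integrable lebesgue {0..T} (\<lambda>s. (norm (f s))\<^sup>2)"
    by (simp add: set_integrable_def integrable_restrict_space)
  have "a t *v x t = a 0 *v x 0 + (LINT s:{0..t}|lebesgue. f s)" if t: "t \<in> {0..T}" for t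
  proof -
    have "f absolutely_integrable_on {0..t}"
      by (rule absolutely_integrable_on_subinterval[OF f]) (use t in auto)
    then have "(LINT s:{0..t}|lebesgue. f s) = integral {0..t} f"
      by (rule set_lebesgue_integral_eq_integral(2))
    also have "\<dots> = a t *v x t - a 0 *v x 0"
      unfolding f_def by (rule product_rule_absolutely_continuous(2)[OF a a' x t])
    finally show ?thesis by simp
  qed
  then show ?thesis
    using meas sq unfolding has_L2_derivative_def set_borel_measurable_eq_lebesgue_on f_def by blast
qed

lemma index_form_integrand_transform:
  fixes A A' P Q S :: "complex ^ 'n::finite ^ 'n"
  assumes "adjoint_mat P = P"
  shows "cinner (P *v (A' *v X + A *v d) + Q *v (A *v X)) (A' *v Y + A *v e)
      + cinner (adjoint_mat Q *v (A' *v X + A *v d)) (A *v Y)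
      + cinner (S *v (A *v X)) (A *v Y)
    = cinner ((adjoint_mat A ** P ** A) *v d + (adjoint_mat A ** P ** A' + adjoint_mat A ** Q ** A) *v X) e
      + cinner (adjoint_mat (adjoint_mat A ** P ** A' + adjoint_mat A ** Q ** A) *v d) Y
      + cinner ((adjoint_mat A' ** P ** A' + adjoint_mat A' ** Q ** A
              + adjoint_mat A ** adjoint_mat Q ** A' + adjoint_mat A ** S ** A) *v X) Y"
proof -
  have move: "cinner x (B *v y) = cinner (adjoint_mat B *v x) y" for x y and B :: "complex ^ 'n ^ 'n"
    using cinner_adjoint[of "adjoint_mat B"] by simp
  show ?thesis
    by (simp add: cinner_simps move matrix_vector_right_distrib matrix_vector_mult_add_rdistrib
        matrix_vector_mul_assoc adjoint_mat_add adjoint_mat_mult assms matrix_mul_assoc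
        matrix_mult_add_right matrix_mult_add_left)
qed

lemma index_form_integrand_measurable:
  assumes "continuous_on {0..T} p" "continuous_on {0..T} q" "continuous_on {0..T} r"
    and x: "has_L2_derivative T x g" and y: "has_L2_derivative T y h"
  shows "(\<lambda>t. cinner (p t *v g t + q t *v x t) (h t) + cinner (adjoint_mat (q t) *v g t) (y t)
      + cinner (r t *v x t) (y t)) \<in> borel_measurable (lebesgue_on {0..T})"
proof -
  have meas: "f \<in> borel_measurable (lebesgue_on {0..T})" if "continuous_on {0..T} f"
    for f :: "real \<Rightarrow> 'b::euclidean_space"
    by (rule continuous_imp_measurable_on_sets_lebesgue[OF that]) simp
  have gh: "g \<in> borel_measurable (lebesgue_on {0..T})" "h \<in> borel_measurable (lebesgue_on {0..T})"
    using x y by (auto simp: has_L2_derivative_def set_borel_measurable_eq_lebesgue_on)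
  show ?thesis
    by (intro borel_measurable_add gh meas assms continuous_on_adjoint_mat
        borel_measurable_bounded_bilinear[OF bounded_bilinear_matrix_vector_mult]
        borel_measurable_bounded_bilinear[OF bounded_bilinear_cinner]
        has_L2_derivative_continuous[OF x] has_L2_derivative_continuous[OF y])
qed

text \<open>\<open>L2_derivative\<close> is determined only almost everywhere, so the integrands agree only almost
  everywhere, and the comparison of the integrals requires their measurability.\<close>

lemma index_form_transform:
  fixes a :: "real \<Rightarrow> complex ^ 'n::finite ^ 'n"
  assumes a: "C1_on {0..T} a" and da: "\<And>t. t \<in> {0..T} \<Longrightarrow> da t = vector_derivative a (at t within {0..T})"
    and p: "continuous_on {0..T} p" and q: "continuous_on {0..T} q" and r: "continuous_on {0..T} r"
    and p_herm: "\<And>t. t \<in> {0..T} \<Longrightarrow> p t = adjoint_mat (p t)"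
    and p': "\<And>t. t \<in> {0..T} \<Longrightarrow> p' t = adjoint_mat (a t) ** p t ** a t"
    and q': "\<And>t. t \<in> {0..T} \<Longrightarrow>
        q' t = adjoint_mat (a t) ** p t ** da t + adjoint_mat (a t) ** q t ** a t"
    and r': "\<And>t. t \<in> {0..T} \<Longrightarrow>
        r' t = adjoint_mat (da t) ** p t ** da t + adjoint_mat (da t) ** q t ** a t
              + adjoint_mat (a t) ** adjoint_mat (q t) ** da t + adjoint_mat (a t) ** r t ** a t"
    and x: "x \<in> H1 T" and y: "y \<in> H1 T"
  shows "index_form T p q r (\<lambda>t. a t *v x t) (\<lambda>t. a t *v y t) = index_form T p' q' r' x y"
proof -
  have der: "(a has_vector_derivative da t) (at t within {0..T})" if "t \<in> {0..T}" for t
    unfolding da[OF that] by (rule C1_on_has_vector_derivative[OF a that])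
  have cont_a: "continuous_on {0..T} a"
    by (rule C1_on_imp_continuous_on[OF a])
  have "continuous_on {0..T} (\<lambda>t. vector_derivative a (at t within {0..T}))"
    using a by (simp add: C1_on_def)
  then have cont_da: "continuous_on {0..T} da"
    by (subst continuous_on_cong[OF refl da])
  define ax ay where "ax = (\<lambda>t. a t *v x t)" and "ay = (\<lambda>t. a t *v y t)"
  have Lx: "has_L2_derivative T x (L2_derivative T x)" and Ly: "has_L2_derivative T y (L2_derivative T y)"
    by (rule L2_derivative_has, fact)+
  have dax: "has_L2_derivative T ax (\<lambda>t. da t *v x t + a t *v L2_derivative T x t)"
    and day: "has_L2_derivative T ay (\<lambda>t. da t *v y t + a t *v L2_derivative T y t)"
    unfolding ax_def ay_def by (rule has_L2_derivative_mult[OF der cont_da], assumption, fact)+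
  then have Lax: "has_L2_derivative T ax (L2_derivative T ax)" and Lay: "has_L2_derivative T ay (L2_derivative T ay)"
    by (blast intro: L2_derivative_has[unfolded H1_def, OF CollectI])+
  have cont': "continuous_on {0..T} p'" "continuous_on {0..T} q'" "continuous_on {0..T} r'"
    by (subst continuous_on_cong[OF refl p'] continuous_on_cong[OF refl q'] continuous_on_cong[OF refl r'],
        assumption, intro continuous_intros p q r cont_a cont_da)+
  show ?thesis
    unfolding index_form_def set_integral_eq_lebesgue_on ax_def[symmetric] ay_def[symmetric]
  proof (rule Bochner_Integration.integral_cong_AE)
    have "AE t in lebesgue_on {0..T}. L2_derivative T ax t = da t *v x t + a t *v L2_derivative T x t"
      "AE t in lebesgue_on {0..T}. L2_derivative T ay t = da t *v y t + a t *v L2_derivative T y t"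
      using has_L2_derivative_unique[OF Lax dax] has_L2_derivative_unique[OF Lay day]
      by (simp_all add: AE_restrict_space_iff)
    moreover have "AE t in lebesgue_on {0..T}. t \<in> {0..T}"
      by (rule AE_I2) simp
    ultimately show "AE t in lebesgue_on {0..T}.
        cinner (p t *v L2_derivative T ax t + q t *v ax t) (L2_derivative T ay t)
        + cinner (adjoint_mat (q t) *v L2_derivative T ax t) (ay t) + cinner (r t *v ax t) (ay t)
      = cinner (p' t *v L2_derivative T x t + q' t *v x t) (L2_derivative T y t)
        + cinner (adjoint_mat (q' t) *v L2_derivative T x t) (y t) + cinner (r' t *v x t) (y t)"
    proof eventually_elim
      case (elim t)
      have "adjoint_mat (p t) = p t"
        using p_herm[OF elim(3)] by simp
      moreover have "ax t = a t *v x t" "ay t = a t *v y t"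
        by (simp_all add: ax_def ay_def)
      ultimately show ?case
        by (simp only: index_form_integrand_transform elim(1,2) p'[OF elim(3)] q'[OF elim(3)] r'[OF elim(3)])
    qed
  qed (intro index_form_integrand_measurable p q r Lax Lay Lx Ly cont')+
qed

section \<open>Orthogonal complements and orthonormal sets\<close>

lemma vec_subspace_imp_subspace:
  assumes "vec.subspace (S :: (complex ^ 'm::finite) set)"
  shows "subspace S"
  using assms by (auto simp: subspace_def vec.subspace_def scaleR_eq_scale)

text \<open>The real orthogonal projection serves: a vector that is real-orthogonal to a complex subspace is
  real-orthogonal to \<open>\<i> *s v\<close> too, for every \<open>v\<close> in it, and so Hermitian-orthogonal.\<close>

lemma orthogonal_projection_exists:
  assumes S: "vec.subspace (S :: (complex ^ 'm::finite) set)"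
  obtains s where "s \<in> S" "\<And>v. v \<in> S \<Longrightarrow> cinner (x - s) v = 0"
proof -
  have span: "span S = S"
    using vec_subspace_imp_subspace[OF S] by (simp add: span_eq_iff)
  obtain y z where yz: "y \<in> span S" "\<And>w. w \<in> span S \<Longrightarrow> orthogonal z w" "x = y + z"
    using orthogonal_subspace_decomp_exists by blast
  have "cinner z v = 0" if "v \<in> S" for v
  proof -
    have "Re (cinner (c *s v) z) = 0" for c
    proof -
      have "c *s v \<in> S"
        using S that by (rule vec.subspace_scale)
      then have "orthogonal z (c *s v)"
        using yz(2) span by auto
      then show ?thesis
        by (simp add: orthogonal_def inner_commute flip: inner_eq_Re_cinner)
    qed
    then show ?thesis
      using cinner_eq_0_if_Re_eq_0[of v z] cinner_commute[of z v] by simp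
  qed
  then show thesis
    using that[of y] yz span by simp
qed

lemma vec_subspace_orth_compl: "vec.subspace (orth_compl R)"
  unfolding vec.subspace_def orth_compl_def by (auto simp: cinner_simps)

lemma orth_compl_orth_compl:
  assumes "vec.subspace R"
  shows "orth_compl (orth_compl R) = R"
proof
  show "R \<subseteq> orth_compl (orth_compl R)"
  proof
    fix x assume "x \<in> R"
    then have "cinner x w = 0" if "w \<in> orth_compl R" for w
      using that cinner_commute[of x w] by (simp add: orth_compl_def)
    then show "x \<in> orth_compl (orth_compl R)"
      by (simp add: orth_compl_def)
  qed
  show "orth_compl (orth_compl R) \<subseteq> R"
  proof
    fix w assume w: "w \<in> orth_compl (orth_compl R)"
    obtain s where s: "s \<in> R" "\<And>v. v \<in> R \<Longrightarrow> cinner (w - s) v = 0"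
      using orthogonal_projection_exists[OF assms, of w] by blast
    then have "w - s \<in> orth_compl R"
      by (simp add: orth_compl_def)
    then have "cinner w (w - s) = 0"
      using w by (simp add: orth_compl_def)
    moreover have "cinner s (w - s) = 0"
      using s cinner_commute[of s "w - s"] by simp
    ultimately have "cinner (w - s) (w - s) = 0"
      by (simp add: cinner_diff_left)
    then show "w \<in> R"
      using s(1) by simp
  qed
qed

lemma vec_dim_UNIV: "vec.dim (UNIV :: (complex ^ 'm::finite) set) = CARD('m)"
  by (rule vec_dim_card)

lemma dim_orth_compl:
  fixes R :: "(complex ^ 'm::finite) set"
  assumes "vec.subspace R"
  shows "vec.dim R + vec.dim (orth_compl R) = CARD('m)"
proof -
  have "R \<inter> orth_compl R = {0}"
    using vec.subspace_0[OF assms] by (auto simp: orth_compl_def)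
  then have zero: "vec.dim (R \<inter> orth_compl R) = 0"
    by simp
  have UNIV: "{x + y |x y. x \<in> R \<and> y \<in> orth_compl R} = UNIV"
  proof -
    have "w \<in> {x + y |x y. x \<in> R \<and> y \<in> orth_compl R}" for w
    proof -
      obtain s where "s \<in> R" "\<And>v. v \<in> R \<Longrightarrow> cinner (w - s) v = 0"
        using orthogonal_projection_exists[OF assms, of w] by blast
      then have "w = s + (w - s)" "s \<in> R" "w - s \<in> orth_compl R"
        by (auto simp: orth_compl_def)
      then show ?thesis by blast
    qed
    then show ?thesis by auto
  qed
  show ?thesis
    using vec.dim_sums_Int[OF assms vec_subspace_orth_compl[of R]] unfolding zero UNIV vec_dim_UNIV by simp
qed

definition orthonormal_set :: "(complex ^ 'm::finite) set \<Rightarrow> bool" where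
  "orthonormal_set B \<longleftrightarrow> finite B \<and> (\<forall>b\<in>B. cinner b b = 1) \<and> (\<forall>b\<in>B. \<forall>c\<in>B. b \<noteq> c \<longrightarrow> cinner b c = 0)"

lemma orthonormal_set_subset: "orthonormal_set B \<Longrightarrow> C \<subseteq> B \<Longrightarrow> orthonormal_set C"
  unfolding orthonormal_set_def by (auto intro: finite_subset)

lemma cinner_sum_orthonormal:
  assumes "orthonormal_set B" "b \<in> B"
  shows "cinner (\<Sum>c\<in>B. u c *s c) b = u b"
proof -
  have "cinner (\<Sum>c\<in>B. u c *s c) b = (\<Sum>c\<in>B. u c * cinner c b)"
    by (simp add: cinner_sum_left cinner_scale_left)
  also have "\<dots> = (\<Sum>c\<in>B. if c = b then u b else 0)"
    using assms by (intro sum.cong) (auto simp: orthonormal_set_def)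
  also have "\<dots> = u b"
    using assms by (simp add: orthonormal_set_def)
  finally show ?thesis .
qed

lemma orthonormal_independent:
  assumes "orthonormal_set B"
  shows "vec.independent B"
proof -
  have "finite B" using assms by (simp add: orthonormal_set_def)
  moreover have "u v = 0" if "(\<Sum>c\<in>B. u c *s c) = 0" "v \<in> B" for u v
    using cinner_sum_orthonormal[OF assms that(2), of u] that(1) by simp
  ultimately show ?thesis
    by (auto simp: vec.dependent_finite)
qed

lemma dim_span_orthonormal: "orthonormal_set B \<Longrightarrow> vec.dim (vec.span B) = card B"
  using vec.dim_span_eq_card_independent[OF orthonormal_independent] .

lemma orthonormal_expansion:
  assumes "orthonormal_set B" "x \<in> vec.span B"
  shows "x = (\<Sum>b\<in>B. cinner x b *s b)"
proof -
  have "finite B" using assms by (simp add: orthonormal_set_def)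
  then obtain u where u: "x = (\<Sum>b\<in>B. u b *s b)"
    using assms(2) by (auto simp: vec.span_finite)
  show ?thesis
    by (subst u, rule sum.cong) (simp_all add: u cinner_sum_orthonormal[OF assms(1)])
qed

lemma norm_orthonormal_expansion:
  assumes "orthonormal_set B" "x \<in> vec.span B"
  shows "(norm x)\<^sup>2 = (\<Sum>b\<in>B. (norm (cinner x b))\<^sup>2)"
proof -
  have "cinner x x = (\<Sum>b\<in>B. cinner x b * cinner b x)"
    by (subst orthonormal_expansion[OF assms]) (simp add: cinner_sum_left cinner_scale_left)
  also have "\<dots> = (\<Sum>b\<in>B. of_real ((norm (cinner x b))\<^sup>2))"
    by (intro sum.cong refl) (metis cinner_commute complex_norm_square of_real_power)
  finally have "complex_of_real ((norm x)\<^sup>2) = of_real (\<Sum>b\<in>B. (norm (cinner x b))\<^sup>2)"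
    by (simp add: cinner_self)
  then show ?thesis
    by (simp only: of_real_eq_iff)
qed

section \<open>Unitary operators on a subspace\<close>

lemma unitary_isoD:
  assumes "unitary_iso X Y U"
  shows "x \<in> X \<Longrightarrow> U x \<in> Y"
    and "x \<in> X \<Longrightarrow> y \<in> X \<Longrightarrow> U (x + y) = U x + U y"
    and "x \<in> X \<Longrightarrow> U (c *s x) = c *s U x"
    and "x \<in> X \<Longrightarrow> y \<in> X \<Longrightarrow> cinner (U x) (U y) = cinner x y"
    and "x \<in> X \<Longrightarrow> norm (U x) = norm x"
    and "x \<in> X \<Longrightarrow> y \<in> X \<Longrightarrow> inner (U x) (U y) = inner x y"
    and "inj_on U X" and "U ` X = Y"
proof -
  show *: "x \<in> X \<Longrightarrow> y \<in> X \<Longrightarrow> cinner (U x) (U y) = cinner x y" for x y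
    using assms by (auto simp: unitary_iso_def)
  then show "x \<in> X \<Longrightarrow> y \<in> X \<Longrightarrow> inner (U x) (U y) = inner x y" for x y
    by (simp add: inner_eq_Re_cinner)
  then show "x \<in> X \<Longrightarrow> norm (U x) = norm x"
    by (simp add: norm_eq_sqrt_inner)
qed (use assms in \<open>auto simp: unitary_iso_def bij_betw_def\<close>)

lemma unitary_iso_diff:
  assumes "unitary_iso X Y U" "vec.subspace X" "x \<in> X" "y \<in> X"
  shows "U (x - y) = U x - U y"
proof -
  have "U (x + (-1) *s y) = U x + (-1) *s U y"
    using assms vec.subspace_scale by (metis unitary_isoD(2,3))
  then show ?thesis by simp
qed

lemma unitary_iso_zero:
  assumes "unitary_iso X Y U" "vec.subspace X"
  shows "U 0 = 0"
  using unitary_isoD(5)[OF assms(1) vec.subspace_0[OF assms(2)]] by simp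

lemma unitary_iso_sum:
  assumes U: "unitary_iso X Y U" and X: "vec.subspace X" and B: "finite B" "B \<subseteq> X"
  shows "U (\<Sum>b\<in>B. u b *s b) = (\<Sum>b\<in>B. u b *s U b)"
  using B
proof (induction B rule: finite_induct)
  case empty
  then show ?case using unitary_iso_zero[OF U X] by simp
next
  case (insert b B)
  have "(\<Sum>b\<in>B. u b *s b) \<in> X" "u b *s b \<in> X" "b \<in> X"
    using insert.prems X by (auto intro!: vec.subspace_sum vec.subspace_scale)
  then show ?case
    using insert unitary_isoD(2,3)[OF U] by simp
qed

text \<open>A maximiser \<open>x\<close> of \<open>inner (V x) x\<close> on the unit sphere of \<open>X\<close> is a critical point, which says
  \<open>V x + V\<inverse> x = 2c x\<close> with \<open>c\<close> the maximum. So \<open>x\<close> is annihilated by the quadratic polynomial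
  \<open>(V - \<mu>) (V - cnj \<mu>)\<close>, and \<open>x\<close> or \<open>V x - \<mu> x\<close> is an eigenvector.\<close>

lemma unitary_eigenvector_exists:
  assumes V: "unitary_iso X X V" and X: "vec.subspace X" "X \<noteq> {0}"
  obtains x \<mu> where "x \<in> X" "x \<noteq> 0" "V x = \<mu> *s x"
proof -
  have lin: "V (x + t *\<^sub>R y) = V x + t *\<^sub>R V y" "x + t *\<^sub>R y \<in> X" if "x \<in> X" "y \<in> X" for x y t
    using that X(1) unitary_isoD(2,3)[OF V]
    by (simp_all add: scaleR_eq_scale vec.subspace_add vec.subspace_scale)
  define S where "S = X \<inter> sphere 0 1"
  have "compact S"
    unfolding S_def using vec_subspace_imp_subspace[OF X(1)]
    by (intro closed_Int_compact closed_subspace) auto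
  moreover have "S \<noteq> {}"
  proof -
    obtain y where y: "y \<in> X" "y \<noteq> 0"
      using X vec.subspace_0 by blast
    then have "(1 / norm y) *\<^sub>R y \<in> S"
      unfolding S_def using X(1) by (auto simp: scaleR_eq_scale vec.subspace_scale norm_scale norm_divide)
    then show ?thesis by auto
  qed
  moreover have "continuous_on S V"
    unfolding continuous_on_iff
  proof (intro ballI allI impI)
    fix x e assume x: "x \<in> S" and e: "(0::real) < e"
    have "dist (V y) (V x) = dist y x" if "y \<in> S" for y
      using that x unitary_iso_diff[OF V X(1), of y x] unitary_isoD(5)[OF V, of "y - x"] X(1)
      by (simp add: S_def dist_norm vec.subspace_diff)
    then show "\<exists>d>0. \<forall>x'\<in>S. dist x' x < d \<longrightarrow> dist (V x') (V x) < e"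
      using e by auto
  qed
  then have "continuous_on S (\<lambda>x. inner (V x) x)"
    by (intro continuous_intros)
  ultimately obtain x where x: "x \<in> S" and max: "\<And>y. y \<in> S \<Longrightarrow> inner (V y) y \<le> inner (V x) x"
    using continuous_attains_sup[of S "\<lambda>x. inner (V x) x"] by blast
  have xX: "x \<in> X" and nx: "norm x = 1"
    using x by (auto simp: S_def)
  define c where "c = inner (V x) x"
  have F: "0 \<le> c * inner y y - inner (V y) y" if y: "y \<in> X" for y
  proof (cases "y = 0")
    case False
    have "V ((1 / norm y) *\<^sub>R y) = (1 / norm y) *\<^sub>R V y" "(1 / norm y) *\<^sub>R y \<in> X"
      using lin[of 0 y "1 / norm y"] y vec.subspace_0[OF X(1)] unitary_iso_zero[OF V X(1)] by auto
    moreover from this have "(1 / norm y) *\<^sub>R y \<in> S"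
      using False by (simp add: S_def)
    ultimately have "inner (V y) y / (norm y)\<^sup>2 \<le> c"
      using max[of "(1 / norm y) *\<^sub>R y"] by (simp add: c_def power2_eq_square)
    then show ?thesis
      using False by (simp add: field_simps power2_norm_eq_inner)
  qed (use unitary_iso_zero[OF V X(1)] in auto)
  obtain w where w: "w \<in> X" "V w = x"
    using unitary_isoD(8)[OF V] xX by (metis imageE)
  define z where "z = (2 * c) *\<^sub>R x - V x - w"
  have zX: "z \<in> X"
    unfolding z_def using X(1) xX w(1) unitary_isoD(1)[OF V xX]
    by (auto intro!: vec.subspace_diff vec.subspace_scale simp: scaleR_eq_scale)
  have "0 \<le> t * inner z z + t\<^sup>2 * (c * inner z z - inner (V z) z)" for t
  proof -
    have "inner (V z) x = inner z w"
      using unitary_isoD(6)[OF V zX w(1)] w(2) by simp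
    then have "inner z z = 2 * c * inner x z - inner (V x) z - inner (V z) x"
      using inner_diff_left[of "(2 * c) *\<^sub>R x - V x" w z] inner_diff_left[of "(2 * c) *\<^sub>R x" "V x" z]
      unfolding z_def[symmetric] by (simp add: inner_commute)
    moreover have "0 \<le> c * inner (x + t *\<^sub>R z) (x + t *\<^sub>R z) - inner (V x + t *\<^sub>R V z) (x + t *\<^sub>R z)"
      using F[OF lin(2)[OF xX zX]] lin(1)[OF xX zX] by simp
    moreover have "inner x x = 1"
      using nx by (simp add: norm_eq_sqrt_inner)
    then have "c * inner (x + t *\<^sub>R z) (x + t *\<^sub>R z) - inner (V x + t *\<^sub>R V z) (x + t *\<^sub>R z)
        = t * (2 * c * inner x z - inner (V x) z - inner (V z) x) + t\<^sup>2 * (c * inner z z - inner (V z) z)"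
      by (simp add: inner_add_left inner_add_right c_def[symmetric] inner_commute[of z x]
          algebra_simps power2_eq_square)
    ultimately show ?thesis
      by simp
  qed
  note quad = this
  have "inner z z = 0"
  proof (rule ccontr)
    assume "inner z z \<noteq> 0"
    then have A: "inner z z > 0" by auto
    \<comment> \<open>For small negative \<open>t\<close> the linear term of \<open>quad\<close> dominates.\<close>
    define D where "D = \<bar>c * inner z z - inner (V z) z\<bar> + 1"
    have D: "D > 0" "c * inner z z - inner (V z) z < D" by (auto simp: D_def)
    define t where "t = - inner z z / D"
    have "t\<^sup>2 * (c * inner z z - inner (V z) z) < t\<^sup>2 * D"
      using D A by (intro mult_strict_left_mono) (auto simp: t_def)
    also have "t\<^sup>2 * D = - t * inner z z"
      using D by (simp add: t_def power2_eq_square)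
    finally show False using quad[of t] by linarith
  qed
  then have "z = 0" by simp
  then have Vx: "V x + w = complex_of_real (2 * c) *s x"
    by (simp add: z_def scaleR_eq_scale algebra_simps)
  have "V (V x + w) = complex_of_real (2 * c) *s V x"
    unfolding Vx by (rule unitary_isoD(3)[OF V xX])
  then have VVx: "V (V x) = complex_of_real (2 * c) *s V x - x"
    using unitary_isoD(2)[OF V, of "V x" w] unitary_isoD(1)[OF V xX] w by (simp add: algebra_simps)
  have "\<bar>c\<bar> \<le> 1"
    using Cauchy_Schwarz_ineq2[of "V x" x] unitary_isoD(5)[OF V xX] nx by (simp add: c_def)
  then have c2: "c\<^sup>2 \<le> 1" by (simp add: abs_square_le_1)
  define \<mu> where "\<mu> = Complex c (sqrt (1 - c\<^sup>2))"
  have mu: "complex_of_real (2 * c) - \<mu> = cnj \<mu>" "cnj \<mu> * \<mu> = 1"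
    using c2 by (auto simp: \<mu>_def complex_eq_iff power2_eq_square)
  define y where "y = V x - \<mu> *s x"
  show thesis
  proof (cases "y = 0")
    case True
    moreover have "x \<noteq> 0" using nx by auto
    ultimately show thesis using that[of x \<mu>] xX by (simp add: y_def)
  next
    case False
    have "V y = V (V x) - \<mu> *s V x"
      using unitary_iso_diff[OF V X(1), of "V x" "\<mu> *s x"] unitary_isoD(1,3)[OF V xX] xX X(1)
      by (simp add: y_def vec.subspace_scale)
    also have "\<dots> = (complex_of_real (2 * c) - \<mu>) *s V x - x"
      by (simp add: VVx vector_sub_rdistrib)
    also have "\<dots> = cnj \<mu> *s V x - (cnj \<mu> * \<mu>) *s x"
      by (simp only: mu) simp
    also have "\<dots> = cnj \<mu> *s y"
      by (simp add: y_def vec_eq_iff algebra_simps)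
    finally show thesis
      using that[of y "cnj \<mu>"] False xX X(1) unitary_isoD(1)[OF V xX]
      by (simp add: y_def vec.subspace_diff vec.subspace_scale)
  qed
qed

definition eigenbasis ::
  "(complex ^ 'm::finite) set \<Rightarrow> (complex ^ 'm \<Rightarrow> complex ^ 'm) \<Rightarrow> (complex ^ 'm) set \<Rightarrow> (complex ^ 'm \<Rightarrow> complex) \<Rightarrow> bool"
  where
  "eigenbasis X V B ev \<longleftrightarrow>
     orthonormal_set B \<and> vec.span B = X \<and> (\<forall>b\<in>B. V b = ev b *s b \<and> norm (ev b) = 1)"

text \<open>The orthogonal complement of an eigenvector is invariant under a unitary operator.\<close>

lemma unitary_eigenbasis_exists:
  assumes "unitary_iso X X V" "vec.subspace X"
  shows "\<exists>B ev. eigenbasis X V B ev"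
  using assms
proof (induction "vec.dim X" arbitrary: X rule: less_induct)
  case less
  note V = less.prems(1) and X = less.prems(2)
  show ?case
  proof (cases "X = {0}")
    case True
    then have "eigenbasis X V {} (\<lambda>_. 1)"
      by (simp add: eigenbasis_def orthonormal_set_def)
    then show ?thesis by blast
  next
    case False
    obtain e0 \<mu> where e0: "e0 \<in> X" "e0 \<noteq> 0" "V e0 = \<mu> *s e0"
      using unitary_eigenvector_exists[OF V X False] by blast
    define e where "e = (1 / complex_of_real (norm e0)) *s e0"
    have eX: "e \<in> X"
      unfolding e_def by (rule vec.subspace_scale[OF X e0(1)])
    have ne: "norm e = 1"
      using e0(2) by (simp add: e_def norm_scale norm_divide)
    have Ve: "V e = \<mu> *s e"
      using unitary_isoD(3)[OF V e0(1)] e0(3) by (simp add: e_def vec_eq_iff)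
    have nmu: "norm \<mu> = 1"
      using unitary_isoD(5)[OF V eX] ne by (simp add: Ve norm_scale)
    define X' where "X' = {x\<in>X. cinner x e = 0}"
    have X': "vec.subspace X'"
      using X unfolding X'_def vec.subspace_def by (auto simp: cinner_simps)
    have orth: "cinner (V x) e = 0 \<longleftrightarrow> cinner x e = 0" if "x \<in> X" for x
    proof -
      have "cnj \<mu> * cinner (V x) e = cinner x e"
        using unitary_isoD(4)[OF V that eX] by (simp add: Ve cinner_simps)
      then show ?thesis using nmu by auto
    qed
    have "V ` X' = X'"
    proof
      show "V ` X' \<subseteq> X'"
        using unitary_isoD(1)[OF V] orth by (auto simp: X'_def)
      show "X' \<subseteq> V ` X'"
      proof
        fix y assume y: "y \<in> X'"
        then obtain x where "x \<in> X" "y = V x"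
          using unitary_isoD(8)[OF V] unfolding X'_def by (metis (no_types, lifting) imageE mem_Collect_eq)
        then show "y \<in> V ` X'"
          using y orth by (auto simp: X'_def)
      qed
    qed
    then have V': "unitary_iso X' X' V"
      using V unfolding unitary_iso_def bij_betw_def by (auto simp: X'_def intro: inj_on_subset)
    have "X' \<subset> X"
    proof
      show "X' \<noteq> X"
        using eX ne by (auto simp: X'_def cinner_self[of e] dest!: equalityD2 subsetD[of _ _ e])
    qed (auto simp: X'_def)
    then have "vec.dim X' < vec.dim X"
      by (intro vec.dim_psubset) (simp add: vec.span_eq_iff[THEN iffD2] X X')
    then obtain B ev where B: "eigenbasis X' V B ev"
      using less.hyps[OF _ V' X'] by blast
    have BX': "B \<subseteq> X'"
      using B vec.span_superset by (auto simp: eigenbasis_def)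
    have eB: "e \<notin> B"
      using BX' ne cinner_self_eq_0[of e] by (auto simp: X'_def)
    have "cinner b e = 0 \<and> cinner e b = 0" if "b \<in> B" for b
      using that BX' cinner_commute[of e b] by (auto simp: X'_def)
    then have "orthonormal_set (insert e B)"
      using B ne by (auto simp: eigenbasis_def orthonormal_set_def cinner_self[of e])
    moreover have "vec.span (insert e B) = X"
    proof
      show "vec.span (insert e B) \<subseteq> X"
        using BX' eX by (intro vec.span_minimal X) (auto simp: X'_def)
      show "X \<subseteq> vec.span (insert e B)"
      proof
        fix x assume x: "x \<in> X"
        have "x - cinner x e *s e \<in> X'"
          using x eX X ne by (simp add: X'_def vec.subspace_diff vec.subspace_scale cinner_simps cinner_self[of e])
        then have "x - cinner x e *s e \<in> vec.span B"
          using B by (simp add: eigenbasis_def)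
        then show "x \<in> vec.span (insert e B)"
          by (auto simp: vec.span_insert)
      qed
    qed
    ultimately have "eigenbasis X V (insert e B) (ev(e := \<mu>))"
      using B eB Ve nmu by (auto simp: eigenbasis_def)
    then show ?thesis by blast
  qed
qed

lemma eigenbasis_finite: "eigenbasis X V B ev \<Longrightarrow> finite B"
  by (simp add: eigenbasis_def orthonormal_set_def)

lemma eigenbasis_subset: "eigenbasis X V B ev \<Longrightarrow> B \<subseteq> X"
  using vec.span_superset by (auto simp: eigenbasis_def)

lemma eigenbasis_card: "eigenbasis X V B ev \<Longrightarrow> card B = vec.dim X"
  by (metis dim_span_orthonormal eigenbasis_def)

lemma eigenbasis_eval:
  assumes "eigenbasis X V B ev" "unitary_iso X X V" "vec.subspace X" "x \<in> X"
  shows "V x = (\<Sum>b\<in>B. (cinner x b * ev b) *s b)"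
proof -
  have "x = (\<Sum>b\<in>B. cinner x b *s b)"
    using assms(1,4) by (intro orthonormal_expansion) (auto simp: eigenbasis_def)
  then have "V x = V (\<Sum>b\<in>B. cinner x b *s b)"
    by simp
  also have "\<dots> = (\<Sum>b\<in>B. cinner x b *s V b)"
    by (rule unitary_iso_sum[OF assms(2,3) eigenbasis_finite[OF assms(1)] eigenbasis_subset[OF assms(1)]])
  also have "\<dots> = (\<Sum>b\<in>B. (cinner x b * ev b) *s b)"
    using assms(1) by (intro sum.cong) (auto simp: eigenbasis_def)
  finally show ?thesis .
qed

lemma eigenspace_eq_span:
  assumes "eigenbasis X V B ev" "unitary_iso X X V" "vec.subspace X"
  shows "{x\<in>X. V x = \<mu> *s x} = vec.span {b\<in>B. ev b = \<mu>}" (is "?E = vec.span ?B'")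
proof
  have sub: "vec.subspace ?E"
    unfolding vec.subspace_def using assms(3) unitary_isoD(2,3)[OF assms(2)] unitary_iso_zero[OF assms(2,3)]
    by (auto simp: vec.subspace_0 vec.subspace_add vec.subspace_scale vec.scale_right_distrib mult.commute)
  show "vec.span ?B' \<subseteq> ?E"
    using assms(1) eigenbasis_subset[OF assms(1)] by (intro vec.span_minimal sub) (auto simp: eigenbasis_def)
  show "?E \<subseteq> vec.span ?B'"
  proof
    fix x assume x: "x \<in> ?E"
    then have exp: "x = (\<Sum>b\<in>B. cinner x b *s b)"
      using assms(1) by (intro orthonormal_expansion) (auto simp: eigenbasis_def)
    have zero: "cinner x b = 0" if "b \<in> B" "ev b \<noteq> \<mu>" for b
    proof -
      have "cinner (V x) b = cinner x b * ev b"
        using x assms(1) cinner_sum_orthonormal[of B b "\<lambda>b. cinner x b * ev b"] that(1)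
          eigenbasis_eval[OF assms, of x] by (metis (no_types, lifting) eigenbasis_def mem_Collect_eq)
      moreover have "cinner (V x) b = \<mu> * cinner x b"
        using x by (simp add: cinner_scale_left)
      ultimately show ?thesis using that(2) by auto
    qed
    have "x = (\<Sum>b\<in>?B'. cinner x b *s b)"
      by (subst exp, rule sum.mono_neutral_right) (auto simp: zero eigenbasis_finite[OF assms(1)])
    also have "\<dots> \<in> vec.span ?B'"
      by (intro vec.span_sum vec.span_scale vec.span_base)
    finally show "x \<in> vec.span ?B'" .
  qed
qed

lemma dim_eigenspace:
  assumes "eigenbasis X V B ev" "unitary_iso X X V" "vec.subspace X"
  shows "vec.dim {x\<in>X. V x = \<mu> *s x} = card {b\<in>B. ev b = \<mu>}"
  unfolding eigenspace_eq_span[OF assms]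
  by (rule dim_span_orthonormal, rule orthonormal_set_subset[of B]) (use assms in \<open>auto simp: eigenbasis_def\<close>)

lemma eigenvalue_iff:
  assumes "eigenbasis X V B ev" "unitary_iso X X V" "vec.subspace X"
  shows "(\<exists>x\<in>X. x \<noteq> 0 \<and> V x = \<mu> *s x) \<longleftrightarrow> (\<exists>b\<in>B. ev b = \<mu>)"
proof
  assume "\<exists>x\<in>X. x \<noteq> 0 \<and> V x = \<mu> *s x"
  then have "vec.span {b\<in>B. ev b = \<mu>} \<noteq> {0}"
    by (subst eigenspace_eq_span[OF assms, symmetric]) auto
  then have "{b\<in>B. ev b = \<mu>} \<noteq> {}" by (metis vec.span_empty)
  then show "\<exists>b\<in>B. ev b = \<mu>" by auto
next
  assume "\<exists>b\<in>B. ev b = \<mu>"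
  then obtain b where b: "b \<in> B" "ev b = \<mu>" by blast
  moreover have "b \<in> X" "cinner b b = 1" "V b = ev b *s b"
    using assms(1) b eigenbasis_subset[OF assms(1)] by (auto simp: eigenbasis_def orthonormal_set_def)
  ultimately show "\<exists>x\<in>X. x \<noteq> 0 \<and> V x = \<mu> *s x"
    by (intro bexI[of _ b]) auto
qed

section \<open>Counting eigenvalues on arcs of the unit circle\<close>

lemma finite_card_sum_preimage:
  assumes "finite B" "finite M"
  shows "card {b\<in>B. f b \<in> M} = (\<Sum>\<mu>\<in>M. card {b\<in>B. f b = \<mu>})"
proof -
  have "{b\<in>B. f b \<in> M} = (\<Union>\<mu>\<in>M. {b\<in>B. f b = \<mu>})"
    by auto
  also have "card \<dots> = (\<Sum>\<mu>\<in>M. card {b\<in>B. f b = \<mu>})"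
    using assms by (intro card_UN_disjoint) auto
  finally show ?thesis .
qed

lemma arc_count_eq_card:
  assumes "eigenbasis X V B ev" "unitary_iso X X V" "vec.subspace X"
  shows "arc_count X V \<epsilon> = card {b\<in>B. ev b \<in> cis ` {0..<\<epsilon>}}"
proof -
  have fin: "finite B" by (rule eigenbasis_finite[OF assms(1)])
  let ?M = "{cis \<theta> |\<theta>. 0 \<le> \<theta> \<and> \<theta> < \<epsilon> \<and> (\<exists>x\<in>X. x \<noteq> 0 \<and> V x = cis \<theta> *s x)}"
  have M: "?M = ev ` B \<inter> cis ` {0..<\<epsilon>}"
    unfolding eigenvalue_iff[OF assms] by (auto simp: image_iff) metis
  have "arc_count X V \<epsilon> = (\<Sum>\<mu>\<in>?M. card {b\<in>B. ev b = \<mu>})"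
    unfolding arc_count_def dim_eigenspace[OF assms] ..
  also have "\<dots> = card {b\<in>B. ev b \<in> ?M}"
    unfolding M by (intro finite_card_sum_preimage[symmetric]) (auto simp: fin)
  also have "{b\<in>B. ev b \<in> ?M} = {b\<in>B. ev b \<in> cis ` {0..<\<epsilon>}}"
    unfolding M by auto
  finally show ?thesis .
qed

definition no_eigenvalue :: "(complex ^ 'm::finite) set \<Rightarrow> (complex ^ 'm \<Rightarrow> complex ^ 'm) \<Rightarrow> complex \<Rightarrow> bool" where
  "no_eigenvalue X V \<mu> \<longleftrightarrow> (\<forall>x\<in>X. V x = \<mu> *s x \<longrightarrow> x = 0)"

lemma no_eigenvalue_iff:
  assumes "eigenbasis X V B ev" "unitary_iso X X V" "vec.subspace X"
  shows "no_eigenvalue X V \<mu> \<longleftrightarrow> (\<forall>b\<in>B. ev b \<noteq> \<mu>)"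
  using eigenvalue_iff[OF assms, of \<mu>] by (auto simp: no_eigenvalue_def)

text \<open>On the unit circle the half-plane \<open>Re (cnj w * \<mu>) > c\<close> cuts out an open arc with midpoint \<open>w\<close>.
  The Hermitian form below is positive on the span of the eigenvectors with eigenvalue in the arc
  and negative on the span of those with eigenvalue outside its closure.\<close>

definition arc_form :: "complex \<Rightarrow> real \<Rightarrow> (complex ^ 'm::finite \<Rightarrow> complex ^ 'm) \<Rightarrow> complex ^ 'm \<Rightarrow> real" where
  "arc_form w c V x = Re (cnj w * cinner (V x) x) - c * (norm x)\<^sup>2"

lemma arc_form_eigenbasis:
  assumes "eigenbasis X V B ev" "unitary_iso X X V" "vec.subspace X" "x \<in> X"
  shows "arc_form w c V x = (\<Sum>b\<in>B. (Re (cnj w * ev b) - c) * (norm (cinner x b))\<^sup>2)"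
proof -
  have on: "orthonormal_set B" "x \<in> vec.span B"
    using assms(1,4) by (auto simp: eigenbasis_def)
  have "cinner (V x) x = (\<Sum>b\<in>B. cinner x b * ev b * cinner b x)"
    by (simp add: eigenbasis_eval[OF assms] cinner_sum_left cinner_scale_left)
  also have "\<dots> = (\<Sum>b\<in>B. ev b * of_real ((norm (cinner x b))\<^sup>2))"
  proof (intro sum.cong refl)
    fix b
    have "cinner x b * cinner b x = of_real ((norm (cinner x b))\<^sup>2)"
      by (metis cinner_commute complex_norm_square of_real_power)
    then show "cinner x b * ev b * cinner b x = ev b * of_real ((norm (cinner x b))\<^sup>2)"
      by (metis mult.commute mult.left_commute)
  qed
  finally have "Re (cnj w * cinner (V x) x) = (\<Sum>b\<in>B. Re (cnj w * ev b * of_real ((norm (cinner x b))\<^sup>2)))"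
    by (simp add: sum_distrib_left mult.assoc)
  also have "\<dots> = (\<Sum>b\<in>B. Re (cnj w * ev b) * (norm (cinner x b))\<^sup>2)"
    by (simp only: Re_complex_of_real times_complex.sel Im_complex_of_real mult_zero_right diff_zero)
  finally show ?thesis
    unfolding arc_form_def norm_orthonormal_expansion[OF on]
    by (simp add: sum_distrib_left sum_subtractf left_diff_distrib)
qed

lemma arc_form_perturb:
  assumes "norm (V' x - V x) \<le> \<delta> * norm x" "norm w = 1"
  shows "\<bar>arc_form w c V' x - arc_form w c V x\<bar> \<le> \<delta> * (norm x)\<^sup>2"
proof -
  have eq: "cnj w * cinner y x = cinner y (w *s x)" for y
    by (simp add: cinner_scale_right)
  have "arc_form w c V' x - arc_form w c V x = inner (V' x - V x) (w *s x)"
    unfolding arc_form_def eq inner_eq_Re_cinner by (simp add: cinner_diff_left)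
  also have "\<bar>\<dots>\<bar> \<le> norm (V' x - V x) * norm (w *s x)"
    by (rule Cauchy_Schwarz_ineq2)
  also have "\<dots> \<le> (\<delta> * norm x) * norm x"
    using mult_right_mono[OF assms(1), of "norm x"] assms(2) by (simp add: norm_scale)
  finally show ?thesis by (simp add: power2_eq_square mult.assoc)
qed

lemma dim_add_le_if_Int_trivial:
  fixes S T X :: "(complex ^ 'm::finite) set"
  assumes "vec.subspace S" "vec.subspace T" "S \<inter> T \<subseteq> {0}" "S \<subseteq> X" "T \<subseteq> X" "vec.subspace X"
  shows "vec.dim S + vec.dim T \<le> vec.dim X"
proof -
  have "vec.dim (S \<inter> T) = 0"
    using assms(3) by simp
  moreover have "vec.dim {x + y |x y. x \<in> S \<and> y \<in> T} \<le> vec.dim X"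
    using assms(4-6) by (intro vec.dim_subset) (auto intro!: vec.subspace_add)
  ultimately show ?thesis
    using vec.dim_sums_Int[OF assms(1,2)] by linarith
qed

definition op_close :: "(complex ^ 'm::finite) set \<Rightarrow> real \<Rightarrow> (complex ^ 'm \<Rightarrow> complex ^ 'm) \<Rightarrow> (complex ^ 'm \<Rightarrow> complex ^ 'm) \<Rightarrow> bool" where
  "op_close X \<delta> V' V \<longleftrightarrow> (\<forall>x\<in>X. norm (V' x - V x) \<le> \<delta> * norm x)"

lemma op_close_mono: "op_close X \<delta> V' V \<Longrightarrow> \<delta> \<le> \<delta>' \<Longrightarrow> op_close X \<delta>' V' V"
  unfolding op_close_def by (meson mult_right_mono norm_ge_zero order_trans)

text \<open>Positivity and negativity of the form on the two spectral subspaces of \<open>V\<close> survive small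
  perturbations. Hence neither the number of eigenvalues inside the arc nor the number outside it
  drops, and the two numbers always add up to the dimension of \<open>X\<close>.\<close>

lemma half_plane_count_locally_constant:
  assumes V: "eigenbasis X V B ev" "unitary_iso X X V" and X: "vec.subspace X" and w: "norm w = 1"
    and off: "\<forall>b\<in>B. Re (cnj w * ev b) \<noteq> c"
  shows "\<exists>\<delta>>0. \<forall>V' B' ev'. eigenbasis X V' B' ev' \<longrightarrow> unitary_iso X X V' \<longrightarrow> op_close X \<delta> V' V \<longrightarrow>
       card {b\<in>B'. Re (cnj w * ev' b) > c} = card {b\<in>B. Re (cnj w * ev b) > c} \<and>
       (\<forall>b\<in>B'. Re (cnj w * ev' b) \<noteq> c)"
proof -
  define g where "g b = \<bar>Re (cnj w * ev b) - c\<bar>" for b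
  have fin: "finite B" by (rule eigenbasis_finite[OF V(1)])
  obtain \<eta> where \<eta>: "\<eta> > 0" "\<And>b. b \<in> B \<Longrightarrow> \<eta> \<le> g b"
  proof (cases "B = {}")
    case False
    have "Min (g ` B) > 0"
      using fin False off by (auto simp: g_def)
    moreover have "Min (g ` B) \<le> g b" if "b \<in> B" for b
      using fin that by auto
    ultimately show thesis using that by blast
  qed (use that[of 1] in auto)
  show ?thesis
  proof (intro exI[of _ "\<eta> / 2"] conjI allI impI)
    show "\<eta> / 2 > 0" using \<eta> by simp
    fix V' B' ev'
    assume V': "eigenbasis X V' B' ev'" "unitary_iso X X V'" and cl: "op_close X (\<eta> / 2) V' V"
    have close: "norm (V' x - V x) \<le> \<eta> / 2 * norm x" if "x \<in> X" for x
      using cl that by (simp add: op_close_def)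
    have sub: "vec.span C \<subseteq> X" "vec.span C' \<subseteq> X" if "C \<subseteq> B" "C' \<subseteq> B'" for C C'
      by (rule vec.span_minimal[OF _ X], use that eigenbasis_subset[OF V(1)] eigenbasis_subset[OF V'(1)] in blast)+
    have coeff0: "cinner x b = 0" if D: "orthonormal_set D" "C \<subseteq> D" "x \<in> vec.span C" "b \<in> D" "b \<notin> C" for x b C D
    proof -
      have "orthonormal_set C" using D orthonormal_set_subset by blast
      from orthonormal_expansion[OF this D(3)] have "cinner x b = (\<Sum>d\<in>C. cinner x d * cinner d b)"
        by (metis (no_types, lifting) cinner_scale_left cinner_sum_left sum.cong)
      also have "\<dots> = 0"
        using D by (intro sum.neutral) (auto simp: orthonormal_set_def)
      finally show ?thesis .
    qed
    have on: "orthonormal_set B" "orthonormal_set B'"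
      using V(1) V'(1) by (auto simp: eigenbasis_def)
    let ?P = "{b\<in>B. Re (cnj w * ev b) > c}" and ?N = "{b\<in>B. Re (cnj w * ev b) < c}"
    let ?P' = "{b\<in>B'. Re (cnj w * ev' b) > c}" and ?N' = "{b\<in>B'. Re (cnj w * ev' b) < c}"
    let ?Q' = "{b\<in>B'. Re (cnj w * ev' b) \<ge> c}" and ?M' = "{b\<in>B'. Re (cnj w * ev' b) \<le> c}"
    have pos: "arc_form w c V' x > 0" if x: "x \<in> vec.span ?P" "x \<noteq> 0" for x
    proof -
      have xX: "x \<in> X" using sub(1)[of ?P "{}"] x by auto
      then have xB: "x \<in> vec.span B" using V(1) by (simp add: eigenbasis_def)
      have "\<eta> * (norm x)\<^sup>2 = (\<Sum>b\<in>B. \<eta> * (norm (cinner x b))\<^sup>2)"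
        by (simp add: norm_orthonormal_expansion[OF on(1) xB] sum_distrib_left)
      also have "\<dots> \<le> (\<Sum>b\<in>B. (Re (cnj w * ev b) - c) * (norm (cinner x b))\<^sup>2)"
      proof (rule sum_mono)
        fix b assume b: "b \<in> B"
        show "\<eta> * (norm (cinner x b))\<^sup>2 \<le> (Re (cnj w * ev b) - c) * (norm (cinner x b))\<^sup>2"
        proof (cases "b \<in> ?P")
          case True
          then show ?thesis using \<eta>(2)[OF b] by (intro mult_right_mono) (auto simp: g_def)
        next
          case False
          then show ?thesis using coeff0[OF on(1) _ x(1) b False] by auto
        qed
      qed
      also have "\<dots> = arc_form w c V x"
        by (rule arc_form_eigenbasis[OF V X xX, symmetric])
      finally have "\<eta> * (norm x)\<^sup>2 \<le> arc_form w c V x" .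
      moreover have "\<bar>arc_form w c V' x - arc_form w c V x\<bar> \<le> \<eta> / 2 * (norm x)\<^sup>2"
        by (intro arc_form_perturb close xX w)
      moreover have "\<eta> * (norm x)\<^sup>2 > 0" using \<eta> x by simp
      ultimately show ?thesis by linarith
    qed
    have neg: "arc_form w c V' x < 0" if x: "x \<in> vec.span ?N" "x \<noteq> 0" for x
    proof -
      have xX: "x \<in> X" using sub(1)[of ?N "{}"] x by auto
      then have xB: "x \<in> vec.span B" using V(1) by (simp add: eigenbasis_def)
      have "(\<Sum>b\<in>B. (Re (cnj w * ev b) - c) * (norm (cinner x b))\<^sup>2) \<le> (\<Sum>b\<in>B. - \<eta> * (norm (cinner x b))\<^sup>2)"
      proof (rule sum_mono)
        fix b assume b: "b \<in> B"
        show "(Re (cnj w * ev b) - c) * (norm (cinner x b))\<^sup>2 \<le> - \<eta> * (norm (cinner x b))\<^sup>2"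
        proof (cases "b \<in> ?N")
          case True
          then show ?thesis using \<eta>(2)[OF b] by (intro mult_right_mono) (auto simp: g_def)
        next
          case False
          then show ?thesis using coeff0[OF on(1) _ x(1) b False] by auto
        qed
      qed
      also have "\<dots> = - \<eta> * (norm x)\<^sup>2"
        by (simp add: norm_orthonormal_expansion[OF on(1) xB] sum_distrib_left sum_negf)
      finally have "arc_form w c V x \<le> - (\<eta> * (norm x)\<^sup>2)"
        by (simp add: arc_form_eigenbasis[OF V X xX])
      moreover have "\<bar>arc_form w c V' x - arc_form w c V x\<bar> \<le> \<eta> / 2 * (norm x)\<^sup>2"
        by (intro arc_form_perturb close xX w)
      moreover have "\<eta> * (norm x)\<^sup>2 > 0" using \<eta> x by simp
      ultimately show ?thesis by linarith
    qed
    have nonneg': "arc_form w c V' x \<ge> 0" if x: "x \<in> vec.span ?Q'" for x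
    proof -
      have xX: "x \<in> X" using sub(2)[of "{}" ?Q'] x by auto
      have "0 \<le> (Re (cnj w * ev' b) - c) * (norm (cinner x b))\<^sup>2" if "b \<in> B'" for b
        by (cases "b \<in> ?Q'") (use coeff0[OF on(2) _ x that] in auto)
      then show ?thesis
        unfolding arc_form_eigenbasis[OF V' X xX] by (rule sum_nonneg)
    qed
    have nonpos': "arc_form w c V' x \<le> 0" if x: "x \<in> vec.span ?M'" for x
    proof -
      have xX: "x \<in> X" using sub(2)[of "{}" ?M'] x by auto
      have "(Re (cnj w * ev' b) - c) * (norm (cinner x b))\<^sup>2 \<le> 0" if "b \<in> B'" for b
        by (cases "b \<in> ?M'") (use coeff0[OF on(2) _ x that] in \<open>auto simp: mult_nonpos_nonneg\<close>)
      then show ?thesis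
        unfolding arc_form_eigenbasis[OF V' X xX] by (rule sum_nonpos)
    qed
    have dim: "vec.dim (vec.span C) = card C" "vec.dim (vec.span C') = card C'" if "C \<subseteq> B" "C' \<subseteq> B'" for C C'
      using that on orthonormal_set_subset dim_span_orthonormal by blast+
    have fin': "finite B'" by (rule eigenbasis_finite[OF V'(1)])
    have "vec.span ?P \<inter> vec.span ?M' \<subseteq> {0}" "vec.span ?N \<inter> vec.span ?Q' \<subseteq> {0}"
      using pos neg nonneg' nonpos' by force+
    then have "vec.dim (vec.span ?P) + vec.dim (vec.span ?M') \<le> vec.dim X"
      "vec.dim (vec.span ?N) + vec.dim (vec.span ?Q') \<le> vec.dim X"
      by (intro dim_add_le_if_Int_trivial sub(1)[of _ "{}"] sub(2)[of "{}"] X; auto)+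
    then have ineq: "card ?P + card ?M' \<le> card B" "card ?N + card ?Q' \<le> card B"
      using dim(1)[of ?P "{}"] dim(1)[of ?N "{}"] dim(2)[of "{}" ?M'] dim(2)[of "{}" ?Q'] eigenbasis_card[OF V(1)]
      by auto
    have "card ?P + card ?N = card B"
    proof -
      have "?P \<union> ?N = B" using off by (auto simp: neq_iff)
      moreover have "?P \<inter> ?N = {}" by auto
      then have "card (?P \<union> ?N) = card ?P + card ?N"
        using fin by (intro card_Un_disjoint) auto
      ultimately show ?thesis by simp
    qed
    moreover have "card ?P' + card ?M' = card B" "card ?N' + card ?Q' = card B"
    proof -
      have "?P' \<union> ?M' = B'" "?N' \<union> ?Q' = B'" by auto
      moreover have "card (?P' \<union> ?M') = card ?P' + card ?M'" "card (?N' \<union> ?Q') = card ?N' + card ?Q'"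
        using fin' by (intro card_Un_disjoint; auto)+
      ultimately have "card B' = card ?P' + card ?M'" "card B' = card ?N' + card ?Q'"
        by simp_all
      then show "card ?P' + card ?M' = card B" "card ?N' + card ?Q' = card B"
        using eigenbasis_card[OF V(1)] eigenbasis_card[OF V'(1)] by auto
    qed
    moreover have "card ?P' + card ?N' \<le> card B"
    proof -
      have "?P' \<inter> ?N' = {}" by auto
      then have "card ?P' + card ?N' = card (?P' \<union> ?N')"
        using fin' by (simp add: card_Un_disjoint)
      also have "\<dots> \<le> card B'" by (rule card_mono[OF fin']) auto
      finally show ?thesis using eigenbasis_card[OF V(1)] eigenbasis_card[OF V'(1)] by simp
    qed
    ultimately have eqs: "card ?P' = card ?P" "card ?N' = card ?N" "card ?M' = card ?N'"
      using ineq by linarith+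
    have "?N' = ?M'"
      by (rule card_subset_eq) (use fin' eqs in auto)
    then show "\<forall>b\<in>B'. Re (cnj w * ev' b) \<noteq> c"
      by fastforce
    show "card ?P' = card ?P" by (rule eqs)
  qed
qed

lemma cos_less_iff_abs:
  assumes "0 \<le> \<delta>" "\<delta> \<le> pi" "\<bar>x\<bar> \<le> pi"
  shows "cos \<delta> < cos x \<longleftrightarrow> \<bar>x\<bar> < \<delta>"
proof -
  have "cos x = cos \<bar>x\<bar>" by (simp add: abs_if)
  then show ?thesis
    using cos_mono_less_eq[of \<delta> "\<bar>x\<bar>"] assms by simp
qed

lemma unit_eq_mult_cis:
  assumes "norm w = 1" "norm (\<mu> :: complex) = 1"
  obtains \<phi> where "\<bar>\<phi>\<bar> \<le> pi" "\<mu> = w * cis \<phi>" "Re (cnj w * \<mu>) = cos \<phi>"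
proof -
  have w: "w * cnj w = 1" "cnj w * w = 1"
    using assms(1) complex_norm_square[of w] by (simp_all add: mult.commute)
  define \<phi> where "\<phi> = Arg (cnj w * \<mu>)"
  have "cnj w * \<mu> \<noteq> 0" using assms by auto
  then have "cis \<phi> = sgn (cnj w * \<mu>)" "- pi < \<phi>" "\<phi> \<le> pi"
    using Arg_correct[of "cnj w * \<mu>"] by (auto simp: \<phi>_def)
  moreover have "sgn (cnj w * \<mu>) = cnj w * \<mu>"
    using assms by (simp add: sgn_eq norm_mult)
  ultimately have c: "cis \<phi> = cnj w * \<mu>" "\<bar>\<phi>\<bar> \<le> pi" by auto
  have "w * cis \<phi> = \<mu>"
    by (simp add: c(1) w flip: mult.assoc)
  moreover have "Re (cnj w * \<mu>) = cos \<phi>"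
    by (simp flip: c(1))
  ultimately show thesis
    using that[of \<phi>] c(2) by simp
qed

text \<open>For \<open>\<mu> = cis \<theta>\<close> the real part is \<open>cos (\<theta> - m)\<close>, and on \<open>[-pi, pi]\<close> the cosine decreases with the
  distance from \<open>0\<close>.\<close>

lemma arc_iff_half_plane:
  assumes "norm \<mu> = 1" "0 \<le> \<delta>" "\<delta> \<le> pi"
  shows "\<mu> \<in> cis ` {m - \<delta><..<m + \<delta>} \<longleftrightarrow> Re (cnj (cis m) * \<mu>) > cos \<delta>"
proof
  assume "\<mu> \<in> cis ` {m - \<delta><..<m + \<delta>}"
  then obtain \<theta> where \<theta>: "\<mu> = cis \<theta>" "\<bar>\<theta> - m\<bar> < \<delta>"
    by (auto simp: abs_if)
  have "cnj (cis m) * \<mu> = cis (\<theta> - m)"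
    by (simp add: \<theta>(1) cis_cnj cis_mult)
  then show "Re (cnj (cis m) * \<mu>) > cos \<delta>"
    using cos_less_iff_abs[of \<delta> "\<theta> - m"] \<theta>(2) assms by simp
next
  assume R: "Re (cnj (cis m) * \<mu>) > cos \<delta>"
  obtain \<phi> where \<phi>: "\<bar>\<phi>\<bar> \<le> pi" "\<mu> = cis m * cis \<phi>" "Re (cnj (cis m) * \<mu>) = cos \<phi>"
    using unit_eq_mult_cis[of "cis m" \<mu>] assms by auto
  then have "\<bar>\<phi>\<bar> < \<delta>"
    using R cos_less_iff_abs[of \<delta> \<phi>] assms by simp
  then show "\<mu> \<in> cis ` {m - \<delta><..<m + \<delta>}"
    using \<phi>(2) by (intro image_eqI[of _ _ "m + \<phi>"]) (auto simp: cis_mult abs_if split: if_splits)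
qed

lemma half_plane_boundary:
  assumes "norm \<mu> = 1" "0 \<le> \<delta>" "\<delta> \<le> pi" "Re (cnj (cis m) * \<mu>) = cos \<delta>"
  shows "\<mu> = cis (m + \<delta>) \<or> \<mu> = cis (m - \<delta>)"
proof -
  obtain \<phi> where \<phi>: "\<bar>\<phi>\<bar> \<le> pi" "\<mu> = cis m * cis \<phi>" "Re (cnj (cis m) * \<mu>) = cos \<phi>"
    using unit_eq_mult_cis[of "cis m" \<mu>] assms by auto
  have "cos \<delta> = cos \<bar>\<phi>\<bar>"
    using \<phi>(3) assms(4) by (simp add: abs_if)
  then have "\<delta> = \<bar>\<phi>\<bar>"
    using assms(2,3) \<phi>(1) cos_inj_pi[of \<delta> "\<bar>\<phi>\<bar>"] by simp
  then show ?thesis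
    using \<phi>(2) by (auto simp: cis_mult abs_if split: if_splits)
qed

lemma cis_inj_on_2pi: "inj_on cis {0..<2 * pi}"
proof (rule inj_onI)
  fix x y assume xy: "x \<in> {0..<2 * pi}" "y \<in> {0..<2 * pi}" "cis x = cis y"
  then have "cis (x - y) = 1"
    by (simp flip: cis_divide)
  then have "cos (x - y) = 1"
    by (simp add: complex_eq_iff)
  then obtain n :: int where "x - y = n * 2 * pi"
    by (auto simp: cos_one_2pi_int)
  moreover have "\<bar>x - y\<bar> < 1 * (2 * pi)"
    using xy by auto
  ultimately have "\<bar>real_of_int n\<bar> * (2 * pi) < 1 * (2 * pi)"
    by (simp add: abs_mult)
  then have "n = 0"
    by (subst (asm) mult_less_cancel_right) auto
  then show "x = y"
    using \<open>x - y = n * 2 * pi\<close> by simp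
qed

text \<open>The half-plane \<open>Re (cnj (cis \<epsilon>) * \<mu>) > 1\<close> misses the unit circle; its boundary touches the circle
  exactly at \<open>cis \<epsilon>\<close>.\<close>

lemma no_eigenvalue_locally_constant:
  assumes V: "unitary_iso X X V" and X: "vec.subspace X" and ne: "no_eigenvalue X V (cis \<epsilon>)"
  obtains \<delta> where "\<delta> > 0"
    "\<And>V'. unitary_iso X X V' \<Longrightarrow> op_close X \<delta> V' V \<Longrightarrow> no_eigenvalue X V' (cis \<epsilon>)"
proof -
  obtain B ev where B: "eigenbasis X V B ev"
    using unitary_eigenbasis_exists[OF V X] by blast
  have off: "\<forall>b\<in>B. Re (cnj (cis \<epsilon>) * ev b) \<noteq> 1"
  proof (intro ballI notI)
    fix b assume b: "b \<in> B"
    assume "Re (cnj (cis \<epsilon>) * ev b) = 1"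
    then have "ev b = cis (\<epsilon> + 0) \<or> ev b = cis (\<epsilon> - 0)"
      using B b by (intro half_plane_boundary) (auto simp: eigenbasis_def)
    then show False
      using ne b no_eigenvalue_iff[OF B V X] by auto
  qed
  obtain \<delta> where \<delta>: "\<delta> > 0"
    "\<forall>V' B' ev'. eigenbasis X V' B' ev' \<longrightarrow> unitary_iso X X V' \<longrightarrow> op_close X \<delta> V' V \<longrightarrow>
       card {b\<in>B'. Re (cnj (cis \<epsilon>) * ev' b) > 1} = card {b\<in>B. Re (cnj (cis \<epsilon>) * ev b) > 1} \<and>
       (\<forall>b\<in>B'. Re (cnj (cis \<epsilon>) * ev' b) \<noteq> 1)"
    using half_plane_count_locally_constant[OF B V X norm_cis, OF off] by blast
  show thesis
  proof (rule that[OF \<delta>(1)])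
    fix V' assume V': "unitary_iso X X V'" "op_close X \<delta> V' V"
    obtain B' ev' where B': "eigenbasis X V' B' ev'"
      using unitary_eigenbasis_exists[OF V'(1) X] by blast
    have "\<forall>b\<in>B'. Re (cnj (cis \<epsilon>) * ev' b) \<noteq> 1"
      using \<delta>(2) B' V' by blast
    moreover have "Re (cnj (cis \<epsilon>) * cis \<epsilon>) = 1"
      by (simp add: cis_cnj cis_mult)
    ultimately show "no_eigenvalue X V' (cis \<epsilon>)"
      unfolding no_eigenvalue_iff[OF B' V'(1) X] by auto
  qed
qed

text \<open>Since \<open>cis \<epsilon>\<close> is not an eigenvalue, the difference of the two counts is the number of eigenvalues
  on the open arc from \<open>\<epsilon>\<close> to \<open>\<epsilon>'\<close>.\<close>

lemma arc_count_diff_locally_constant_less: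
  assumes V: "unitary_iso X X V" and X: "vec.subspace X"
    and \<epsilon>: "0 < \<epsilon>" "\<epsilon> < \<epsilon>'" "\<epsilon>' < pi"
    and ne: "no_eigenvalue X V (cis \<epsilon>)" "no_eigenvalue X V (cis \<epsilon>')"
  obtains \<delta> where "\<delta> > 0"
    "\<And>V'. unitary_iso X X V' \<Longrightarrow> op_close X \<delta> V' V \<Longrightarrow>
       int (arc_count X V' \<epsilon>') - int (arc_count X V' \<epsilon>) = int (arc_count X V \<epsilon>') - int (arc_count X V \<epsilon>)"
proof -
  obtain B ev where B: "eigenbasis X V B ev"
    using unitary_eigenbasis_exists[OF V X] by blast
  define m d where "m = (\<epsilon> + \<epsilon>') / 2" "d = (\<epsilon>' - \<epsilon>) / 2"
  have md: "m - d = \<epsilon>" "m + d = \<epsilon>'" "0 \<le> d" "d \<le> pi"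
    using \<epsilon> by (auto simp: m_d_def field_simps)
  have diff: "int (arc_count X W \<epsilon>') - int (arc_count X W \<epsilon>) = int (card {b\<in>C. Re (cnj (cis m) * e b) > cos d})"
    if C: "eigenbasis X W C e" and W: "unitary_iso X X W" and neW: "no_eigenvalue X W (cis \<epsilon>)" for W C e
  proof -
    have "{b\<in>C. e b \<in> cis ` {0..<\<epsilon>'}} = {b\<in>C. e b \<in> cis ` {0..<\<epsilon>}} \<union> {b\<in>C. Re (cnj (cis m) * e b) > cos d}" (is "?L = ?A \<union> ?R")
    proof -
      have "e b \<in> cis ` {0..<\<epsilon>'} \<longleftrightarrow> e b \<in> cis ` {0..<\<epsilon>} \<or> e b \<in> cis ` {\<epsilon><..<\<epsilon>'}" if "b \<in> C" for b
      proof -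
        have "{0..<\<epsilon>'} = {0..<\<epsilon>} \<union> insert \<epsilon> {\<epsilon><..<\<epsilon>'}" using \<epsilon> by auto
        moreover have "e b \<noteq> cis \<epsilon>"
          using neW no_eigenvalue_iff[OF C W X] that by auto
        ultimately show ?thesis by auto
      qed
      moreover have "e b \<in> cis ` {\<epsilon><..<\<epsilon>'} \<longleftrightarrow> Re (cnj (cis m) * e b) > cos d" if "b \<in> C" for b
        using arc_iff_half_plane[of "e b" d m] md C that by (simp add: eigenbasis_def)
      ultimately show ?thesis by blast
    qed
    moreover have "?A \<inter> ?R = {}"
    proof -
      have False if "b \<in> ?A" "b \<in> ?R" for b
      proof -
        have "e b \<in> cis ` {\<epsilon><..<\<epsilon>'}"
          using arc_iff_half_plane[of "e b" d m] md C that by (simp add: eigenbasis_def)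
        then obtain t where "e b = cis t" "t \<in> {\<epsilon><..<\<epsilon>'}" by auto
        moreover obtain s where "e b = cis s" "s \<in> {0..<\<epsilon>}" using \<open>b \<in> ?A\<close> by auto
        ultimately show False
          using inj_onD[OF cis_inj_on_2pi, of s t] \<epsilon> pi_gt_zero by auto
      qed
      then show ?thesis by blast
    qed
    ultimately have "card ?L = card ?A + card ?R"
      using eigenbasis_finite[OF C] by (simp add: card_Un_disjoint)
    then show ?thesis
      by (simp add: arc_count_eq_card[OF C W X])
  qed
  have off: "\<forall>b\<in>B. Re (cnj (cis m) * ev b) \<noteq> cos d"
  proof (intro ballI notI)
    fix b assume b: "b \<in> B"
    assume "Re (cnj (cis m) * ev b) = cos d"
    then have "ev b = cis \<epsilon>' \<or> ev b = cis \<epsilon>"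
      using half_plane_boundary[of "ev b" d m] B b md by (simp add: eigenbasis_def)
    then show False
      using ne b no_eigenvalue_iff[OF B V X] by auto
  qed
  obtain \<delta>1 where \<delta>1: "\<delta>1 > 0"
    "\<forall>V' B' ev'. eigenbasis X V' B' ev' \<longrightarrow> unitary_iso X X V' \<longrightarrow> op_close X \<delta>1 V' V \<longrightarrow>
       card {b\<in>B'. Re (cnj (cis m) * ev' b) > cos d} = card {b\<in>B. Re (cnj (cis m) * ev b) > cos d} \<and>
       (\<forall>b\<in>B'. Re (cnj (cis m) * ev' b) \<noteq> cos d)"
    using half_plane_count_locally_constant[OF B V X norm_cis, OF off] by blast
  obtain \<delta>2 where \<delta>2: "\<delta>2 > 0"
    "\<And>V'. unitary_iso X X V' \<Longrightarrow> op_close X \<delta>2 V' V \<Longrightarrow> no_eigenvalue X V' (cis \<epsilon>)"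
    by (rule no_eigenvalue_locally_constant[OF V X ne(1)]) (rule that)
  show thesis
  proof (rule that[of "min \<delta>1 \<delta>2"])
    show "min \<delta>1 \<delta>2 > 0" using \<delta>1 \<delta>2 by simp
    fix V' assume V': "unitary_iso X X V'" "op_close X (min \<delta>1 \<delta>2) V' V"
    then have cl: "op_close X \<delta>1 V' V" "op_close X \<delta>2 V' V"
      by (auto intro: op_close_mono)
    obtain B' ev' where B': "eigenbasis X V' B' ev'"
      using unitary_eigenbasis_exists[OF V'(1) X] by blast
    have "card {b\<in>B'. Re (cnj (cis m) * ev' b) > cos d} = card {b\<in>B. Re (cnj (cis m) * ev b) > cos d}"
      using \<delta>1(2) B' V'(1) cl(1) by blast
    then show "int (arc_count X V' \<epsilon>') - int (arc_count X V' \<epsilon>) = int (arc_count X V \<epsilon>') - int (arc_count X V \<epsilon>)"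
      by (simp only: diff[OF B' V'(1) \<delta>2(2)[OF V'(1) cl(2)]] diff[OF B V ne(1)])
  qed
qed

lemma arc_count_diff_locally_constant:
  assumes V: "unitary_iso X X V" and X: "vec.subspace X"
    and \<epsilon>: "0 < \<epsilon>" "\<epsilon> < pi" "0 < \<epsilon>'" "\<epsilon>' < pi"
    and ne: "no_eigenvalue X V (cis \<epsilon>)" "no_eigenvalue X V (cis \<epsilon>')"
  shows "\<exists>\<delta>>0. \<forall>V'. unitary_iso X X V' \<longrightarrow> op_close X \<delta> V' V \<longrightarrow>
       int (arc_count X V' \<epsilon>) - int (arc_count X V \<epsilon>) = int (arc_count X V' \<epsilon>') - int (arc_count X V \<epsilon>')"
proof (cases \<epsilon> \<epsilon>' rule: linorder_cases)
  case less
  obtain \<delta> where "\<delta> > 0" "\<And>V'. unitary_iso X X V' \<Longrightarrow> op_close X \<delta> V' V \<Longrightarrow>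
       int (arc_count X V' \<epsilon>') - int (arc_count X V' \<epsilon>) = int (arc_count X V \<epsilon>') - int (arc_count X V \<epsilon>)"
    using arc_count_diff_locally_constant_less[OF V X \<epsilon>(1) less \<epsilon>(4) ne] by blast
  then show ?thesis by (intro exI[of _ \<delta>]) force
next
  case greater
  obtain \<delta> where "\<delta> > 0" "\<And>V'. unitary_iso X X V' \<Longrightarrow> op_close X \<delta> V' V \<Longrightarrow>
       int (arc_count X V' \<epsilon>) - int (arc_count X V' \<epsilon>') = int (arc_count X V \<epsilon>) - int (arc_count X V \<epsilon>')"
    using arc_count_diff_locally_constant_less[OF V X \<epsilon>(3) greater \<epsilon>(2) ne(2,1)] by blast
  then show ?thesis by (intro exI[of _ \<delta>]) force
qed (auto intro: exI[of _ 1])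

lemma ex_no_eigenvalue:
  assumes V: "unitary_iso X X V" and X: "vec.subspace X"
  obtains \<epsilon> where "0 < \<epsilon>" "\<epsilon> < pi" "no_eigenvalue X V (cis \<epsilon>)"
proof -
  obtain B ev where B: "eigenbasis X V B ev"
    using unitary_eigenbasis_exists[OF V X] by blast
  have "inj_on cis {0<..<pi}"
    by (rule inj_on_subset[OF cis_inj_on_2pi]) (use pi_gt_zero in auto)
  then have "infinite (cis ` {0<..<pi})"
    using finite_imageD infinite_Ioo[OF pi_gt_zero] by blast
  then have "\<not> cis ` {0<..<pi} \<subseteq> ev ` B"
    using eigenbasis_finite[OF B] finite_subset by blast
  then obtain \<epsilon> where "0 < \<epsilon>" "\<epsilon> < pi" "cis \<epsilon> \<notin> ev ` B"
    by (metis greaterThanLessThan_iff image_subsetI)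
  then show thesis
    using that no_eigenvalue_iff[OF B V X] by (metis imageI)
qed

text \<open>Around an operator \<open>V\<close> the eigenvalues of nearby operators that are close to \<open>1\<close> number exactly
  the multiplicity of \<open>1\<close> for \<open>V\<close>. If \<open>1\<close> keeps its multiplicity they all stay at \<open>1\<close>; if the
  spectrum is symmetric under conjugation, those that leave \<open>1\<close> do so in conjugate pairs.\<close>

lemma arc_count_near_one:
  assumes V: "unitary_iso X X V" and X: "vec.subspace X"
  obtains \<epsilon> \<delta> where "0 < \<epsilon>" "\<epsilon> < pi" "no_eigenvalue X V (cis \<epsilon>)" "\<delta> > 0"
    "arc_count X V \<epsilon> = vec.dim {x\<in>X. V x = x}"
    "\<And>V' B' ev'. eigenbasis X V' B' ev' \<Longrightarrow> unitary_iso X X V' \<Longrightarrow> op_close X \<delta> V' V \<Longrightarrow>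
       card {b\<in>B'. Re (ev' b) > cos \<epsilon>} = vec.dim {x\<in>X. V x = x}"
proof -
  obtain B ev where B: "eigenbasis X V B ev"
    using unitary_eigenbasis_exists[OF V X] by blast
  have fin: "finite B" by (rule eigenbasis_finite[OF B])
  have one: "\<mu> = 1" if "norm \<mu> = 1" "Re \<mu> \<ge> 1" for \<mu>
  proof -
    have "Re \<mu> = 1"
      using complex_Re_le_cmod[of \<mu>] that by simp
    then have "(Im \<mu>)\<^sup>2 = 0"
      using cmod_power2[of \<mu>] that(1) by simp
    then show ?thesis using \<open>Re \<mu> = 1\<close> by (simp add: complex_eq_iff)
  qed
  \<comment> \<open>\<open>c0\<close> is the largest real part of an eigenvalue other than \<open>1\<close>; \<open>-1\<close> is inserted for the case that
    there is none. Between \<open>c0\<close> and \<open>1\<close> there is room for the half-plane bound \<open>c = cos \<epsilon>\<close>.\<close>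
  define c0 where "c0 = Max (insert (-1) ((\<lambda>b. Re (ev b)) ` {b\<in>B. ev b \<noteq> 1}))"
  have c0_lt: "c0 < 1"
    unfolding c0_def using fin B one by (subst Max_less_iff) (auto simp: eigenbasis_def not_le[symmetric])
  have c0_ge: "c0 \<ge> -1" "\<And>b. b \<in> B \<Longrightarrow> ev b \<noteq> 1 \<Longrightarrow> Re (ev b) \<le> c0"
    unfolding c0_def using fin by (auto intro!: Max_ge)
  define c \<epsilon> where "c = (c0 + 1) / 2" "\<epsilon> = arccos c"
  have c: "c0 < c" "c < 1" "-1 < c"
    using c0_lt c0_ge(1) by (auto simp: c_\<epsilon>_def)
  have cos: "cos \<epsilon> = c" using c by (simp add: c_\<epsilon>_def)
  have \<epsilon>: "0 < \<epsilon>" "\<epsilon> < pi"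
    using c arccos_lt_bounded[of c] by (auto simp: c_\<epsilon>_def)
  have dim: "vec.dim {x\<in>X. V x = x} = card {b\<in>B. ev b = 1}"
    using dim_eigenspace[OF B V X, of 1] by simp
  have gt: "Re (ev b) > c \<longleftrightarrow> ev b = 1" if "b \<in> B" for b
    using c c0_ge(2)[OF that] by force
  have ne: "\<forall>b\<in>B. Re (cnj (cis 0) * ev b) \<noteq> c"
  proof
    fix b assume "b \<in> B"
    then show "Re (cnj (cis 0) * ev b) \<noteq> c"
      using c c0_ge(2)[of b] by (cases "ev b = 1") auto
  qed
  have noev: "no_eigenvalue X V (cis \<epsilon>)"
    unfolding no_eigenvalue_iff[OF B V X] using ne cos by fastforce
  have cnt: "arc_count X V \<epsilon> = vec.dim {x\<in>X. V x = x}"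
  proof -
    have "ev b \<in> cis ` {0..<\<epsilon>} \<longleftrightarrow> ev b = 1" if b: "b \<in> B" for b
    proof
      assume "ev b \<in> cis ` {0..<\<epsilon>}"
      then obtain \<theta> where "ev b = cis \<theta>" "0 \<le> \<theta>" "\<theta> < \<epsilon>" by auto
      then have "Re (ev b) > c"
        using cos_monotone_0_pi[of \<theta> \<epsilon>] \<epsilon> cos by simp
      then show "ev b = 1" using gt[OF b] by simp
    next
      assume "ev b = 1"
      then show "ev b \<in> cis ` {0..<\<epsilon>}" using \<epsilon> by (intro image_eqI[of _ _ 0]) auto
    qed
    then have "{b\<in>B. ev b \<in> cis ` {0..<\<epsilon>}} = {b\<in>B. ev b = 1}" by blast
    then show ?thesis by (simp add: arc_count_eq_card[OF B V X] dim)
  qed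
  obtain \<delta> where \<delta>: "\<delta> > 0"
    "\<forall>V' B' ev'. eigenbasis X V' B' ev' \<longrightarrow> unitary_iso X X V' \<longrightarrow> op_close X \<delta> V' V \<longrightarrow>
       card {b\<in>B'. Re (cnj (cis 0) * ev' b) > c} = card {b\<in>B. Re (cnj (cis 0) * ev b) > c} \<and>
       (\<forall>b\<in>B'. Re (cnj (cis 0) * ev' b) \<noteq> c)"
    using half_plane_count_locally_constant[OF B V X norm_cis, OF ne] by blast
  have B_eq: "card {b\<in>B. Re (cnj (cis 0) * ev b) > c} = card {b\<in>B. ev b = 1}"
    by (rule arg_cong[where f = card]) (use gt in auto)
  show thesis
  proof (rule that[OF \<epsilon> noev \<delta>(1) cnt])
    fix V' B' ev' assume "eigenbasis X V' B' ev'" "unitary_iso X X V'" "op_close X \<delta> V' V"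
    with \<delta>(2) have "card {b\<in>B'. Re (cnj (cis 0) * ev' b) > c} = card {b\<in>B. Re (cnj (cis 0) * ev b) > c}"
      by blast
    then show "card {b\<in>B'. Re (ev' b) > cos \<epsilon>} = vec.dim {x\<in>X. V x = x}"
      unfolding B_eq dim cos by simp
  qed
qed

lemma arc_count_constant_multiplicity_one:
  assumes V: "unitary_iso X X V" and X: "vec.subspace X"
    and \<epsilon>: "0 < \<epsilon>" "\<epsilon> < pi" "no_eigenvalue X V (cis \<epsilon>)"
  shows "\<exists>\<delta>>0. \<forall>V'. unitary_iso X X V' \<longrightarrow> op_close X \<delta> V' V \<longrightarrow>
      vec.dim {x\<in>X. V' x = x} = vec.dim {x\<in>X. V x = x} \<longrightarrow>
      int (arc_count X V' \<epsilon>) - int (arc_count X V \<epsilon>) = 0"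
proof -
  obtain \<epsilon>1 \<delta>1 where 1: "0 < \<epsilon>1" "\<epsilon>1 < pi" "no_eigenvalue X V (cis \<epsilon>1)" "\<delta>1 > 0"
    "arc_count X V \<epsilon>1 = vec.dim {x\<in>X. V x = x}"
    "\<And>V' B' ev'. eigenbasis X V' B' ev' \<Longrightarrow> unitary_iso X X V' \<Longrightarrow> op_close X \<delta>1 V' V \<Longrightarrow>
       card {b\<in>B'. Re (ev' b) > cos \<epsilon>1} = vec.dim {x\<in>X. V x = x}"
    by (rule arc_count_near_one[OF V X]) (rule that)
  obtain \<delta>2 where 2: "\<delta>2 > 0" "\<And>V'. unitary_iso X X V' \<Longrightarrow> op_close X \<delta>2 V' V \<Longrightarrow>
      int (arc_count X V' \<epsilon>) - int (arc_count X V \<epsilon>) = int (arc_count X V' \<epsilon>1) - int (arc_count X V \<epsilon>1)"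
    using arc_count_diff_locally_constant[OF V X \<epsilon>(1,2) 1(1,2) \<epsilon>(3) 1(3)] by blast
  have "int (arc_count X V' \<epsilon>) - int (arc_count X V \<epsilon>) = 0"
    if V': "unitary_iso X X V'" and cl: "op_close X (min \<delta>1 \<delta>2) V' V"
      and dim: "vec.dim {x\<in>X. V' x = x} = vec.dim {x\<in>X. V x = x}" for V'
  proof -
    have cl: "op_close X \<delta>1 V' V" "op_close X \<delta>2 V' V"
      using cl by (auto intro: op_close_mono)
    obtain B' ev' where B': "eigenbasis X V' B' ev'"
      using unitary_eigenbasis_exists[OF V' X] by blast
    have fin: "finite B'" by (rule eigenbasis_finite[OF B'])
    have "card {b\<in>B'. ev' b = 1} = card {b\<in>B'. Re (ev' b) > cos \<epsilon>1}"
      using 1(6)[OF B' V' cl(1)] dim dim_eigenspace[OF B' V' X, of 1] by simp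
    moreover have lt1: "cos \<epsilon>1 < 1"
      using cos_monotone_0_pi[of 0 \<epsilon>1] 1(1,2) by simp
    moreover have "{b\<in>B'. ev' b = 1} \<subseteq> {b\<in>B'. Re (ev' b) > cos \<epsilon>1}"
      using lt1 by auto
    ultimately have eq: "{b\<in>B'. ev' b = 1} = {b\<in>B'. Re (ev' b) > cos \<epsilon>1}"
      using fin by (intro card_subset_eq) auto
    have "ev' b \<in> cis ` {0..<\<epsilon>1} \<longleftrightarrow> ev' b = 1" if b: "b \<in> B'" for b
    proof
      assume "ev' b \<in> cis ` {0..<\<epsilon>1}"
      then obtain \<theta> where "ev' b = cis \<theta>" "0 \<le> \<theta>" "\<theta> < \<epsilon>1" by auto
      then have "Re (ev' b) > cos \<epsilon>1"
        using cos_monotone_0_pi[of \<theta> \<epsilon>1] 1(1,2) by simp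
      then show "ev' b = 1" using eq b by blast
    next
      assume "ev' b = 1"
      then show "ev' b \<in> cis ` {0..<\<epsilon>1}" using 1(1) by (intro image_eqI[of _ _ 0]) auto
    qed
    then have "{b\<in>B'. ev' b \<in> cis ` {0..<\<epsilon>1}} = {b\<in>B'. ev' b = 1}" by blast
    then have "arc_count X V' \<epsilon>1 = arc_count X V \<epsilon>1"
      using dim dim_eigenspace[OF B' V' X, of 1] by (simp add: arc_count_eq_card[OF B' V' X] 1(5))
    then show ?thesis using 2(2)[OF V' cl(2)] by simp
  qed
  then show ?thesis
    using 1(4) 2(1) by (intro exI[of _ "min \<delta>1 \<delta>2"]) auto
qed

lemma arc_count_conjugation_symmetric:
  assumes V: "unitary_iso X X V" and X: "vec.subspace X"
    and \<epsilon>: "0 < \<epsilon>" "\<epsilon> < pi" "no_eigenvalue X V (cis \<epsilon>)"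
  shows "\<exists>\<delta>>0. \<forall>V'. unitary_iso X X V' \<longrightarrow> op_close X \<delta> V' V \<longrightarrow>
      (\<forall>\<mu>. norm \<mu> = 1 \<longrightarrow> vec.dim {x\<in>X. V' x = cnj \<mu> *s x} = vec.dim {x\<in>X. V' x = \<mu> *s x}) \<longrightarrow>
      2 * (int (arc_count X V' \<epsilon>) - int (arc_count X V \<epsilon>)) =
        int (vec.dim {x\<in>X. V' x = x}) - int (vec.dim {x\<in>X. V x = x})"
proof -
  obtain \<epsilon>1 \<delta>1 where 1: "0 < \<epsilon>1" "\<epsilon>1 < pi" "no_eigenvalue X V (cis \<epsilon>1)" "\<delta>1 > 0"
    "arc_count X V \<epsilon>1 = vec.dim {x\<in>X. V x = x}"
    "\<And>V' B' ev'. eigenbasis X V' B' ev' \<Longrightarrow> unitary_iso X X V' \<Longrightarrow> op_close X \<delta>1 V' V \<Longrightarrow>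
       card {b\<in>B'. Re (ev' b) > cos \<epsilon>1} = vec.dim {x\<in>X. V x = x}"
    by (rule arc_count_near_one[OF V X]) (rule that)
  obtain \<delta>2 where 2: "\<delta>2 > 0" "\<And>V'. unitary_iso X X V' \<Longrightarrow> op_close X \<delta>2 V' V \<Longrightarrow>
      int (arc_count X V' \<epsilon>) - int (arc_count X V \<epsilon>) = int (arc_count X V' \<epsilon>1) - int (arc_count X V \<epsilon>1)"
    using arc_count_diff_locally_constant[OF V X \<epsilon>(1,2) 1(1,2) \<epsilon>(3) 1(3)] by blast
  have "2 * (int (arc_count X V' \<epsilon>) - int (arc_count X V \<epsilon>)) =
        int (vec.dim {x\<in>X. V' x = x}) - int (vec.dim {x\<in>X. V x = x})"
    if V': "unitary_iso X X V'" and cl: "op_close X (min \<delta>1 \<delta>2) V' V"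
      and sym: "\<forall>\<mu>. norm \<mu> = 1 \<longrightarrow> vec.dim {x\<in>X. V' x = cnj \<mu> *s x} = vec.dim {x\<in>X. V' x = \<mu> *s x}" for V'
  proof -
    have cl: "op_close X \<delta>1 V' V" "op_close X \<delta>2 V' V"
      using cl by (auto intro: op_close_mono)
    obtain B' ev' where B': "eigenbasis X V' B' ev'"
      using unitary_eigenbasis_exists[OF V' X] by blast
    have fin: "finite B'" by (rule eigenbasis_finite[OF B'])
    have nev: "norm (ev' b) = 1" if "b \<in> B'" for b
      using B' that by (simp add: eigenbasis_def)
    have mult: "card {b\<in>B'. ev' b = cnj \<mu>} = card {b\<in>B'. ev' b = \<mu>}" if "norm \<mu> = 1" for \<mu>
      using sym that by (simp add: dim_eigenspace[OF B' V' X])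
    let ?U = "{b\<in>B'. Re (ev' b) > cos \<epsilon>1 \<and> Im (ev' b) > 0}"
    let ?L = "{b\<in>B'. Re (ev' b) > cos \<epsilon>1 \<and> Im (ev' b) < 0}"
    let ?O = "{b\<in>B'. ev' b = 1}"
    have lt1: "cos \<epsilon>1 < 1"
      using cos_monotone_0_pi[of 0 \<epsilon>1] 1(1,2) by simp
    have gtm1: "cos \<epsilon>1 > - 1"
      using cos_monotone_0_pi[of \<epsilon>1 pi] 1(1,2) by simp
    have Im0: "ev' b = 1" if "b \<in> B'" "Re (ev' b) > cos \<epsilon>1" "Im (ev' b) = 0" for b
    proof -
      have "(Re (ev' b))\<^sup>2 = 1"
        using nev[OF that(1)] that(3) cmod_power2[of "ev' b"] by simp
      then have "Re (ev' b) = 1 \<or> Re (ev' b) = - 1" by (simp add: power2_eq_1_iff)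
      then show ?thesis using that gtm1 by (auto simp: complex_eq_iff)
    qed
    have arc: "ev' b \<in> cis ` {0..<\<epsilon>1} \<longleftrightarrow> b \<in> ?O \<or> b \<in> ?U" if b: "b \<in> B'" for b
    proof
      assume "ev' b \<in> cis ` {0..<\<epsilon>1}"
      then obtain \<theta> where \<theta>: "ev' b = cis \<theta>" "0 \<le> \<theta>" "\<theta> < \<epsilon>1" by auto
      show "b \<in> ?O \<or> b \<in> ?U"
      proof (cases "\<theta> = 0")
        case False
        then have "Re (ev' b) > cos \<epsilon>1" "Im (ev' b) > 0"
          using cos_monotone_0_pi[of \<theta> \<epsilon>1] sin_gt_zero[of \<theta>] \<theta> 1(2) by auto
        then show ?thesis using b by simp
      qed (use \<theta> b in auto)
    next
      assume *: "b \<in> ?O \<or> b \<in> ?U"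
      show "ev' b \<in> cis ` {0..<\<epsilon>1}"
      proof (cases "ev' b = 1")
        case True
        then show ?thesis using 1(1) by (intro image_eqI[of _ _ 0]) auto
      next
        case False
        then have U: "Re (ev' b) > cos \<epsilon>1" "Im (ev' b) > 0" using * by auto
        then have "ev' b \<in> cis ` {0 - \<epsilon>1<..<0 + \<epsilon>1}"
          using arc_iff_half_plane[of "ev' b" \<epsilon>1 0] nev[OF b] 1(1,2) by simp
        then obtain \<theta> where \<theta>: "ev' b = cis \<theta>" "- \<epsilon>1 < \<theta>" "\<theta> < \<epsilon>1" by auto
        have "\<theta> > 0"
        proof (rule ccontr)
          assume "\<not> \<theta> > 0"
          then have "sin (- \<theta>) \<ge> 0"
            using \<theta> 1(2) by (intro sin_ge_zero) auto
          then show False using U(2) \<theta>(1) by simp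
        qed
        then show ?thesis using \<theta> by (intro image_eqI[of _ _ \<theta>]) auto
      qed
    qed
    have "?O \<inter> ?U = {}" by auto
    moreover have "{b\<in>B'. ev' b \<in> cis ` {0..<\<epsilon>1}} = ?O \<union> ?U" using arc by blast
    ultimately have cnt: "arc_count X V' \<epsilon>1 = card ?O + card ?U"
      using fin by (simp add: arc_count_eq_card[OF B' V' X] card_Un_disjoint)
    have "{b\<in>B'. Re (ev' b) > cos \<epsilon>1} = ?O \<union> ?U \<union> ?L"
      using Im0 lt1 by (auto simp: neq_iff) (metis linorder_neqE_linordered_idom)
    moreover have "(?O \<union> ?U) \<inter> ?L = {}" "?O \<inter> ?U = {}" by auto
    ultimately have tot: "card {b\<in>B'. Re (ev' b) > cos \<epsilon>1} = card ?O + card ?U + card ?L"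
      using fin by (simp add: card_Un_disjoint)
    have UL: "card ?U = card ?L"
    proof -
      let ?Up = "{\<mu>\<in>ev' ` B' \<union> cnj ` ev' ` B'. Re \<mu> > cos \<epsilon>1 \<and> Im \<mu> > 0}"
      let ?Low = "{\<mu>\<in>ev' ` B' \<union> cnj ` ev' ` B'. Re \<mu> > cos \<epsilon>1 \<and> Im \<mu> < 0}"
      have finM: "finite ?Up" "finite ?Low" using fin by auto
      have "?Low = cnj ` ?Up"
      proof
        show "?Low \<subseteq> cnj ` ?Up"
        proof
          fix \<mu> assume "\<mu> \<in> ?Low"
          then show "\<mu> \<in> cnj ` ?Up"
            by (intro image_eqI[of _ _ "cnj \<mu>"]) (auto simp: image_iff)
        qed
      qed (auto simp: image_iff)
      have "card ?L = card {b\<in>B'. ev' b \<in> ?Low}"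
        by (rule arg_cong[where f = card]) auto
      also have "\<dots> = (\<Sum>\<mu>\<in>?Low. card {b\<in>B'. ev' b = \<mu>})"
        by (rule finite_card_sum_preimage[OF fin finM(2)])
      also have "\<dots> = (\<Sum>\<mu>\<in>?Up. card {b\<in>B'. ev' b = cnj \<mu>})"
        unfolding \<open>?Low = cnj ` ?Up\<close> by (subst sum.reindex) (auto simp: inj_on_def)
      also have "\<dots> = (\<Sum>\<mu>\<in>?Up. card {b\<in>B'. ev' b = \<mu>})"
        by (intro sum.cong refl mult) (use nev in auto)
      also have "\<dots> = card {b\<in>B'. ev' b \<in> ?Up}"
        by (rule finite_card_sum_preimage[OF fin finM(1), symmetric])
      also have "\<dots> = card ?U"
        by (rule arg_cong[where f = card]) auto
      finally show ?thesis by simp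
    qed
    have "card {b\<in>B'. Re (ev' b) > cos \<epsilon>1} = vec.dim {x\<in>X. V x = x}"
      by (rule 1(6)[OF B' V' cl(1)])
    then have "int (vec.dim {x\<in>X. V x = x}) = int (card ?O) + int (card ?U) + int (card ?L)"
      using tot by simp
    moreover have "int (vec.dim {x\<in>X. V' x = x}) = int (card ?O)"
      using dim_eigenspace[OF B' V' X, of 1] by simp
    moreover have "int (arc_count X V' \<epsilon>1) = int (card ?O) + int (card ?U)"
      using cnt by simp
    moreover have "int (arc_count X V \<epsilon>1) = int (vec.dim {x\<in>X. V x = x})"
      using 1(5) by simp
    moreover have "int (card ?U) = int (card ?L)"
      using UL by simp
    ultimately show ?thesis
      using 2(2)[OF V' cl(2)] by (simp only:) (simp add: algebra_simps)
  qed
  then show ?thesis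
    using 1(4) 2(1) by (intro exI[of _ "min \<delta>1 \<delta>2"]) auto
qed

section \<open>Spectral flow\<close>

definition op_continuous_on ::
  "'a::topological_space set \<Rightarrow> (complex ^ 'm::finite) set \<Rightarrow> ('a \<Rightarrow> complex ^ 'm \<Rightarrow> complex ^ 'm) \<Rightarrow> bool" where
  "op_continuous_on S X V \<longleftrightarrow> (\<forall>p\<in>S. \<forall>\<delta>>0. \<forall>\<^sub>F q in at p within S. op_close X \<delta> (V q) (V p))"

lemma op_continuous_on_compose:
  assumes "op_continuous_on S X V" "continuous_on T f" "f ` T \<subseteq> S"
  shows "op_continuous_on T X (\<lambda>t. V (f t))"
  unfolding op_continuous_on_def
proof (intro ballI allI impI)
  fix p and \<delta> :: real assume p: "p \<in> T" and \<delta>: "\<delta> > 0"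
  have fp: "f p \<in> S" using assms(3) p by auto
  then have "\<forall>\<^sub>F q in at (f p) within S. op_close X \<delta> (V q) (V (f p))"
    using assms(1) \<delta> by (auto simp: op_continuous_on_def)
  then obtain U where U: "open U" "f p \<in> U" "\<And>q. q \<in> U \<Longrightarrow> q \<noteq> f p \<Longrightarrow> q \<in> S \<Longrightarrow> op_close X \<delta> (V q) (V (f p))"
    by (auto simp: eventually_at_topological)
  have self: "op_close X \<delta> (V (f p)) (V (f p))"
    using \<delta> by (simp add: op_close_def)
  obtain A where A: "open A" "p \<in> A" "\<And>t. t \<in> A \<Longrightarrow> t \<in> T \<Longrightarrow> f t \<in> U"
    using assms(2)[unfolded continuous_on_topological, rule_format, OF p U(1,2)] by blast
  show "\<forall>\<^sub>F t in at p within T. op_close X \<delta> (V (f t)) (V (f p))"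
    unfolding eventually_at_topological
  proof (intro exI[of _ A] conjI ballI impI A(1,2))
    fix t assume "t \<in> A" "t \<noteq> p" "t \<in> T"
    then show "op_close X \<delta> (V (f t)) (V (f p))"
      using A(3) U(3)[of "f t"] self assms(3) by (cases "f t = f p") auto
  qed
qed

lemma eventually_within_imp_nhd:
  assumes "\<forall>\<^sub>F q in at p within S. P q" "P p"
  shows "\<exists>U. open U \<and> p \<in> U \<and> (\<forall>q\<in>U \<inter> S. P q)"
  using assms unfolding eventually_at_topological by (metis IntD1 IntD2)

context
  fixes X :: "(complex ^ 'm::finite) set" and S :: "'a::topological_space set"
    and V :: "'a \<Rightarrow> complex ^ 'm \<Rightarrow> complex ^ 'm"
  assumes X: "vec.subspace X" and V: "\<And>p. p \<in> S \<Longrightarrow> unitary_iso X X (V p)"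
    and cont: "op_continuous_on S X V"
begin

lemma eventually_no_eigenvalue:
  assumes p: "p \<in> S" and ne: "no_eigenvalue X (V p) (cis \<epsilon>)"
  shows "\<forall>\<^sub>F q in at p within S. no_eigenvalue X (V q) (cis \<epsilon>)"
proof -
  obtain \<delta> where \<delta>: "\<delta> > 0" "\<And>V'. unitary_iso X X V' \<Longrightarrow> op_close X \<delta> V' (V p) \<Longrightarrow> no_eigenvalue X V' (cis \<epsilon>)"
    by (rule no_eigenvalue_locally_constant[OF V[OF p] X ne]) (rule that)
  have "\<forall>\<^sub>F q in at p within S. op_close X \<delta> (V q) (V p)"
    using cont p \<delta>(1) by (simp add: op_continuous_on_def)
  moreover have "\<forall>\<^sub>F q in at p within S. q \<in> S"
    by (simp add: eventually_at_filter)
  ultimately show ?thesis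
    by eventually_elim (rule \<delta>(2)[OF V])
qed

lemma eventually_arc_count_diff:
  assumes p: "p \<in> S" and \<epsilon>: "0 < \<epsilon>" "\<epsilon> < pi" "0 < \<epsilon>'" "\<epsilon>' < pi"
    and ne: "no_eigenvalue X (V p) (cis \<epsilon>)" "no_eigenvalue X (V p) (cis \<epsilon>')"
  shows "\<forall>\<^sub>F q in at p within S. int (arc_count X (V q) \<epsilon>) - int (arc_count X (V p) \<epsilon>) =
     int (arc_count X (V q) \<epsilon>') - int (arc_count X (V p) \<epsilon>')"
proof -
  obtain \<delta> where \<delta>: "\<delta> > 0" "\<And>V'. unitary_iso X X V' \<Longrightarrow> op_close X \<delta> V' (V p) \<Longrightarrow>
       int (arc_count X V' \<epsilon>) - int (arc_count X (V p) \<epsilon>) = int (arc_count X V' \<epsilon>') - int (arc_count X (V p) \<epsilon>')"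
    using arc_count_diff_locally_constant[OF V[OF p] X \<epsilon> ne] by blast
  have "\<forall>\<^sub>F q in at p within S. op_close X \<delta> (V q) (V p)"
    using cont p \<delta>(1) by (simp add: op_continuous_on_def)
  moreover have "\<forall>\<^sub>F q in at p within S. q \<in> S"
    by (simp add: eventually_at_filter)
  ultimately show ?thesis
    by eventually_elim (rule \<delta>(2)[OF V])
qed

end

text \<open>Clamping \<open>t\<close> to \<open>[s j, s (Suc j)]\<close> splits the increment of a function from \<open>s 0\<close> to \<open>t\<close> into its
  increments over the pieces of the partition.\<close>

lemma sum_clamp_telescope:
  fixes s :: "nat \<Rightarrow> real" and f :: "real \<Rightarrow> int"
  assumes "\<And>j. j < N \<Longrightarrow> s j \<le> s (Suc j)" "s 0 \<le> t" "t \<le> s N"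
  shows "(\<Sum>j<N. f (min (max t (s j)) (s (Suc j))) - f (s j)) = f t - f (s 0)"
  using assms
proof (induction N arbitrary: t)
  case 0
  then show ?case by simp
next
  case (Suc N)
  have mono: "s j \<le> s k" if "j \<le> k" "k \<le> N" for j k
    using that(2,1) by (induction k) (auto simp: le_Suc_eq intro: order_trans[OF _ Suc.prems(1)])
  show ?case
  proof (cases "t \<le> s N")
    case True
    then have "min (max t (s N)) (s (Suc N)) = s N"
      using Suc.prems(1)[of N] by auto
    moreover have "(\<Sum>j<N. f (min (max t (s j)) (s (Suc j))) - f (s j)) = f t - f (s 0)"
      by (rule Suc.IH) (use Suc.prems True in auto)
    ultimately show ?thesis by simp
  next
    case False
    have "(\<Sum>j<N. f (min (max t (s j)) (s (Suc j))) - f (s j)) = (\<Sum>j<N. f (min (max (s N) (s j)) (s (Suc j))) - f (s j))"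
    proof (intro sum.cong refl)
      fix j assume "j \<in> {..<N}"
      then have "s j \<le> s N" "s (Suc j) \<le> s N"
        using mono by auto
      then show "f (min (max t (s j)) (s (Suc j))) - f (s j) = f (min (max (s N) (s j)) (s (Suc j))) - f (s j)"
        using False by (simp add: max_def min_def)
    qed
    also have "\<dots> = f (s N) - f (s 0)"
      by (rule Suc.IH) (use Suc.prems mono[of 0 N] in auto)
    finally show ?thesis
      using False Suc.prems by (simp add: max_def min_def)
  qed
qed

text \<open>Along a partition the crossings seen up to time \<open>t\<close> define a function of \<open>t\<close> whose local
  increments are those of \<open>arc_count\<close> for any admissible \<open>\<epsilon>\<close>. The functions belonging to two
  partitions therefore differ by a constant.\<close>

lemma has_spectral_flow_l_unique:
  assumes X: "vec.subspace X" and V: "\<And>t. t \<in> {a..b} \<Longrightarrow> unitary_iso X X (V t)"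
    and cont: "op_continuous_on {a..b} X V" and ab: "a \<le> b"
    and k: "has_spectral_flow_l X V a b k" "has_spectral_flow_l X V a b k'"
  shows "k = k'"
proof -
  have potential: "\<exists>F. F a = 0 \<and> F b = k \<and>
      (\<forall>t\<in>{a..b}. \<forall>\<epsilon>. 0 < \<epsilon> \<longrightarrow> \<epsilon> < pi \<longrightarrow> no_eigenvalue X (V t) (cis \<epsilon>) \<longrightarrow>
        (\<forall>\<^sub>F u in at t within {a..b}. F u - F t = int (arc_count X (V u) \<epsilon>) - int (arc_count X (V t) \<epsilon>)))"
    if flow: "has_spectral_flow_l X V a b k" for k
  proof -
    obtain N :: nat and s \<epsilon> where s: "s 0 = a" "s N = b" "\<And>j. j < N \<Longrightarrow> s j \<le> s (Suc j)"
      and \<epsilon>: "\<And>j. j < N \<Longrightarrow> 0 < \<epsilon> j \<and> \<epsilon> j < pi"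
      and ne: "\<And>j t. j < N \<Longrightarrow> t \<in> {s j..s (Suc j)} \<Longrightarrow> no_eigenvalue X (V t) (cis (\<epsilon> j))"
      and k: "k = (\<Sum>j<N. int (arc_count X (V (s (Suc j))) (\<epsilon> j)) - int (arc_count X (V (s j)) (\<epsilon> j)))"
      using flow unfolding has_spectral_flow_l_def no_eigenvalue_def by blast
    have mono: "s j \<le> s k" if "j \<le> k" "k \<le> N" for j k
      using that(2,1) by (induction k) (auto simp: le_Suc_eq intro: order_trans[OF _ s(3)])
    have sab: "s j \<in> {a..b}" if "j \<le> N" for j
      using mono[of 0 j] mono[of j N] that s by auto
    define \<tau> where "\<tau> j t = min (max t (s j)) (s (Suc j))" for j t
    define c where "c t e = int (arc_count X (V t) e)" for t e
    define F where "F t = (\<Sum>j<N. c (\<tau> j t) (\<epsilon> j) - c (s j) (\<epsilon> j))" for t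
    have \<tau>_in: "\<tau> j t \<in> {s j..s (Suc j)}" if "j < N" for j t
      using s(3)[OF that] by (auto simp: \<tau>_def)
    have "\<tau> j a = s j" "\<tau> j b = s (Suc j)" if "j < N" for j
      using that s(3)[OF that] sab[of j] sab[of "Suc j"] by (auto simp: \<tau>_def)
    then have "F a = 0" "F b = k"
      unfolding F_def k c_def by (auto intro!: sum.neutral sum.cong)
    moreover have "\<forall>\<^sub>F u in at t within {a..b}. F u - F t = c u e - c t e"
      if t: "t \<in> {a..b}" and e: "0 < e" "e < pi" "no_eigenvalue X (V t) (cis e)" for t e
    proof -
      have "\<forall>\<^sub>F u in at t within {a..b}. c (\<tau> j u) (\<epsilon> j) - c (\<tau> j t) (\<epsilon> j) = c (\<tau> j u) e - c (\<tau> j t) e"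
        if j: "j < N" for j
      proof -
        consider "t \<in> {s j..s (Suc j)}" | "t < s j" | "t > s (Suc j)" by force
        then show ?thesis
        proof cases
          case 1
          have "\<forall>\<^sub>F u in at t within {a..b}. c u (\<epsilon> j) - c t (\<epsilon> j) = c u e - c t e"
            unfolding c_def using \<epsilon>[OF j]
            by (intro eventually_arc_count_diff[OF X V cont t] e ne[OF j 1]) auto
          then obtain d where d: "d > 0" "\<And>u. u \<in> {a..b} \<Longrightarrow> u \<noteq> t \<Longrightarrow> dist u t < d \<Longrightarrow> c u (\<epsilon> j) - c t (\<epsilon> j) = c u e - c t e"
            unfolding eventually_at by blast
          have "\<tau> j t = t" using 1 by (auto simp: \<tau>_def)
          show ?thesis
            unfolding eventually_at
          proof (intro exI[of _ d] conjI d(1) ballI impI)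
            fix u assume u: "u \<in> {a..b}" "u \<noteq> t \<and> dist u t < d"
            have "dist (\<tau> j u) t < d" "\<tau> j u \<in> {a..b}"
              using u 1 \<tau>_in[OF j, of u] sab[of j] sab[of "Suc j"] j by (auto simp: \<tau>_def dist_real_def)
            then show "c (\<tau> j u) (\<epsilon> j) - c (\<tau> j t) (\<epsilon> j) = c (\<tau> j u) e - c (\<tau> j t) e"
              using d(2)[of "\<tau> j u"] \<open>\<tau> j t = t\<close> by (cases "\<tau> j u = t") auto
          qed
        next
          case 2
          show ?thesis
            unfolding eventually_at
            by (intro exI[of _ "s j - t"] conjI ballI impI) (use 2 s(3)[OF j] in \<open>auto simp: \<tau>_def dist_real_def\<close>)
        next
          case 3
          show ?thesis
            unfolding eventually_at
            by (intro exI[of _ "t - s (Suc j)"] conjI ballI impI) (use 3 s(3)[OF j] in \<open>auto simp: \<tau>_def dist_real_def\<close>)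
        qed
      qed
      then have "\<forall>\<^sub>F u in at t within {a..b}. \<forall>j\<in>{..<N}. c (\<tau> j u) (\<epsilon> j) - c (\<tau> j t) (\<epsilon> j) = c (\<tau> j u) e - c (\<tau> j t) e"
        by (intro eventually_ball_finite) auto
      moreover have "\<forall>\<^sub>F u in at t within {a..b}. u \<in> {a..b}"
        by (simp add: eventually_at_filter)
      ultimately show ?thesis
      proof eventually_elim
        case (elim u)
        have tel: "(\<Sum>j<N. c (\<tau> j v) e - c (s j) e) = c v e - c a e" if "v \<in> {a..b}" for v
          using sum_clamp_telescope[of N s v "\<lambda>v. c v e"] s that by (simp add: \<tau>_def)
        have "F u - F t = (\<Sum>j<N. c (\<tau> j u) (\<epsilon> j) - c (\<tau> j t) (\<epsilon> j))"
          by (simp add: F_def flip: sum_subtractf)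
        also have "\<dots> = (\<Sum>j<N. c (\<tau> j u) e - c (\<tau> j t) e)"
          using elim(1) by (intro sum.cong) auto
        also have "\<dots> = (\<Sum>j<N. c (\<tau> j u) e - c (s j) e) - (\<Sum>j<N. c (\<tau> j t) e - c (s j) e)"
          by (simp flip: sum_subtractf)
        also have "\<dots> = c u e - c t e"
          using tel[OF elim(2)] tel[OF t] by simp
        finally show ?case .
      qed
    qed
    ultimately show ?thesis
      unfolding c_def by blast
  qed
  obtain F where F: "F a = 0" "F b = k"
    "\<And>t \<epsilon>. t \<in> {a..b} \<Longrightarrow> 0 < \<epsilon> \<Longrightarrow> \<epsilon> < pi \<Longrightarrow> no_eigenvalue X (V t) (cis \<epsilon>) \<Longrightarrow>
        \<forall>\<^sub>F u in at t within {a..b}. F u - F t = int (arc_count X (V u) \<epsilon>) - int (arc_count X (V t) \<epsilon>)"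
    using potential[OF k(1)] by blast
  obtain F' where F': "F' a = 0" "F' b = k'"
    "\<And>t \<epsilon>. t \<in> {a..b} \<Longrightarrow> 0 < \<epsilon> \<Longrightarrow> \<epsilon> < pi \<Longrightarrow> no_eigenvalue X (V t) (cis \<epsilon>) \<Longrightarrow>
        \<forall>\<^sub>F u in at t within {a..b}. F' u - F' t = int (arc_count X (V u) \<epsilon>) - int (arc_count X (V t) \<epsilon>)"
    using potential[OF k(2)] by blast
  have "F a - F' a = F b - F' b"
  proof (rule connected_local_const[of "{a..b}" a b "\<lambda>t. F t - F' t"])
    show "\<forall>t\<in>{a..b}. \<forall>\<^sub>F u in at t within {a..b}. F t - F' t = F u - F' u"
    proof
      fix t assume t: "t \<in> {a..b}"
      obtain \<epsilon> where \<epsilon>: "0 < \<epsilon>" "\<epsilon> < pi" "no_eigenvalue X (V t) (cis \<epsilon>)"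
        using ex_no_eigenvalue[OF V[OF t] X] by blast
      show "\<forall>\<^sub>F u in at t within {a..b}. F t - F' t = F u - F' u"
        using F(3)[OF t \<epsilon>] F'(3)[OF t \<epsilon>] by eventually_elim simp
    qed
  qed (use ab in auto)
  then show ?thesis using F F' by simp
qed

lemma has_spectral_flow_l_cong:
  assumes "\<And>t. t \<in> {a..b} \<Longrightarrow> V t = V' t"
  shows "has_spectral_flow_l X V a b k \<longleftrightarrow> has_spectral_flow_l X V' a b k"
proof -
  have "has_spectral_flow_l X V' a b k"
    if flow: "has_spectral_flow_l X V a b k" and eq: "\<And>t. t \<in> {a..b} \<Longrightarrow> V t = V' t" for V V'
  proof -
    obtain N :: nat and s \<epsilon> where s: "s 0 = a" "s N = b" "\<forall>j<N. s j \<le> s (Suc j)"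
      and \<epsilon>: "\<forall>j<N. 0 < \<epsilon> j \<and> \<epsilon> j < pi \<and> (\<forall>t\<in>{s j..s (Suc j)}. \<forall>x\<in>X. V t x = cis (\<epsilon> j) *s x \<longrightarrow> x = 0)"
      and k: "k = (\<Sum>j<N. int (arc_count X (V (s (Suc j))) (\<epsilon> j)) - int (arc_count X (V (s j)) (\<epsilon> j)))"
      using flow unfolding has_spectral_flow_l_def by blast
    have mono: "s j \<le> s i" if "j \<le> i" "i \<le> N" for j i
      using that(2,1) by (induction i) (auto simp: le_Suc_eq intro: order_trans[OF _ s(3)[rule_format]])
    have sab: "s j \<in> {a..b}" if "j \<le> N" for j
      using mono[of 0 j] mono[of j N] that s by auto
    have eq': "V t = V' t" if "j < N" "t \<in> {s j..s (Suc j)}" for j t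
      using that sab[of j] sab[of "Suc j"] by (intro eq) auto
    have "\<forall>j<N. 0 < \<epsilon> j \<and> \<epsilon> j < pi \<and> (\<forall>t\<in>{s j..s (Suc j)}. \<forall>x\<in>X. V' t x = cis (\<epsilon> j) *s x \<longrightarrow> x = 0)"
    proof (intro allI impI conjI ballI)
      fix j t x assume "j < N" "t \<in> {s j..s (Suc j)}" "x \<in> X" "V' t x = cis (\<epsilon> j) *s x"
      then show "x = 0" using \<epsilon> eq'[of j t] by metis
    qed (use \<epsilon> in auto)
    moreover have "k = (\<Sum>j<N. int (arc_count X (V' (s (Suc j))) (\<epsilon> j)) - int (arc_count X (V' (s j)) (\<epsilon> j)))"
      unfolding k using eq' s(3) by (intro sum.cong refl) auto
    ultimately show ?thesis
      unfolding has_spectral_flow_l_def using s by blast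
  qed
  then show ?thesis
    using assms by metis
qed

lemma spectral_flow_l_cong:
  assumes "\<And>t. t \<in> {a..b} \<Longrightarrow> V t = V' t"
  shows "spectral_flow_l X V a b = spectral_flow_l X V' a b"
proof -
  have "has_spectral_flow_l X V a b = has_spectral_flow_l X V' a b"
    by (rule ext) (rule has_spectral_flow_l_cong[OF assms])
  then show ?thesis by (simp add: spectral_flow_l_def)
qed

lemma has_spectral_flow_l_single:
  assumes "a \<le> b" "0 < \<epsilon>" "\<epsilon> < pi" "\<And>t. t \<in> {a..b} \<Longrightarrow> no_eigenvalue X (V t) (cis \<epsilon>)"
  shows "has_spectral_flow_l X V a b (int (arc_count X (V b) \<epsilon>) - int (arc_count X (V a) \<epsilon>))"
  unfolding has_spectral_flow_l_def
  by (rule exI[of _ 1], rule exI[of _ "\<lambda>j. if j = 0 then a else b"], rule exI[of _ "\<lambda>_. \<epsilon>"])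
     (use assms in \<open>auto simp: no_eigenvalue_def\<close>)

lemma has_spectral_flow_l_concat:
  assumes "has_spectral_flow_l X V a b k" "has_spectral_flow_l X V b c l"
  shows "has_spectral_flow_l X V a c (k + l)"
proof -
  let ?P = "\<lambda>s \<epsilon> j. s j \<le> s (Suc j) \<and> 0 < \<epsilon> j \<and> \<epsilon> j < pi \<and>
      (\<forall>t\<in>{s j..s (Suc j)}. \<forall>x\<in>X. V t x = cis (\<epsilon> j) *s x \<longrightarrow> x = 0)"
  let ?S = "\<lambda>s \<epsilon> j. int (arc_count X (V (s (Suc j))) (\<epsilon> j)) - int (arc_count X (V (s j)) (\<epsilon> j))"
  obtain N :: nat and s \<epsilon> where 1: "s 0 = a" "s N = b" "\<And>j. j < N \<Longrightarrow> ?P s \<epsilon> j" "k = (\<Sum>j<N. ?S s \<epsilon> j)"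
    using assms(1) unfolding has_spectral_flow_l_def by blast
  obtain M :: nat and r \<eta> where 2: "r 0 = b" "r M = c" "\<And>j. j < M \<Longrightarrow> ?P r \<eta> j" "l = (\<Sum>j<M. ?S r \<eta> j)"
    using assms(2) unfolding has_spectral_flow_l_def by blast
  define q where "q j = (if j \<le> N then s j else r (j - N))" for j
  define \<zeta> where "\<zeta> j = (if j < N then \<epsilon> j else \<eta> (j - N))" for j
  have q1: "q j = s j" "q (Suc j) = s (Suc j)" "\<zeta> j = \<epsilon> j" if "j < N" for j
    using that by (auto simp: q_def \<zeta>_def)
  have q2: "q (N + j) = r j" "q (Suc (N + j)) = r (Suc j)" "\<zeta> (N + j) = \<eta> j" for j
    using 1(2) 2(1) by (auto simp: q_def \<zeta>_def Suc_diff_le)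
  have P: "?P q \<zeta> j" if "j < N + M" for j
  proof (cases "j < N")
    case True
    show ?thesis
      unfolding q1[OF True] by (rule 1(3)[OF True])
  next
    case False
    define i where "i = j - N"
    have i: "j = N + i" "i < M"
      using that False by (auto simp: i_def)
    show ?thesis
      unfolding i(1) q2 by (rule 2(3)[OF i(2)])
  qed
  have "(\<Sum>j<N + M. ?S q \<zeta> j) = (\<Sum>j<N. ?S q \<zeta> j) + (\<Sum>j<M. ?S q \<zeta> (N + j))"
    by (induction M) auto
  also have "\<dots> = k + l"
    unfolding 1(4) 2(4) by (intro arg_cong2[where f = "(+)"] sum.cong) (auto simp: q1 q2)
  finally have "k + l = (\<Sum>j<N + M. ?S q \<zeta> j)" by simp
  moreover have "q 0 = a" "q (N + M) = c"
    using 1(1) q2(1)[of M] 2(2) by (auto simp: q_def)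
  ultimately show ?thesis
    unfolding has_spectral_flow_l_def
    by (intro exI[of _ "N + M"] exI[of _ q] exI[of _ \<zeta>] conjI[of "q 0 = a"] conjI[of "q (N + M) = c"]
        conjI[of "\<forall>j<N + M. q j \<le> q (Suc j)"] conjI[of "\<forall>j<N + M. 0 < \<zeta> j \<and> _ j"] allI impI)
       (erule P[THEN conjunct1] P[THEN conjunct2] | assumption)+
qed

text \<open>Near \<open>(s0, z)\<close> one \<open>\<epsilon>\<close> is admissible for all operators of the family, so over a short time
  interval around \<open>z\<close> the change of the flow from \<open>s0\<close> to a neighbouring \<open>s\<close> is read off at the two
  ends. When such intervals are joined, the contributions of the common end point cancel.\<close>

lemma spectral_flow_locally:
  fixes V :: "real \<Rightarrow> real \<Rightarrow> complex ^ 'm::finite \<Rightarrow> complex ^ 'm"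
  assumes X: "vec.subspace X" and V: "\<And>s t. s \<in> A \<Longrightarrow> t \<in> {a..b} \<Longrightarrow> unitary_iso X X (V s t)"
    and cont: "op_continuous_on (A \<times> {a..b}) X (\<lambda>p. V (fst p) (snd p))" and ab: "a \<le> b"
    and s0: "s0 \<in> A"
    and \<epsilon>: "0 < \<epsilon>" "\<epsilon> < pi" "no_eigenvalue X (V s0 a) (cis \<epsilon>)"
    and \<epsilon>': "0 < \<epsilon>'" "\<epsilon>' < pi" "no_eigenvalue X (V s0 b) (cis \<epsilon>')"
  shows "\<forall>\<^sub>F s in at s0 within A. \<exists>k k0. has_spectral_flow_l X (V s) a b k \<and> has_spectral_flow_l X (V s0) a b k0 \<and>
     k - k0 = (int (arc_count X (V s b) \<epsilon>') - int (arc_count X (V s0 b) \<epsilon>'))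
            - (int (arc_count X (V s a) \<epsilon>) - int (arc_count X (V s0 a) \<epsilon>))"
proof -
  define \<Delta> where "\<Delta> s t e = int (arc_count X (V s t) e) - int (arc_count X (V s0 t) e)" for s t e
  define adm where "adm t e \<longleftrightarrow> 0 < e \<and> e < pi \<and> no_eigenvalue X (V s0 t) (cis e)" for t e
  have cont_s: "op_continuous_on A X (\<lambda>s. V s t)" if "t \<in> {a..b}" for t
  proof -
    have "continuous_on A (\<lambda>s. (s, t))"
      by (intro continuous_intros)
    moreover have "(\<lambda>s. (s, t)) ` A \<subseteq> A \<times> {a..b}"
      using that by auto
    ultimately show ?thesis
      using op_continuous_on_compose[OF cont] by fastforce
  qed
  have indep: "\<forall>\<^sub>F s in at s0 within A. \<Delta> s t e = \<Delta> s t e'"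
    if t: "t \<in> {a..b}" and "adm t e" "adm t e'" for t e e'
    unfolding \<Delta>_def using that by (intro eventually_arc_count_diff[OF X V cont_s s0] ) (auto simp: adm_def)
  have "\<forall>e e'. a \<le> a \<longrightarrow> a \<le> a \<and> b \<le> b \<longrightarrow> adm a e \<longrightarrow> adm b e' \<longrightarrow> (\<forall>\<^sub>F s in at s0 within A.
      \<exists>k k0. has_spectral_flow_l X (V s) a b k \<and> has_spectral_flow_l X (V s0) a b k0 \<and> k - k0 = \<Delta> s b e' - \<Delta> s a e)"
    (is "?P a b")
  proof -
    define Q where "Q u v \<longleftrightarrow> (a \<le> u \<and> v \<le> b \<longrightarrow> (\<forall>e e'. adm u e \<longrightarrow> adm v e' \<longrightarrow> (\<forall>\<^sub>F s in at s0 within A.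
      \<exists>k k0. has_spectral_flow_l X (V s) u v k \<and> has_spectral_flow_l X (V s0) u v k0 \<and> k - k0 = \<Delta> s v e' - \<Delta> s u e)))" for u v
    have "Q a b"
      using ab
    proof (induction rule: Bolzano)
      case (trans u v w)
      show ?case
        unfolding Q_def
      proof (intro impI allI)
        fix e e' assume uw: "a \<le> u \<and> w \<le> b" and e: "adm u e" "adm w e'"
        have v: "v \<in> {a..b}" using trans uw by auto
        obtain e'' where e'': "adm v e''"
          using ex_no_eigenvalue[OF V[OF s0 v] X] unfolding adm_def by blast
        have "\<forall>\<^sub>F s in at s0 within A. \<exists>k k0. has_spectral_flow_l X (V s) u v k \<and> has_spectral_flow_l X (V s0) u v k0 \<and> k - k0 = \<Delta> s v e'' - \<Delta> s u e"
          "\<forall>\<^sub>F s in at s0 within A. \<exists>k k0. has_spectral_flow_l X (V s) v w k \<and> has_spectral_flow_l X (V s0) v w k0 \<and> k - k0 = \<Delta> s w e' - \<Delta> s v e''"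
          using trans e e'' uw unfolding Q_def by auto
        then show "\<forall>\<^sub>F s in at s0 within A. \<exists>k k0. has_spectral_flow_l X (V s) u w k \<and> has_spectral_flow_l X (V s0) u w k0 \<and> k - k0 = \<Delta> s w e' - \<Delta> s u e"
        proof eventually_elim
          case (elim s)
          then obtain k k0 l l0 where
            "has_spectral_flow_l X (V s) u v k" "has_spectral_flow_l X (V s0) u v k0" "k - k0 = \<Delta> s v e'' - \<Delta> s u e"
            "has_spectral_flow_l X (V s) v w l" "has_spectral_flow_l X (V s0) v w l0" "l - l0 = \<Delta> s w e' - \<Delta> s v e''"
            by blast
          then show ?case
            by (intro exI[of _ "k + l"] exI[of _ "k0 + l0"]) (auto intro: has_spectral_flow_l_concat)
        qed
      qed
    next
      case (local z)
      show ?case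
      proof (cases "z \<in> {a..b}")
        case False
        then have "\<forall>u v. u \<le> z \<and> z \<le> v \<longrightarrow> \<not> (a \<le> u \<and> v \<le> b)"
          by auto
        then show ?thesis
          unfolding Q_def by (intro exI[of _ 1]) auto
      next
        case True
        obtain \<eta> where \<eta>: "adm z \<eta>"
          using ex_no_eigenvalue[OF V[OF s0 True] X] unfolding adm_def by blast
        have "\<forall>\<^sub>F p in at (s0, z) within A \<times> {a..b}. no_eigenvalue X (V (fst p) (snd p)) (cis \<eta>)"
          using \<eta> s0 True V by (intro eventually_no_eigenvalue[OF X _ cont]) (auto simp: adm_def)
        then obtain U where U: "open U" "(s0, z) \<in> U" "\<And>p. p \<in> U \<Longrightarrow> p \<in> A \<times> {a..b} \<Longrightarrow> no_eigenvalue X (V (fst p) (snd p)) (cis \<eta>)"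
          using eventually_within_imp_nhd[of "\<lambda>p. no_eigenvalue X (V (fst p) (snd p)) (cis \<eta>)" "(s0, z)" "A \<times> {a..b}"] \<eta>
          by (auto simp: adm_def)
        obtain U1 U2 where U12: "open U1" "open U2" "s0 \<in> U1" "z \<in> U2" "U1 \<times> U2 \<subseteq> U"
          using open_prod_elim[OF U(1,2)] by (metis mem_Sigma_iff)
        obtain d where d: "d > 0" "\<And>t. dist t z < d \<Longrightarrow> t \<in> U2"
          using U12(2,4) unfolding open_dist by blast
        have ne: "no_eigenvalue X (V s t) (cis \<eta>)" if "s \<in> U1" "s \<in> A" "dist t z < d" "t \<in> {a..b}" for s t
          using U(3)[of "(s, t)"] U12(5) d(2)[of t] that by auto
        show ?thesis
        proof (intro exI[of _ d] conjI d(1) allI impI)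
          fix u v assume uv: "u \<le> z \<and> z \<le> v \<and> v - u < d"
          show "Q u v"
            unfolding Q_def
          proof (intro impI allI)
            fix e e' assume in_ab: "a \<le> u \<and> v \<le> b" and e: "adm u e" "adm v e'"
            have t: "dist t z < d" "t \<in> {a..b}" if "t \<in> {u..v}" for t
              using that uv in_ab by (auto simp: dist_real_def)
            have uvab: "u \<in> {a..b}" "v \<in> {a..b}" using uv in_ab by auto
            have adm_uv: "adm u \<eta>" "adm v \<eta>"
              using ne[OF U12(3) s0 t] uv \<eta> by (auto simp: adm_def)
            have "\<forall>\<^sub>F s in at s0 within A. s \<in> U1 \<and> s \<in> A"
              unfolding eventually_at_topological using U12(1,3) by (intro exI[of _ U1]) auto
            then show "\<forall>\<^sub>F s in at s0 within A. \<exists>k k0. has_spectral_flow_l X (V s) u v k \<and> has_spectral_flow_l X (V s0) u v k0 \<and> k - k0 = \<Delta> s v e' - \<Delta> s u e"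
              using indep[OF uvab(1) e(1) adm_uv(1)] indep[OF uvab(2) e(2) adm_uv(2)]
            proof eventually_elim
              case (elim s)
              have "has_spectral_flow_l X (V s) u v (int (arc_count X (V s v) \<eta>) - int (arc_count X (V s u) \<eta>))"
                by (rule has_spectral_flow_l_single) (use uv \<eta> ne t elim in \<open>auto simp: adm_def\<close>)
              moreover have "has_spectral_flow_l X (V s0) u v (int (arc_count X (V s0 v) \<eta>) - int (arc_count X (V s0 u) \<eta>))"
                by (rule has_spectral_flow_l_single) (use uv \<eta> ne t s0 U12(3) in \<open>auto simp: adm_def\<close>)
              ultimately show ?case
                using elim unfolding \<Delta>_def by (intro exI conjI) (assumption, assumption, simp)
            qed
          qed
        qed
      qed
    qed
    then show "?P a b" unfolding Q_def by simp
  qed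
  then show ?thesis
    using \<epsilon> \<epsilon>' unfolding adm_def \<Delta>_def by blast
qed

lemma spectral_flow_l_eqI:
  assumes X: "vec.subspace X" and V: "\<And>t. t \<in> {a..b} \<Longrightarrow> unitary_iso X X (V t)"
    and cont: "op_continuous_on {a..b} X V" and ab: "a \<le> b"
    and k: "has_spectral_flow_l X V a b k"
  shows "spectral_flow_l X V a b = k"
  unfolding spectral_flow_l_def
  by (rule the_equality[where P = "has_spectral_flow_l X V a b", OF k]) (rule has_spectral_flow_l_unique[OF X V cont ab _ k])

text \<open>The functions \<open>f\<close> and \<open>g\<close> record the eigenvalues that enter the upper arc at \<open>1\<close> along the edges
  \<open>t = a\<close> and \<open>t = b\<close>. The flow of the rows, corrected by these contributions, is locally constant in \<open>s\<close>.\<close>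

lemma spectral_flow_homotopy:
  fixes V :: "real \<Rightarrow> real \<Rightarrow> complex ^ 'm::finite \<Rightarrow> complex ^ 'm" and f g :: "real \<Rightarrow> int"
  assumes X: "vec.subspace X" and V: "\<And>s t. s \<in> {c..d} \<Longrightarrow> t \<in> {a..b} \<Longrightarrow> unitary_iso X X (V s t)"
    and cont: "op_continuous_on ({c..d} \<times> {a..b}) X (\<lambda>p. V (fst p) (snd p))" and ab: "a \<le> b" and cd: "c \<le> d"
    and left: "\<And>s0 \<epsilon>. s0 \<in> {c..d} \<Longrightarrow> 0 < \<epsilon> \<Longrightarrow> \<epsilon> < pi \<Longrightarrow> no_eigenvalue X (V s0 a) (cis \<epsilon>) \<Longrightarrow>
       \<forall>\<^sub>F s in at s0 within {c..d}. int (arc_count X (V s a) \<epsilon>) - int (arc_count X (V s0 a) \<epsilon>) = f s - f s0"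
    and right: "\<And>s0 \<epsilon>. s0 \<in> {c..d} \<Longrightarrow> 0 < \<epsilon> \<Longrightarrow> \<epsilon> < pi \<Longrightarrow> no_eigenvalue X (V s0 b) (cis \<epsilon>) \<Longrightarrow>
       \<forall>\<^sub>F s in at s0 within {c..d}. int (arc_count X (V s b) \<epsilon>) - int (arc_count X (V s0 b) \<epsilon>) = g s - g s0"
  shows "spectral_flow_l X (V d) a b - spectral_flow_l X (V c) a b = (g d - g c) - (f d - f c)"
proof -
  define h where "h s = spectral_flow_l X (V s) a b - g s + f s" for s
  have cont_t: "op_continuous_on {a..b} X (V s)" if "s \<in> {c..d}" for s
  proof -
    have "continuous_on {a..b} (\<lambda>t. (s, t))"
      by (intro continuous_intros)
    moreover have "(\<lambda>t. (s, t)) ` {a..b} \<subseteq> {c..d} \<times> {a..b}"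
      using that by auto
    ultimately show ?thesis
      using op_continuous_on_compose[OF cont] by fastforce
  qed
  have "h c = h d"
  proof (rule connected_local_const[of "{c..d}"])
    show "\<forall>s0\<in>{c..d}. \<forall>\<^sub>F s in at s0 within {c..d}. h s0 = h s"
    proof
      fix s0 assume s0: "s0 \<in> {c..d}"
      have ends: "a \<in> {a..b}" "b \<in> {a..b}" using ab by auto
      obtain \<epsilon> where \<epsilon>: "0 < \<epsilon>" "\<epsilon> < pi" "no_eigenvalue X (V s0 a) (cis \<epsilon>)"
        using ex_no_eigenvalue[OF V[OF s0 ends(1)] X] by blast
      obtain \<epsilon>' where \<epsilon>': "0 < \<epsilon>'" "\<epsilon>' < pi" "no_eigenvalue X (V s0 b) (cis \<epsilon>')"
        using ex_no_eigenvalue[OF V[OF s0 ends(2)] X] by blast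
      have "\<forall>\<^sub>F s in at s0 within {c..d}. s \<in> {c..d}"
        by (simp add: eventually_at_filter)
      moreover have "\<forall>\<^sub>F s in at s0 within {c..d}. \<exists>k k0.
          has_spectral_flow_l X (V s) a b k \<and> has_spectral_flow_l X (V s0) a b k0 \<and>
          k - k0 = (int (arc_count X (V s b) \<epsilon>') - int (arc_count X (V s0 b) \<epsilon>'))
            - (int (arc_count X (V s a) \<epsilon>) - int (arc_count X (V s0 a) \<epsilon>))"
        by (rule spectral_flow_locally[OF X _ cont ab s0 \<epsilon> \<epsilon>']) (rule V)
      ultimately show "\<forall>\<^sub>F s in at s0 within {c..d}. h s0 = h s"
        using left[OF s0 \<epsilon>] right[OF s0 \<epsilon>']
      proof eventually_elim
        case (elim s)
        then obtain k k0 where k: "has_spectral_flow_l X (V s) a b k" "has_spectral_flow_l X (V s0) a b k0"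
          "k - k0 = (g s - g s0) - (f s - f s0)"
          by auto
        have "spectral_flow_l X (V s) a b = k" "spectral_flow_l X (V s0) a b = k0"
          using k elim(1) s0 V by (auto intro!: spectral_flow_l_eqI[OF X _ cont_t ab])
        then show ?case
          using k(3) by (simp add: h_def)
      qed
    qed
  qed (use cd in auto)
  then show ?thesis by (simp add: h_def)
qed

section \<open>Lagrange subspaces and their unitary generators\<close>

lemma unitary_iso_inv_into:
  assumes U: "unitary_iso X Y U" and X: "vec.subspace X"
  shows "unitary_iso Y X (inv_into X U)"
proof -
  have surj: "\<exists>x\<in>X. U x = y" if "y \<in> Y" for y
    using unitary_isoD(8)[OF U] that by (metis imageE)
  have inv: "inv_into X U (U x) = x" if "x \<in> X" for x
    using inv_into_f_f[OF unitary_isoD(7)[OF U] that] .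
  show ?thesis
    unfolding unitary_iso_def
  proof (intro conjI ballI allI)
    show "bij_betw (inv_into X U) Y X"
      using U by (auto simp: unitary_iso_def intro: bij_betw_inv_into)
    fix y assume "y \<in> Y"
    then obtain x where x: "x \<in> X" "U x = y" using surj by blast
    show "inv_into X U (c *s y) = c *s inv_into X U y" for c
      using inv[OF vec.subspace_scale[OF X x(1)], of c] inv[OF x(1)] unitary_isoD(3)[OF U x(1)] x(2) by simp
    fix y' assume "y' \<in> Y"
    then obtain x' where x': "x' \<in> X" "U x' = y'" using surj by blast
    show "inv_into X U (y + y') = inv_into X U y + inv_into X U y'"
      using inv[OF vec.subspace_add[OF X x(1) x'(1)]] inv[OF x(1)] inv[OF x'(1)]
        unitary_isoD(2)[OF U x(1) x'(1)] x(2) x'(2) by simp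
    show "cinner (inv_into X U y) (inv_into X U y') = cinner y y'"
      using inv[OF x(1)] inv[OF x'(1)] unitary_isoD(4)[OF U x(1) x'(1)] x(2) x'(2) by simp
  qed
qed

lemma unitary_iso_comp:
  assumes "unitary_iso X Y U" "unitary_iso Y Z U'"
  shows "unitary_iso X Z (U' \<circ> U)"
  unfolding unitary_iso_def
  using assms unitary_isoD[OF assms(1)] unitary_isoD[OF assms(2)]
  by (auto intro: bij_betw_trans simp: unitary_iso_def)

lemma mat_matrix_vector_mult: "mat c *v x = c *s (x :: complex ^ 'm::finite)"
proof -
  have "(\<Sum>j\<in>UNIV. (if i = j then c else 0) * x $ j) = c * x $ i" for i
    by (simp add: if_distrib[of "\<lambda>u. u * _"] cong: if_cong)
  then show ?thesis
    by (simp add: vec_eq_iff matrix_vector_mult_def mat_def)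
qed

lemma dim_matrix_image:
  fixes M :: "complex ^ 'm::finite ^ 'k::finite"
  assumes "vec.subspace S" "inj_on ((*v) M) S"
  shows "vec.dim ((*v) M ` S) = vec.dim S"
  using assms by (intro vec.dim_image_eq matrix_vector_mul_linear_gen) (simp_all add: vec.span_eq_iff[THEN iffD2])

lemma subspace_matrix_image:
  fixes M :: "complex ^ 'm::finite ^ 'k::finite"
  assumes "vec.subspace S"
  shows "vec.subspace ((*v) M ` S)"
  by (rule vec.linear_subspace_image[OF matrix_vector_mul_linear_gen assms])

lemma inj_matrix_mult:
  assumes "invertible (M :: complex ^ 'm::finite ^ 'm)"
  shows "inj ((*v) M)"
  by (rule inj_on_inverseI[of _ "(*v) (matrix_inv M)"])
     (simp add: matrix_vector_mul_assoc invertible_matrix_inv[OF assms])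

locale symplectic_structure =
  fixes J :: "complex ^ 'm::finite ^ 'm"
  assumes adj_J: "adjoint_mat J = - J" and J_J: "J ** J = - mat 1"
begin

definition proj1 :: "complex ^ 'm ^ 'm" where "proj1 = mat (1 / 2) - mat (\<i> / 2) ** J"
definition proj2 :: "complex ^ 'm ^ 'm" where "proj2 = mat (1 / 2) + mat (\<i> / 2) ** J"

definition lagrangian :: "(complex ^ 'm) set \<Rightarrow> bool" where
  "lagrangian \<Lambda> \<longleftrightarrow> vec.subspace \<Lambda> \<and> (\<forall>w. w \<in> \<Lambda> \<longleftrightarrow> (\<forall>z\<in>\<Lambda>. cinner (J *v z) w = 0))"

lemma lagrangian_subspace: "lagrangian \<Lambda> \<Longrightarrow> vec.subspace \<Lambda>"
  unfolding lagrangian_def by (rule conjunct1)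

lemma JJ_vec: "J *v (J *v z) = - z"
  by (simp add: matrix_vector_mul_assoc J_J uminus_matrix_vector_mult)

lemma proj1_eq: "proj1 *v z = (1 / 2) *s (z - \<i> *s (J *v z))"
  and proj2_eq: "proj2 *v z = (1 / 2) *s (z + \<i> *s (J *v z))"
  unfolding proj1_def proj2_def
  by (simp_all add: matrix_vector_mult_diff_rdistrib matrix_vector_mult_add_rdistrib mat_matrix_vector_mult
      vec_eq_iff algebra_simps flip: matrix_vector_mul_assoc)

lemma X1_iff: "x \<in> X1 J \<longleftrightarrow> J *v x = \<i> *s x"
  and X2_iff: "x \<in> X2 J \<longleftrightarrow> J *v x = - (\<i> *s x)"
  unfolding X1_def X2_def
  by (simp_all add: matrix_vector_mult_diff_rdistrib matrix_vector_mult_add_rdistrib mat_matrix_vector_mult add_eq_0_iff2)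

lemma subspace_X1: "vec.subspace (X1 J)"
  unfolding vec.subspace_def
  by (auto simp: X1_iff vec.add vec.scale vec.scale_right_distrib mult.commute)

lemma proj1_in: "proj1 *v z \<in> X1 J" and proj2_in: "proj2 *v z \<in> X2 J"
  unfolding X1_iff X2_iff proj1_eq proj2_eq
  by (simp_all add: vec.scale vec.diff vec.add JJ_vec vec_eq_iff algebra_simps)

lemma proj_add: "proj1 *v z + proj2 *v z = z"
  unfolding proj1_eq proj2_eq by (simp add: vec_eq_iff algebra_simps)

lemma proj1_X1: "x \<in> X1 J \<Longrightarrow> proj1 *v x = x" and proj2_X1: "x \<in> X1 J \<Longrightarrow> proj2 *v x = 0"
  and proj1_X2: "y \<in> X2 J \<Longrightarrow> proj1 *v y = 0" and proj2_X2: "y \<in> X2 J \<Longrightarrow> proj2 *v y = y"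
  unfolding X1_iff X2_iff proj1_eq proj2_eq
  by (simp_all add: vec_eq_iff algebra_simps)

lemma cinner_J_left: "cinner (J *v z) w = - cinner z (J *v w)"
  by (simp add: cinner_adjoint adj_J uminus_matrix_vector_mult cinner_minus_right)

lemma cinner_J_proj:
  "cinner (J *v z) w = \<i> * (cinner (proj1 *v z) (proj1 *v w) - cinner (proj2 *v z) (proj2 *v w))"
proof -
  have "cinner (J *v z) (J *v w) = cinner z w"
    by (simp add: cinner_J_left JJ_vec cinner_minus_right)
  then show ?thesis
    unfolding proj1_eq proj2_eq by (simp add: cinner_simps cinner_J_left algebra_simps)
qed

lemma norm_J: "norm (J *v z) = norm z"
proof -
  have "cinner (J *v z) (J *v z) = cinner z z"
    by (simp add: cinner_J_left JJ_vec cinner_minus_right)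
  then show ?thesis
    by (simp only: cinner_self of_real_eq_iff) simp
qed

lemma norm_proj1_le: "norm (proj1 *v z) \<le> norm z" and norm_proj2_le: "norm (proj2 *v z) \<le> norm z"
proof -
  have "norm (\<i> *s (J *v z)) = norm z"
    by (simp add: norm_scale norm_J)
  moreover have half: "norm ((1 / 2) *s y) = norm y / 2" for y :: "complex ^ 'm"
    by (simp only: norm_scale norm_divide norm_one norm_numeral)
  ultimately show "norm (proj1 *v z) \<le> norm z"
    unfolding proj1_eq half using norm_triangle_ineq4[of z "\<i> *s (J *v z)"] by linarith
  show "norm (proj2 *v z) \<le> norm z"
    unfolding proj2_eq half
    using norm_triangle_ineq[of z "\<i> *s (J *v z)"] \<open>norm (\<i> *s (J *v z)) = norm z\<close> by linarith
qed

lemma lagrangian_cinner_proj: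
  assumes "lagrangian \<Lambda>" "z \<in> \<Lambda>" "w \<in> \<Lambda>"
  shows "cinner (proj1 *v z) (proj1 *v w) = cinner (proj2 *v z) (proj2 *v w)"
proof -
  have "cinner (J *v z) w = 0"
    using assms unfolding lagrangian_def by blast
  then show ?thesis
    by (simp add: cinner_J_proj)
qed

lemma lagrangian_inj_on: "lagrangian \<Lambda> \<Longrightarrow> inj_on ((*v) proj1) \<Lambda>"
proof (rule inj_onI)
  fix z w assume \<Lambda>: "lagrangian \<Lambda>" and zw: "z \<in> \<Lambda>" "w \<in> \<Lambda>" "proj1 *v z = proj1 *v w"
  have d: "z - w \<in> \<Lambda>" using vec.subspace_diff[OF lagrangian_subspace[OF \<Lambda>]] zw by blast
  have p1: "proj1 *v (z - w) = 0" using zw by (simp add: vec.diff)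
  have "cinner (proj2 *v (z - w)) (proj2 *v (z - w)) = 0"
    using lagrangian_cinner_proj[OF \<Lambda> d d] p1 by simp
  then have "proj2 *v (z - w) = 0" by simp
  then show "z = w" using proj_add[of "z - w"] p1 by simp
qed

text \<open>A vector of \<open>X1\<close> orthogonal to the projection of \<open>\<Lambda>\<close> is \<open>\<omega>\<close>-orthogonal to \<open>\<Lambda>\<close>, hence lies in
  \<open>\<Lambda>\<close>; but \<open>\<Lambda>\<close> contains no nonzero vector of \<open>X1\<close>.\<close>

lemma lagrangian_proj1_image:
  assumes \<Lambda>: "lagrangian \<Lambda>"
  shows "(*v) proj1 ` \<Lambda> = X1 J"
proof
  show "(*v) proj1 ` \<Lambda> \<subseteq> X1 J" using proj1_in by auto
  show "X1 J \<subseteq> (*v) proj1 ` \<Lambda>"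
  proof
    fix x assume x: "x \<in> X1 J"
    have sub: "vec.subspace ((*v) proj1 ` \<Lambda>)"
      by (intro subspace_matrix_image lagrangian_subspace \<Lambda>)
    obtain s where s: "s \<in> (*v) proj1 ` \<Lambda>" "\<And>v. v \<in> (*v) proj1 ` \<Lambda> \<Longrightarrow> cinner (x - s) v = 0"
      using orthogonal_projection_exists[OF sub] by blast
    have d: "x - s \<in> X1 J"
      using x s(1) proj1_in subspace_X1 by (auto intro: vec.subspace_diff)
    have "cinner (J *v z) (x - s) = 0" if "z \<in> \<Lambda>" for z
    proof -
      have "cinner (proj1 *v z) (x - s) = 0"
        using s(2)[of "proj1 *v z"] that cinner_commute[of "proj1 *v z" "x - s"] by auto
      then show ?thesis
        unfolding cinner_J_proj using proj1_X1[OF d] proj2_X1[OF d] by simp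
    qed
    then have "x - s \<in> \<Lambda>"
      using \<Lambda> unfolding lagrangian_def by blast
    from lagrangian_cinner_proj[OF \<Lambda> this this] have "x - s = 0"
      unfolding proj1_X1[OF d] proj2_X1[OF d] by simp
    then show "x \<in> (*v) proj1 ` \<Lambda>" using s(1) by simp
  qed
qed

end

lemma symplectic_structure_uminus:
  assumes "symplectic_structure J"
  shows "symplectic_structure (- J)"
  using assms unfolding symplectic_structure_def by (simp add: adjoint_mat_minus matrix_mult_simps)

context symplectic_structure
begin

lemma lagrangian_proj2_image:
  assumes \<Lambda>: "lagrangian \<Lambda>"
  shows "(*v) proj2 ` \<Lambda> = X2 J"
proof -
  interpret neg: symplectic_structure "- J"
    by (rule symplectic_structure_uminus) (rule symplectic_structure_axioms)
  have "neg.lagrangian \<Lambda> = lagrangian \<Lambda>"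
    unfolding lagrangian_def neg.lagrangian_def
    by (simp only: uminus_matrix_vector_mult cinner_minus_left neg_equal_0_iff_equal)
  then have "neg.lagrangian \<Lambda>"
    using \<Lambda> by (rule iffD2)
  moreover have "neg.proj1 = proj2"
    by (simp add: neg.proj1_def proj2_def matrix_mult_simps)
  moreover have "X1 (- J) = X2 J"
  proof (rule set_eqI)
    show "x \<in> X1 (- J) \<longleftrightarrow> x \<in> X2 J" for x
      unfolding neg.X1_iff X2_iff uminus_matrix_vector_mult minus_equation_iff[of "J *v x" "\<i> *s x"]
      by (rule eq_commute)
  qed
  ultimately show ?thesis
    using neg.lagrangian_proj1_image[of \<Lambda>] by simp
qed

text \<open>Both projections are bijective on \<open>\<Lambda>\<close>, and isotropy of \<open>\<Lambda>\<close> says that they pull the inner product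
  back to the same form. So \<open>\<Lambda>\<close> is the graph of the second projection composed with the inverse of the first.\<close>

lemma lagrangian_unitary_exists:
  assumes \<Lambda>: "lagrangian \<Lambda>"
  shows "\<exists>U. unitary_iso (X1 J) (X2 J) U \<and> \<Lambda> = {x + U x |x. x \<in> X1 J}"
proof -
  have sub: "vec.subspace \<Lambda>" by (rule lagrangian_subspace[OF \<Lambda>])
  define L where "L = inv_into \<Lambda> ((*v) proj1)"
  have L: "L x \<in> \<Lambda>" "proj1 *v L x = x" if "x \<in> X1 J" for x
    using that inv_into_into[of x "(*v) proj1" \<Lambda>] f_inv_into_f[of x "(*v) proj1" \<Lambda>]
    unfolding lagrangian_proj1_image[OF \<Lambda>] L_def by auto
  have L_proj: "L (proj1 *v z) = z" if "z \<in> \<Lambda>" for z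
    unfolding L_def by (rule inv_into_f_f[OF lagrangian_inj_on[OF \<Lambda>] that])
  define U where "U x = proj2 *v L x" for x
  have UL: "U (proj1 *v z) = proj2 *v z" if "z \<in> \<Lambda>" for z
    using L_proj[OF that] by (simp add: U_def)
  have iso: "cinner (U x) (U y) = cinner x y" if "x \<in> X1 J" "y \<in> X1 J" for x y
    using lagrangian_cinner_proj[OF \<Lambda> L(1)[OF that(1)] L(1)[OF that(2)]] L(2) that by (simp add: U_def)
  have add: "U (x + y) = U x + U y" if "x \<in> X1 J" "y \<in> X1 J" for x y
    using UL[of "L x + L y"] L that vec.subspace_add[OF sub] by (simp add: vec.add U_def)
  have scale: "U (c *s x) = c *s U x" if "x \<in> X1 J" for c x
    using UL[of "c *s L x"] L that vec.subspace_scale[OF sub] by (simp add: vec.scale U_def)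
  have "U ` X1 J = X2 J"
  proof -
    have "U ` X1 J = (\<lambda>z. U (proj1 *v z)) ` \<Lambda>"
      unfolding lagrangian_proj1_image[OF \<Lambda>, symmetric] image_image ..
    also have "\<dots> = (*v) proj2 ` \<Lambda>"
      using UL by (intro image_cong) auto
    finally show ?thesis
      using lagrangian_proj2_image[OF \<Lambda>] by simp
  qed
  moreover have "inj_on U (X1 J)"
  proof (rule inj_onI)
    fix x y assume xy: "x \<in> X1 J" "y \<in> X1 J" "U x = U y"
    then have d: "x - y \<in> X1 J" using subspace_X1 by (auto intro: vec.subspace_diff)
    have "U ((x - y) + y) = U (x - y) + U y" by (rule add[OF d xy(2)])
    then have "U (x - y) = 0" using xy(3) by simp
    then have "cinner (x - y) (x - y) = 0" using iso[OF d d] by simp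
    then show "x = y" by simp
  qed
  ultimately have "unitary_iso (X1 J) (X2 J) U"
    unfolding unitary_iso_def bij_betw_def using iso add scale by blast
  moreover have "\<Lambda> = {x + U x |x. x \<in> X1 J}"
  proof (intro set_eqI iffI)
    fix z assume "z \<in> \<Lambda>"
    then have "z = proj1 *v z + U (proj1 *v z)"
      using UL proj_add by simp
    then show "z \<in> {x + U x |x. x \<in> X1 J}" using proj1_in by blast
  next
    fix z assume "z \<in> {x + U x |x. x \<in> X1 J}"
    then obtain x where x: "x \<in> X1 J" "z = x + U x" by blast
    then have "z = L x"
      using L(2)[of x] proj_add[of "L x"] by (simp add: U_def)
    then show "z \<in> \<Lambda>" using L(1)[OF x(1)] by simp
  qed
  ultimately show ?thesis by blast
qed

lemma lagrange_unitary:
  assumes "lagrangian \<Lambda>"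
  shows unitary_iso_lagrange_unitary: "unitary_iso (X1 J) (X2 J) (lagrange_unitary J \<Lambda>)"
    and lagrange_unitary_graph: "\<Lambda> = {x + lagrange_unitary J \<Lambda> x |x. x \<in> X1 J}"
  using someI_ex[OF lagrangian_unitary_exists[OF assms]] unfolding lagrange_unitary_def by blast+

lemma lagrange_unitary_proj:
  assumes "lagrangian \<Lambda>" "z \<in> \<Lambda>"
  shows "lagrange_unitary J \<Lambda> (proj1 *v z) = proj2 *v z"
proof -
  obtain x where x: "x \<in> X1 J" "z = x + lagrange_unitary J \<Lambda> x"
    using assms lagrange_unitary_graph[OF assms(1)] by blast
  moreover have "lagrange_unitary J \<Lambda> x \<in> X2 J"
    using unitary_isoD(1)[OF unitary_iso_lagrange_unitary[OF assms(1)]] x(1) by blast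
  ultimately show ?thesis
    by (simp add: vec.add proj1_X1 proj2_X1 proj1_X2 proj2_X2)
qed

lemma lagrange_unitary_in:
  assumes "lagrangian \<Lambda>" "x \<in> X1 J"
  shows "x + lagrange_unitary J \<Lambda> x \<in> \<Lambda>"
  by (subst (2) lagrange_unitary_graph[OF assms(1)]) (use assms(2) in blast)

text \<open>Compare \<open>x = proj1 z\<close> with \<open>proj1 z'\<close> for a vector \<open>z'\<close> of \<open>\<Lambda>'\<close> close to \<open>z\<close>: the generator of \<open>\<Lambda>'\<close>
  is an isometry and sends \<open>proj1 z'\<close> to \<open>proj2 z'\<close>.\<close>

lemma lagrange_unitary_close:
  assumes \<Lambda>: "lagrangian \<Lambda>" and \<Lambda>': "lagrangian \<Lambda>'"
    and close: "\<And>z. z \<in> \<Lambda> \<Longrightarrow> \<exists>z'\<in>\<Lambda>'. norm (z' - z) \<le> \<delta> * norm z" and \<delta>: "0 \<le> \<delta>"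
    and x: "x \<in> X1 J"
  shows "norm (lagrange_unitary J \<Lambda>' x - lagrange_unitary J \<Lambda> x) \<le> 4 * \<delta> * norm x"
proof -
  let ?U = "lagrange_unitary J \<Lambda>" and ?U' = "lagrange_unitary J \<Lambda>'"
  note U = unitary_iso_lagrange_unitary[OF \<Lambda>] and U' = unitary_iso_lagrange_unitary[OF \<Lambda>']
  define z where "z = x + ?U x"
  have z: "z \<in> \<Lambda>" unfolding z_def by (rule lagrange_unitary_in[OF \<Lambda> x])
  have Ux: "?U x \<in> X2 J" by (rule unitary_isoD(1)[OF U x])
  have p: "proj1 *v z = x" "proj2 *v z = ?U x"
    using x Ux by (simp_all add: z_def vec.add proj1_X1 proj2_X1 proj1_X2 proj2_X2)
  obtain z' where z': "z' \<in> \<Lambda>'" "norm (z' - z) \<le> \<delta> * norm z" using close[OF z] by blast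
  have "?U' x - ?U x = ?U' (x - proj1 *v z') + (proj2 *v z' - proj2 *v z)"
    using unitary_iso_diff[OF U' subspace_X1 x proj1_in] lagrange_unitary_proj[OF \<Lambda>' z'(1)] p by simp
  also have "norm \<dots> \<le> norm (?U' (x - proj1 *v z')) + norm (proj2 *v (z' - z))"
    using norm_triangle_ineq by (simp add: vec.diff)
  also have "norm (?U' (x - proj1 *v z')) = norm (proj1 *v (z - z'))"
    using unitary_isoD(5)[OF U' vec.subspace_diff[OF subspace_X1 x proj1_in]] p by (simp add: vec.diff)
  also have "norm (proj1 *v (z - z')) + norm (proj2 *v (z' - z)) \<le> 2 * norm (z' - z)"
    using norm_proj1_le[of "z - z'"] norm_proj2_le[of "z' - z"] by (simp add: norm_minus_commute)
  also have "\<dots> \<le> 2 * (\<delta> * norm z)" using z'(2) by simp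
  also have "\<dots> \<le> 2 * (\<delta> * (2 * norm x))"
  proof -
    have "norm z \<le> 2 * norm x"
      using norm_triangle_ineq[of x "?U x"] unitary_isoD(5)[OF U x] by (simp add: z_def)
    then show ?thesis using \<delta> by (intro mult_left_mono) auto
  qed
  finally show ?thesis by simp
qed

definition relative_unitary :: "(complex ^ 'm) set \<Rightarrow> (complex ^ 'm) set \<Rightarrow> complex ^ 'm \<Rightarrow> complex ^ 'm" where
  "relative_unitary \<Lambda> W = inv_into (X1 J) (lagrange_unitary J W) \<circ> lagrange_unitary J \<Lambda>"

lemma maslov_index_eq:
  "maslov_index J \<Lambda> W a b = - spectral_flow_l (X1 J) (\<lambda>s. relative_unitary (\<Lambda> s) (W s)) a b"
  unfolding maslov_index_def relative_unitary_def ..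

context
  fixes \<Lambda> W :: "(complex ^ 'm) set"
  assumes \<Lambda>: "lagrangian \<Lambda>" and W: "lagrangian W"
begin

lemma unitary_iso_relative_unitary: "unitary_iso (X1 J) (X1 J) (relative_unitary \<Lambda> W)"
  unfolding relative_unitary_def
  by (rule unitary_iso_comp[OF unitary_iso_lagrange_unitary[OF \<Lambda>]
        unitary_iso_inv_into[OF unitary_iso_lagrange_unitary[OF W] subspace_X1]])

lemma lagrange_unitary_relative_unitary:
  assumes "x \<in> X1 J"
  shows "lagrange_unitary J W (relative_unitary \<Lambda> W x) = lagrange_unitary J \<Lambda> x"
proof -
  have "lagrange_unitary J \<Lambda> x \<in> lagrange_unitary J W ` X1 J"
    using unitary_isoD(1)[OF unitary_iso_lagrange_unitary[OF \<Lambda>] assms]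
      unitary_isoD(8)[OF unitary_iso_lagrange_unitary[OF W]] by simp
  then show ?thesis
    by (simp add: relative_unitary_def f_inv_into_f)
qed

lemma relative_unitary_eigen_iff:
  assumes x: "x \<in> X1 J"
  shows "relative_unitary \<Lambda> W x = \<mu> *s x \<longleftrightarrow> lagrange_unitary J \<Lambda> x = \<mu> *s lagrange_unitary J W x"
proof -
  note UW = unitary_iso_lagrange_unitary[OF W]
  have "relative_unitary \<Lambda> W x \<in> X1 J" "\<mu> *s x \<in> X1 J"
    using unitary_isoD(1)[OF unitary_iso_relative_unitary x] vec.subspace_scale[OF subspace_X1 x] by auto
  then have "relative_unitary \<Lambda> W x = \<mu> *s x \<longleftrightarrow>
      lagrange_unitary J W (relative_unitary \<Lambda> W x) = lagrange_unitary J W (\<mu> *s x)"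
    using inj_on_eq_iff[OF unitary_isoD(7)[OF UW]] by simp
  then show ?thesis
    by (simp add: lagrange_unitary_relative_unitary[OF x] unitary_isoD(3)[OF UW x])
qed

text \<open>The eigenvectors for \<open>\<mu>\<close> are the \<open>X1\<close>-components of the intersection of \<open>\<Lambda>\<close> with a rotated
  copy of \<open>W\<close>. This makes eigenspace dimensions accessible to linear symmetries of the pair.\<close>

lemma dim_eigenspace_relative_unitary:
  assumes "norm \<mu> = 1"
  shows "vec.dim {x \<in> X1 J. relative_unitary \<Lambda> W x = \<mu> *s x} = vec.dim (\<Lambda> \<inter> (*v) (proj1 + mat \<mu> ** proj2) ` W)"
proof -
  let ?R = "proj1 + mat \<mu> ** proj2"
  have R: "?R *v w = proj1 *v w + \<mu> *s (proj2 *v w)" for w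
    by (simp add: matrix_vector_mult_add_rdistrib mat_matrix_vector_mult flip: matrix_vector_mul_assoc)
  have sub: "vec.subspace (\<Lambda> \<inter> (*v) ?R ` W)"
    by (intro vec.subspace_inter subspace_matrix_image lagrangian_subspace \<Lambda> W)
  have "(*v) proj1 ` (\<Lambda> \<inter> (*v) ?R ` W) = {x \<in> X1 J. relative_unitary \<Lambda> W x = \<mu> *s x}"
  proof (intro set_eqI iffI)
    fix x assume "x \<in> (*v) proj1 ` (\<Lambda> \<inter> (*v) ?R ` W)"
    then obtain z w where zw: "x = proj1 *v z" "z \<in> \<Lambda>" "z = ?R *v w" "w \<in> W" by blast
    have "proj1 *v z = proj1 *v w" "proj2 *v z = \<mu> *s (proj2 *v w)"
      unfolding zw(3) R by (simp_all add: vec.add vec.scale proj1_X1 proj2_X1 proj1_X2 proj2_X2 proj1_in proj2_in)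
    then have "lagrange_unitary J \<Lambda> x = \<mu> *s lagrange_unitary J W x"
      using lagrange_unitary_proj[OF \<Lambda> zw(2)] lagrange_unitary_proj[OF W zw(4)] zw(1) by simp
    then show "x \<in> {x \<in> X1 J. relative_unitary \<Lambda> W x = \<mu> *s x}"
      using relative_unitary_eigen_iff[of x \<mu>] zw(1) proj1_in by simp
  next
    fix x assume x: "x \<in> {x \<in> X1 J. relative_unitary \<Lambda> W x = \<mu> *s x}"
    then have xX: "x \<in> X1 J" and U: "lagrange_unitary J \<Lambda> x = \<mu> *s lagrange_unitary J W x"
      using relative_unitary_eigen_iff by auto
    have w: "x + lagrange_unitary J W x \<in> W" and z: "x + lagrange_unitary J \<Lambda> x \<in> \<Lambda>"
      by (rule lagrange_unitary_in[OF W xX], rule lagrange_unitary_in[OF \<Lambda> xX])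
    have X2: "lagrange_unitary J W x \<in> X2 J" "lagrange_unitary J \<Lambda> x \<in> X2 J"
      using unitary_isoD(1)[OF unitary_iso_lagrange_unitary[OF W] xX]
        unitary_isoD(1)[OF unitary_iso_lagrange_unitary[OF \<Lambda>] xX] by auto
    have "x + lagrange_unitary J \<Lambda> x = ?R *v (x + lagrange_unitary J W x)"
      unfolding R using X2 xX by (simp add: vec.add proj1_X1 proj2_X1 proj1_X2 proj2_X2 U)
    then have "x + lagrange_unitary J \<Lambda> x \<in> \<Lambda> \<inter> (*v) ?R ` W"
      using w z by blast
    moreover have "x = proj1 *v (x + lagrange_unitary J \<Lambda> x)"
      using X2 xX by (simp add: vec.add proj1_X1 proj1_X2)
    ultimately show "x \<in> (*v) proj1 ` (\<Lambda> \<inter> (*v) ?R ` W)" by blast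
  qed
  moreover have "inj_on ((*v) proj1) (\<Lambda> \<inter> (*v) ?R ` W)"
    using lagrangian_inj_on[OF \<Lambda>] by (rule inj_on_subset) auto
  then have "vec.dim ((*v) proj1 ` (\<Lambda> \<inter> (*v) ?R ` W)) = vec.dim (\<Lambda> \<inter> (*v) ?R ` W)"
    by (rule dim_matrix_image[OF sub])
  ultimately show ?thesis
    by (simp only:)
qed

lemma dim_fixed_relative_unitary:
  "vec.dim {x \<in> X1 J. relative_unitary \<Lambda> W x = x} = vec.dim (\<Lambda> \<inter> W)"
proof -
  have "(proj1 + mat 1 ** proj2) *v w = w" for w
    by (simp add: matrix_vector_mult_add_rdistrib proj_add)
  then have "(*v) (proj1 + mat 1 ** proj2) ` W = W" by simp
  then show ?thesis
    using dim_eigenspace_relative_unitary[of 1] by simp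
qed

text \<open>An antisymplectic involution interchanges the eigenspaces \<open>X1\<close> and \<open>X2\<close> of the complex structure, and
  thereby the eigenvalues \<open>\<mu>\<close> and \<open>cnj \<mu>\<close>.\<close>

lemma dim_eigenspace_conjugation_symmetric:
  assumes S: "S ** S = mat 1" "S ** J = - (J ** S)"
    and inv: "\<And>z. z \<in> \<Lambda> \<Longrightarrow> S *v z \<in> \<Lambda>" "\<And>w. w \<in> W \<Longrightarrow> S *v w \<in> W"
    and \<mu>: "norm \<mu> = 1"
  shows "vec.dim {x \<in> X1 J. relative_unitary \<Lambda> W x = cnj \<mu> *s x} = vec.dim {x \<in> X1 J. relative_unitary \<Lambda> W x = \<mu> *s x}"
proof -
  let ?R = "\<lambda>\<mu>. proj1 + mat \<mu> ** proj2"
  have R: "?R \<mu> *v w = proj1 *v w + \<mu> *s (proj2 *v w)" for w \<mu>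
    by (simp add: matrix_vector_mult_add_rdistrib mat_matrix_vector_mult flip: matrix_vector_mul_assoc)
  have SJ: "S *v (J *v z) = - (J *v (S *v z))" for z
    by (simp add: matrix_vector_mul_assoc S(2) uminus_matrix_vector_mult)
  have S1: "S *v (proj1 *v z) = proj2 *v (S *v z)" and S2: "S *v (proj2 *v z) = proj1 *v (S *v z)" for z
    unfolding proj1_eq proj2_eq by (simp_all add: vec.scale vec.diff vec.add SJ)
  have inj: "inj_on ((*v) S) A" for A
    by (rule inj_on_inverseI[of _ "(*v) S"]) (simp add: matrix_vector_mul_assoc S(1))
  have le: "vec.dim (\<Lambda> \<inter> (*v) (?R \<nu>) ` W) \<le> vec.dim (\<Lambda> \<inter> (*v) (?R (cnj \<nu>)) ` W)" if \<nu>: "norm \<nu> = 1" for \<nu>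
  proof -
    have sub: "vec.subspace (\<Lambda> \<inter> (*v) (?R \<nu>) ` W)"
      by (intro vec.subspace_inter subspace_matrix_image lagrangian_subspace \<Lambda> W)
    have "(*v) S ` (\<Lambda> \<inter> (*v) (?R \<nu>) ` W) \<subseteq> \<Lambda> \<inter> (*v) (?R (cnj \<nu>)) ` W"
    proof
      fix y assume "y \<in> (*v) S ` (\<Lambda> \<inter> (*v) (?R \<nu>) ` W)"
      then obtain w where w: "w \<in> W" "?R \<nu> *v w \<in> \<Lambda>" "y = S *v (?R \<nu> *v w)" by blast
      have nn: "cnj \<nu> * \<nu> = 1"
        using \<nu> complex_norm_square[of \<nu>] by (simp add: mult.commute)
      have "y = proj2 *v (S *v w) + \<nu> *s (proj1 *v (S *v w))"
        by (simp add: w(3) R vec.add vec.scale S1 S2)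
      also have "\<dots> = ?R (cnj \<nu>) *v (\<nu> *s (S *v w))"
        unfolding R by (simp add: vec.scale nn add.commute)
      finally have "y = ?R (cnj \<nu>) *v (\<nu> *s (S *v w))" .
      moreover have "\<nu> *s (S *v w) \<in> W"
        by (rule vec.subspace_scale[OF lagrangian_subspace[OF W] inv(2)[OF w(1)]])
      ultimately have "y \<in> (*v) (?R (cnj \<nu>)) ` W"
        by (rule image_eqI)
      then show "y \<in> \<Lambda> \<inter> (*v) (?R (cnj \<nu>)) ` W"
        using inv(1)[OF w(2)] w(3) by simp
    qed
    then have "vec.dim ((*v) S ` (\<Lambda> \<inter> (*v) (?R \<nu>) ` W)) \<le> vec.dim (\<Lambda> \<inter> (*v) (?R (cnj \<nu>)) ` W)"
      by (rule vec.dim_subset)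
    then show ?thesis
      by (simp only: dim_matrix_image[OF sub inj])
  qed
  have "norm (cnj \<mu>) = 1" using \<mu> by simp
  then show ?thesis
    unfolding dim_eigenspace_relative_unitary[OF \<mu>] dim_eigenspace_relative_unitary[OF \<open>norm (cnj \<mu>) = 1\<close>]
    using le[OF \<mu>] le[of "cnj \<mu>"] by simp
qed

end

text \<open>Images \<open>A p ` L\<close> of a fixed set under a continuous family of invertible matrices \<open>A p\<close> have continuously
  varying generators.\<close>

lemma eventually_image_close:
  fixes A :: "'a::topological_space \<Rightarrow> complex ^ 'm ^ 'm"
  assumes A: "continuous_on S A" "\<And>p. p \<in> S \<Longrightarrow> invertible (A p)" and p: "p \<in> S" and \<delta>: "\<delta> > 0"
  shows "\<forall>\<^sub>F q in at p within S. \<forall>z\<in>(*v) (A p) ` L. \<exists>z'\<in>(*v) (A q) ` L. norm (z' - z) \<le> \<delta> * norm z"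
proof -
  obtain K where K: "K > 0" "\<And>(M :: complex ^ 'm ^ 'm) y. norm (M *v y) \<le> norm M * norm y * K"
    using bounded_bilinear.pos_bounded[OF bounded_bilinear_matrix_vector_mult] by blast
  let ?E = "\<lambda>q. A q ** matrix_inv (A p)"
  have "continuous_on S ?E"
    by (intro continuous_intros A(1))
  then have "(?E \<longlongrightarrow> ?E p) (at p within S)"
    using p by (auto simp: continuous_on_def)
  then have "(?E \<longlongrightarrow> mat 1) (at p within S)"
    by (simp add: invertible_matrix_inv A(2) p)
  then have "\<forall>\<^sub>F q in at p within S. dist (?E q) (mat 1) < \<delta> / K"
    by (rule tendstoD) (use \<delta> K(1) in simp)
  then show ?thesis
  proof eventually_elim
    case (elim q)
    show ?case
    proof
      fix z assume "z \<in> (*v) (A p) ` L"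
      then obtain w where w: "w \<in> L" "z = A p *v w" by blast
      have "matrix_inv (A p) *v z = w"
        by (simp add: w(2) matrix_vector_mul_assoc invertible_matrix_inv A(2) p)
      then have "?E q *v z = A q *v w"
        by (simp flip: matrix_vector_mul_assoc)
      then have "A q *v w - z = (?E q - mat 1) *v z"
        by (simp add: matrix_vector_mult_diff_rdistrib)
      then have "norm (A q *v w - z) \<le> norm (?E q - mat 1) * norm z * K"
        using K(2) by simp
      also have "\<dots> = (norm (?E q - mat 1) * K) * norm z" by simp
      also have "\<dots> \<le> \<delta> * norm z"
        using elim K(1) by (intro mult_right_mono) (auto simp: dist_norm field_simps)
      finally show "\<exists>z'\<in>(*v) (A q) ` L. norm (z' - z) \<le> \<delta> * norm z"
        using w(1) by blast
    qed
  qed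
qed

lemma op_continuous_on_relative_unitary:
  fixes A C :: "'a::topological_space \<Rightarrow> complex ^ 'm ^ 'm"
  assumes A: "continuous_on S A" "\<And>p. p \<in> S \<Longrightarrow> invertible (A p)" "\<And>p. p \<in> S \<Longrightarrow> lagrangian ((*v) (A p) ` L)"
    and C: "continuous_on S C" "\<And>p. p \<in> S \<Longrightarrow> invertible (C p)" "\<And>p. p \<in> S \<Longrightarrow> lagrangian ((*v) (C p) ` M)"
  shows "op_continuous_on S (X1 J) (\<lambda>p. relative_unitary ((*v) (A p) ` L) ((*v) (C p) ` M))"
  unfolding op_continuous_on_def
proof (intro ballI allI impI)
  fix p and \<delta> :: real assume p: "p \<in> S" and \<delta>: "\<delta> > 0"
  let ?\<Lambda> = "\<lambda>p. (*v) (A p) ` L" and ?W = "\<lambda>p. (*v) (C p) ` M"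
  have "\<forall>\<^sub>F q in at p within S. \<forall>z\<in>?\<Lambda> p. \<exists>z'\<in>?\<Lambda> q. norm (z' - z) \<le> \<delta> / 8 * norm z"
    by (rule eventually_image_close[OF A(1,2) p]) (use \<delta> in auto)
  moreover have "\<forall>\<^sub>F q in at p within S. \<forall>z\<in>?W p. \<exists>z'\<in>?W q. norm (z' - z) \<le> \<delta> / 8 * norm z"
    by (rule eventually_image_close[OF C(1,2) p]) (use \<delta> in auto)
  moreover have "\<forall>\<^sub>F q in at p within S. q \<in> S"
    by (simp add: eventually_at_filter)
  ultimately show "\<forall>\<^sub>F q in at p within S. op_close (X1 J) \<delta> (relative_unitary (?\<Lambda> q) (?W q)) (relative_unitary (?\<Lambda> p) (?W p))"
  proof eventually_elim
    case (elim q)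
    note \<Lambda>p = A(3)[OF p] and \<Lambda>q = A(3)[OF elim(3)] and Wp = C(3)[OF p] and Wq = C(3)[OF elim(3)]
    show ?case
      unfolding op_close_def
    proof
      fix x assume x: "x \<in> X1 J"
      let ?y = "relative_unitary (?\<Lambda> p) (?W p) x" and ?y' = "relative_unitary (?\<Lambda> q) (?W q) x"
      let ?U = "\<lambda>p. lagrange_unitary J (?\<Lambda> p)" and ?T = "\<lambda>p. lagrange_unitary J (?W p)"
      have y: "?y \<in> X1 J" "?y' \<in> X1 J" "norm ?y = norm x"
        using unitary_isoD(1,5)[OF unitary_iso_relative_unitary[OF \<Lambda>p Wp] x]
          unitary_isoD(1)[OF unitary_iso_relative_unitary[OF \<Lambda>q Wq] x] by auto
      have "norm (?y' - ?y) = norm (?T q ?y' - ?T q ?y)"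
        using unitary_isoD(5)[OF unitary_iso_lagrange_unitary[OF Wq] vec.subspace_diff[OF subspace_X1 y(2,1)]]
          unitary_iso_diff[OF unitary_iso_lagrange_unitary[OF Wq] subspace_X1 y(2,1)] by simp
      also have "?T q ?y' - ?T q ?y = (?U q x - ?U p x) - (?T q ?y - ?T p ?y)"
        using lagrange_unitary_relative_unitary[OF \<Lambda>q Wq x] lagrange_unitary_relative_unitary[OF \<Lambda>p Wp x] by simp
      also have "norm \<dots> \<le> norm (?U q x - ?U p x) + norm (?T q ?y - ?T p ?y)"
        by (rule norm_triangle_ineq4)
      also have "\<dots> \<le> 4 * (\<delta> / 8) * norm x + 4 * (\<delta> / 8) * norm ?y"
        using elim(1,2) \<delta>
        by (intro add_mono lagrange_unitary_close[OF \<Lambda>p \<Lambda>q _ _ x] lagrange_unitary_close[OF Wp Wq _ _ y(1)]) auto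
      finally show "norm (?y' - ?y) \<le> \<delta> * norm x"
        using y(3) by simp
    qed
  qed
qed

text \<open>The kernel dimension is constant along the edge \<open>t = b\<close>, so no eigenvalue crosses \<open>1\<close> there.
  Along the edge \<open>t = a\<close> the spectrum is symmetric, so half of the change of the kernel dimension
  crosses.\<close>

lemma maslov_index_homotopy:
  fixes A C :: "real \<times> real \<Rightarrow> complex ^ 'm ^ 'm" and h :: "real \<Rightarrow> nat"
  assumes ab: "a \<le> b" and cd: "c \<le> d"
    and A: "continuous_on ({c..d} \<times> {a..b}) A" "\<And>p. p \<in> {c..d} \<times> {a..b} \<Longrightarrow> invertible (A p)"
      "\<And>p. p \<in> {c..d} \<times> {a..b} \<Longrightarrow> lagrangian ((*v) (A p) ` L)"
    and C: "continuous_on ({c..d} \<times> {a..b}) C" "\<And>p. p \<in> {c..d} \<times> {a..b} \<Longrightarrow> invertible (C p)"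
      "\<And>p. p \<in> {c..d} \<times> {a..b} \<Longrightarrow> lagrangian ((*v) (C p) ` M)"
    and right: "\<And>s. s \<in> {c..d} \<Longrightarrow> vec.dim ((*v) (A (s, b)) ` L \<inter> (*v) (C (s, b)) ` M) = r"
    and left: "\<And>s. s \<in> {c..d} \<Longrightarrow> int (vec.dim ((*v) (A (s, a)) ` L \<inter> (*v) (C (s, a)) ` M)) = l + 2 * int (h s)"
    and S: "S ** S = mat 1" "S ** J = - (J ** S)"
    and S_inv: "\<And>s z. s \<in> {c..d} \<Longrightarrow> z \<in> (*v) (A (s, a)) ` L \<Longrightarrow> S *v z \<in> (*v) (A (s, a)) ` L"
      "\<And>s z. s \<in> {c..d} \<Longrightarrow> z \<in> (*v) (C (s, a)) ` M \<Longrightarrow> S *v z \<in> (*v) (C (s, a)) ` M"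
    and \<Lambda>0: "\<And>t. t \<in> {a..b} \<Longrightarrow> \<Lambda>0 t = (*v) (A (c, t)) ` L" and W0: "\<And>t. t \<in> {a..b} \<Longrightarrow> W0 t = (*v) (C (c, t)) ` M"
    and \<Lambda>1: "\<And>t. t \<in> {a..b} \<Longrightarrow> \<Lambda>1 t = (*v) (A (d, t)) ` L" and W1: "\<And>t. t \<in> {a..b} \<Longrightarrow> W1 t = (*v) (C (d, t)) ` M"
  shows "maslov_index J \<Lambda>1 W1 a b - maslov_index J \<Lambda>0 W0 a b = int (h d) - int (h c)"
proof -
  let ?D = "{c..d} \<times> {a..b}"
  define V where "V s t = relative_unitary ((*v) (A (s, t)) ` L) ((*v) (C (s, t)) ` M)" for s t
  have V: "unitary_iso (X1 J) (X1 J) (V s t)" if "s \<in> {c..d}" "t \<in> {a..b}" for s t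
    unfolding V_def using that by (intro unitary_iso_relative_unitary A(3) C(3)) auto
  have cont: "op_continuous_on ?D (X1 J) (\<lambda>p. V (fst p) (snd p))"
    using op_continuous_on_relative_unitary[OF A C] by (simp add: V_def)
  have cont_s: "op_continuous_on {c..d} (X1 J) (\<lambda>s. V s t)" if "t \<in> {a..b}" for t
  proof -
    have "continuous_on {c..d} (\<lambda>s. (s, t))"
      by (intro continuous_intros)
    moreover have "(\<lambda>s. (s, t)) ` {c..d} \<subseteq> ?D"
      using that by auto
    ultimately show ?thesis
      using op_continuous_on_compose[OF cont] by fastforce
  qed
  have ends: "a \<in> {a..b}" "b \<in> {a..b}" using ab by auto
  have fixed: "vec.dim {x \<in> X1 J. V s t x = x} = vec.dim ((*v) (A (s, t)) ` L \<inter> (*v) (C (s, t)) ` M)"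
    if "s \<in> {c..d}" "t \<in> {a..b}" for s t
    unfolding V_def using that by (intro dim_fixed_relative_unitary A(3) C(3)) auto
  have "spectral_flow_l (X1 J) (V d) a b - spectral_flow_l (X1 J) (V c) a b = (0 - 0) - (int (h d) - int (h c))"
  proof (rule spectral_flow_homotopy[OF subspace_X1 V cont ab cd, where g = "\<lambda>_. 0"])
    fix s0 \<epsilon> assume s0: "s0 \<in> {c..d}" and \<epsilon>: "0 < \<epsilon>" "\<epsilon> < pi" "no_eigenvalue (X1 J) (V s0 a) (cis \<epsilon>)"
    obtain \<delta> where \<delta>: "\<delta> > 0" and count: "\<forall>V'. unitary_iso (X1 J) (X1 J) V' \<longrightarrow> op_close (X1 J) \<delta> V' (V s0 a) \<longrightarrow>
      (\<forall>\<mu>. norm \<mu> = 1 \<longrightarrow> vec.dim {x\<in>X1 J. V' x = cnj \<mu> *s x} = vec.dim {x\<in>X1 J. V' x = \<mu> *s x}) \<longrightarrow>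
      2 * (int (arc_count (X1 J) V' \<epsilon>) - int (arc_count (X1 J) (V s0 a) \<epsilon>)) =
        int (vec.dim {x\<in>X1 J. V' x = x}) - int (vec.dim {x\<in>X1 J. V s0 a x = x})"
      using arc_count_conjugation_symmetric[OF V[OF s0 ends(1)] subspace_X1 \<epsilon>] by blast
    have "\<forall>\<^sub>F s in at s0 within {c..d}. op_close (X1 J) \<delta> (V s a) (V s0 a)"
      using cont_s[OF ends(1)] s0 \<delta> by (simp add: op_continuous_on_def)
    moreover have "\<forall>\<^sub>F s in at s0 within {c..d}. s \<in> {c..d}"
      by (simp add: eventually_at_filter)
    ultimately show "\<forall>\<^sub>F s in at s0 within {c..d}. int (arc_count (X1 J) (V s a) \<epsilon>) - int (arc_count (X1 J) (V s0 a) \<epsilon>) = int (h s) - int (h s0)"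
    proof eventually_elim
      case (elim s)
      have "vec.dim {x\<in>X1 J. V s a x = cnj \<mu> *s x} = vec.dim {x\<in>X1 J. V s a x = \<mu> *s x}" if "norm \<mu> = 1" for \<mu>
        unfolding V_def using elim(2) ends(1)
        by (intro dim_eigenspace_conjugation_symmetric[OF _ _ S _ _ that] A(3) C(3) S_inv) auto
      then have "2 * (int (arc_count (X1 J) (V s a) \<epsilon>) - int (arc_count (X1 J) (V s0 a) \<epsilon>)) =
        int (vec.dim {x\<in>X1 J. V s a x = x}) - int (vec.dim {x\<in>X1 J. V s0 a x = x})"
        using count V[OF elim(2) ends(1)] elim(1) by blast
      then show ?case
        by (simp only: fixed[OF elim(2) ends(1)] fixed[OF s0 ends(1)] left[OF elim(2)] left[OF s0]) simp
    qed
  next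
    fix s0 \<epsilon> assume s0: "s0 \<in> {c..d}" and \<epsilon>: "0 < \<epsilon>" "\<epsilon> < pi" "no_eigenvalue (X1 J) (V s0 b) (cis \<epsilon>)"
    obtain \<delta> where \<delta>: "\<delta> > 0" and count: "\<forall>V'. unitary_iso (X1 J) (X1 J) V' \<longrightarrow> op_close (X1 J) \<delta> V' (V s0 b) \<longrightarrow>
      vec.dim {x\<in>X1 J. V' x = x} = vec.dim {x\<in>X1 J. V s0 b x = x} \<longrightarrow>
      int (arc_count (X1 J) V' \<epsilon>) - int (arc_count (X1 J) (V s0 b) \<epsilon>) = 0"
      using arc_count_constant_multiplicity_one[OF V[OF s0 ends(2)] subspace_X1 \<epsilon>] by blast
    have "\<forall>\<^sub>F s in at s0 within {c..d}. op_close (X1 J) \<delta> (V s b) (V s0 b)"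
      using cont_s[OF ends(2)] s0 \<delta> by (simp add: op_continuous_on_def)
    moreover have "\<forall>\<^sub>F s in at s0 within {c..d}. s \<in> {c..d}"
      by (simp add: eventually_at_filter)
    ultimately show "\<forall>\<^sub>F s in at s0 within {c..d}. int (arc_count (X1 J) (V s b) \<epsilon>) - int (arc_count (X1 J) (V s0 b) \<epsilon>) = 0 - 0"
    proof eventually_elim
      case (elim s)
      have "vec.dim {x\<in>X1 J. V s b x = x} = vec.dim {x\<in>X1 J. V s0 b x = x}"
        by (simp only: fixed[OF elim(2) ends(2)] fixed[OF s0 ends(2)] right[OF elim(2)] right[OF s0])
      then show ?case
        using count V[OF elim(2) ends(2)] elim(1) by simp
    qed
  qed
  moreover have "maslov_index J \<Lambda>0 W0 a b = - spectral_flow_l (X1 J) (V c) a b"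
    "maslov_index J \<Lambda>1 W1 a b = - spectral_flow_l (X1 J) (V d) a b"
    unfolding maslov_index_eq V_def using \<Lambda>0 W0 \<Lambda>1 W1
    by (auto intro!: arg_cong[where f = uminus] spectral_flow_l_cong)
  ultimately show ?thesis by simp
qed

end

section \<open>The symplectic spaces of the boundary value problem\<close>

lemma vec_linearI:
  assumes "\<And>x y. f (x + y) = f x + f y" "\<And>c x. f (c *s x) = c *s f x"
  shows "Vector_Spaces.linear (*s) (*s) (f :: complex ^ 'm::finite \<Rightarrow> complex ^ 'k::finite)"
  by unfold_locales (simp_all add: assms vec_eq_iff algebra_simps)

lemma vec_dim_linear_image:
  fixes f :: "complex ^ 'm::finite \<Rightarrow> complex ^ 'k::finite"
  assumes "\<And>x y. f (x + y) = f x + f y" "\<And>c x. f (c *s x) = c *s f x" "inj f"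
  shows "vec.dim (f ` S) = vec.dim S"
  using vec_linearI[OF assms(1,2)] assms(3) by (intro vec.dim_image_eq) (auto intro: inj_on_subset)

lemma Jmat_vjoin: "Jmat *v vjoin x y = vjoin (- y) x"
  by (simp add: Jmat_def block_mat_vjoin uminus_matrix_vector_mult)

lemma adjoint_Jmat: "adjoint_mat Jmat = - Jmat"
  by (simp add: Jmat_def adjoint_block_mat adjoint_mat_minus block_mat_minus)

lemma Jmat_Jmat: "Jmat ** Jmat = - mat 1"
  by (simp add: Jmat_def block_mat_mult matrix_mult_simps mat_1_block block_mat_minus)

lemma cinner_Jmat_left: "cinner (Jmat *v z) w = - cinner z (Jmat *v w)"
  by (simp add: cinner_adjoint adjoint_Jmat uminus_matrix_vector_mult cinner_minus_right)

interpretation phase_sum: symplectic_structure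
  "block_mat (- Jmat) 0 0 Jmat :: complex ^ (('n::finite + 'n) + ('n + 'n)) ^ (('n + 'n) + ('n + 'n))"
  by unfold_locales
     (simp_all add: adjoint_block_mat adjoint_mat_minus adjoint_Jmat block_mat_minus block_mat_mult
        matrix_mult_simps Jmat_Jmat mat_1_block)

definition symplectic :: "complex ^ ('n::finite + 'n) ^ ('n + 'n) \<Rightarrow> bool" where
  "symplectic M \<longleftrightarrow> adjoint_mat M ** Jmat ** M = Jmat"

lemma symplectic_mult:
  assumes "symplectic M" "symplectic N"
  shows "symplectic (M ** N)"
proof -
  have "adjoint_mat (M ** N) ** Jmat ** (M ** N) = adjoint_mat N ** (adjoint_mat M ** Jmat ** M) ** N"
    by (simp add: adjoint_mat_mult matrix_mul_assoc)
  then show ?thesis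
    using assms by (simp add: symplectic_def)
qed

lemma symplectic_left_inverse:
  assumes "symplectic M"
  shows "(- Jmat ** adjoint_mat M ** Jmat) ** M = mat 1"
proof -
  have "(- Jmat ** adjoint_mat M ** Jmat) ** M = - Jmat ** (adjoint_mat M ** Jmat ** M)"
    by (simp only: matrix_mul_assoc)
  then show ?thesis
    using assms by (simp add: symplectic_def matrix_mult_simps Jmat_Jmat)
qed

lemma symplectic_invertible:
  assumes "symplectic M"
  shows "invertible M"
  unfolding invertible_def
  using symplectic_left_inverse[OF assms] matrix_left_right_inverse by blast

lemma lagrangian_Gr:
  assumes M: "symplectic M"
  shows "phase_sum.lagrangian (Gr M)"
  unfolding phase_sum.lagrangian_def
proof (intro conjI allI)
  show "vec.subspace (Gr M)"
    unfolding vec.subspace_def Gr_def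
    by (auto simp: vjoin_add vjoin_scale vec.add[symmetric] vec.scale[symmetric] intro: exI[of _ 0])
  have form: "cinner (block_mat (- Jmat) 0 0 Jmat *v vjoin v (M *v v)) (vjoin w w')
      = cinner v (Jmat *v w - adjoint_mat M *v (Jmat *v w'))" for v w w'
    by (simp add: block_mat_vjoin cinner_vjoin uminus_matrix_vector_mult cinner_minus_left cinner_Jmat_left
        cinner_adjoint[of M] cinner_diff_right)
  fix w
  show "w \<in> Gr M \<longleftrightarrow> (\<forall>z\<in>Gr M. cinner (block_mat (- Jmat) 0 0 Jmat *v z) w = 0)"
  proof (cases w rule: vjoin_cases)
    case (vjoin p q)
    have "(\<forall>z\<in>Gr M. cinner (block_mat (- Jmat) 0 0 Jmat *v z) w = 0)
        \<longleftrightarrow> (\<forall>v. cinner v (Jmat *v p - adjoint_mat M *v (Jmat *v q)) = 0)"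
      unfolding vjoin Gr_def by (simp add: form[symmetric]) blast
    also have "\<dots> \<longleftrightarrow> Jmat *v p = adjoint_mat M *v (Jmat *v q)"
      by (metis cinner_self_eq_0 cinner_zero_right right_minus_eq)
    also have "\<dots> \<longleftrightarrow> q = M *v p"
    proof
      assume eq: "Jmat *v p = adjoint_mat M *v (Jmat *v q)"
      have J: "adjoint_mat M ** Jmat ** M = Jmat" using M by (simp add: symplectic_def)
      have "(adjoint_mat M ** Jmat) *v (M *v p) = (adjoint_mat M ** Jmat) *v q"
        using eq J by (simp add: matrix_vector_mul_assoc)
      moreover have "invertible (adjoint_mat M ** Jmat)"
      proof (rule invertible_mult)
        show "invertible (adjoint_mat M)"
          by (rule adjoint_mat_invertible[OF symplectic_invertible[OF M]])
        show "invertible (Jmat :: complex ^ ('a + 'a) ^ ('a + 'a))"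
          unfolding invertible_def
          by (intro exI[of _ "- Jmat"]) (simp add: matrix_mult_simps Jmat_Jmat)
      qed
      ultimately show "q = M *v p"
        using inj_matrix_mult injD by metis
    next
      assume "q = M *v p"
      then show "Jmat *v p = adjoint_mat M *v (Jmat *v q)"
        using M by (simp add: symplectic_def matrix_vector_mul_assoc matrix_mul_assoc)
    qed
    also have "\<dots> \<longleftrightarrow> w \<in> Gr M"
      unfolding vjoin Gr_def by auto
    finally show ?thesis by simp
  qed
qed

lemma vjoin_WR_iff:
  "vjoin (vjoin x y) (vjoin z u) \<in> WR R \<longleftrightarrow> vjoin x (- z) \<in> orth_compl R \<and> vjoin y u \<in> R"
  unfolding WR_def by auto

text \<open>The form \<open>(-\<omega>) \<oplus> \<omega>\<close> pairs the position part of one vector with the momentum part of the other, so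
  \<open>W(R)\<close> is its own annihilator because \<open>R\<^sup>\<bottom>\<^sup>\<bottom> = R\<close>.\<close>

lemma lagrangian_WR:
  assumes R: "vec.subspace R"
  shows "phase_sum.lagrangian (WR R)"
  unfolding phase_sum.lagrangian_def
proof (intro conjI allI)
  note sub = R vec_subspace_orth_compl[of R]
  show "vec.subspace (WR R)"
    unfolding vec.subspace_def
  proof (intro conjI ballI allI)
    have "vjoin (vjoin 0 0) (vjoin 0 0) \<in> WR R"
      unfolding vjoin_WR_iff using sub[THEN vec.subspace_0] by (simp add: vjoin_zero)
    then show "0 \<in> WR R" by (simp add: vjoin_zero)
  next
    fix v w assume "v \<in> WR R" "w \<in> WR R"
    then obtain x y z u x' y' z' u' where vw:
      "v = vjoin (vjoin x y) (vjoin z u)" "vjoin x (- z) \<in> orth_compl R" "vjoin y u \<in> R"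
      "w = vjoin (vjoin x' y') (vjoin z' u')" "vjoin x' (- z') \<in> orth_compl R" "vjoin y' u' \<in> R"
      unfolding WR_def by blast
    then show "v + w \<in> WR R"
      using vec.subspace_add[OF sub(1) vw(3,6)] vec.subspace_add[OF sub(2) vw(2,5)]
      by (simp add: vjoin_add vjoin_WR_iff)
  next
    fix c v assume "v \<in> WR R"
    then obtain x y z u where v:
      "v = vjoin (vjoin x y) (vjoin z u)" "vjoin x (- z) \<in> orth_compl R" "vjoin y u \<in> R"
      unfolding WR_def by blast
    then show "c *s v \<in> WR R"
      using vec.subspace_scale[OF sub(1) v(3), of c] vec.subspace_scale[OF sub(2) v(2), of c]
      by (simp add: vjoin_scale vjoin_WR_iff)
  qed
  have form: "cinner (block_mat (- Jmat) 0 0 Jmat *v vjoin (vjoin x y) (vjoin z u)) (vjoin (vjoin x' y') (vjoin z' u'))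
      = cinner (vjoin y u) (vjoin x' (- z')) - cinner (vjoin x (- z)) (vjoin y' u')" for x y z u x' y' z' u'
    by (simp add: block_mat_vjoin uminus_matrix_vector_mult Jmat_vjoin vjoin_minus cinner_vjoin cinner_simps)
  fix w
  show "w \<in> WR R \<longleftrightarrow> (\<forall>v\<in>WR R. cinner (block_mat (- Jmat) 0 0 Jmat *v v) w = 0)"
  proof
    assume "w \<in> WR R"
    then obtain x' y' z' u' where w:
      "w = vjoin (vjoin x' y') (vjoin z' u')" "vjoin x' (- z') \<in> orth_compl R" "vjoin y' u' \<in> R"
      unfolding WR_def by blast
    show "\<forall>v\<in>WR R. cinner (block_mat (- Jmat) 0 0 Jmat *v v) w = 0"
    proof
      fix v assume "v \<in> WR R"
      then obtain x y z u where v: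
        "v = vjoin (vjoin x y) (vjoin z u)" "vjoin x (- z) \<in> orth_compl R" "vjoin y u \<in> R"
        unfolding WR_def by blast
      have "cinner (vjoin x' (- z')) (vjoin y u) = 0" "cinner (vjoin x (- z)) (vjoin y' u') = 0"
        using v w by (auto simp: orth_compl_def)
      then show "cinner (block_mat (- Jmat) 0 0 Jmat *v v) w = 0"
        unfolding v w form using cinner_commute[of "vjoin y u"] by simp
    qed
  next
    assume zero: "\<forall>v\<in>WR R. cinner (block_mat (- Jmat) 0 0 Jmat *v v) w = 0"
    obtain x' y' z' u' where w: "w = vjoin (vjoin x' y') (vjoin z' u')"
      by (metis vjoin_cases)
    have "cinner (vjoin x' (- z')) r = 0" if r: "r \<in> R" for r
    proof (cases r rule: vjoin_cases)
      case (vjoin y u)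
      have "vjoin (vjoin 0 y) (vjoin 0 u) \<in> WR R"
        using r vjoin vec.subspace_0[OF sub(2)] by (simp add: vjoin_WR_iff vjoin_zero)
      then have "cinner (vjoin y u) (vjoin x' (- z')) = 0"
        using zero form[of 0 y 0 u x' y' z' u'] by (simp add: w cinner_vjoin)
      then show ?thesis
        using vjoin cinner_commute[of "vjoin x' (- z')" r] by simp
    qed
    then have "vjoin x' (- z') \<in> orth_compl R" by (simp add: orth_compl_def)
    moreover have "cinner (vjoin y' u') r = 0" if r: "r \<in> orth_compl R" for r
    proof (cases r rule: vjoin_cases)
      case (vjoin x z)
      have "vjoin (vjoin x 0) (vjoin (- z) 0) \<in> WR R"
        using r vjoin vec.subspace_0[OF sub(1)] by (simp add: vjoin_WR_iff vjoin_zero)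
      then have "cinner (vjoin x z) (vjoin y' u') = 0"
        using zero form[of x 0 "- z" 0 x' y' z' u'] by (simp add: w cinner_vjoin neg_eq_iff_add_eq_0)
      then show ?thesis
        using vjoin cinner_commute[of "vjoin y' u'" r] by simp
    qed
    then have "vjoin y' u' \<in> R"
      using orth_compl_orth_compl[OF R] by (auto simp: orth_compl_def)
    ultimately show "w \<in> WR R"
      by (simp add: w vjoin_WR_iff)
  qed
qed

lemma invertible_block_diagonal:
  assumes "invertible A" "invertible D"
  shows "invertible (block_mat A 0 0 (D :: complex ^ 'l::finite ^ 'l) :: complex ^ ('k::finite + 'l) ^ ('k + 'l))"
  unfolding invertible_def
  by (rule exI[of _ "block_mat (matrix_inv A) 0 0 (matrix_inv D)"])
     (simp add: block_mat_mult invertible_matrix_inv assms mat_1_block)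

section \<open>Change of coordinates\<close>

text \<open>A change of coordinates \<open>x \<mapsto> c x\<close> acts on momenta by the inverse adjoint.\<close>

definition cotangent_lift :: "complex ^ 'n::finite ^ 'n \<Rightarrow> complex ^ ('n + 'n) ^ ('n + 'n)" where
  "cotangent_lift c = block_mat (adjoint_mat (matrix_inv c)) 0 0 c"

lemma matrix_inv_invertible:
  "invertible (a :: complex ^ 'n::finite ^ 'n) \<Longrightarrow> invertible (matrix_inv a)"
  using invertible_matrix_inv unfolding invertible_def by metis

lemma matrix_inv_mult:
  assumes "invertible (a :: complex ^ 'n::finite ^ 'n)" "invertible (b :: complex ^ 'n ^ 'n)"
  shows "matrix_inv (a ** b) = matrix_inv b ** matrix_inv a"
proof (rule matrix_inv_eqI)
  have "a ** b ** (matrix_inv b ** matrix_inv a) = a ** (b ** matrix_inv b) ** matrix_inv a"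
    by (simp only: matrix_mul_assoc)
  then show "a ** b ** (matrix_inv b ** matrix_inv a) = mat 1"
    by (simp add: invertible_matrix_inv assms)
qed

lemma matrix_inv_matrix_inv:
  "invertible (a :: complex ^ 'n::finite ^ 'n) \<Longrightarrow> matrix_inv (matrix_inv a) = a"
  by (rule matrix_inv_eqI) (simp add: invertible_matrix_inv)

lemma cotangent_lift_mult:
  assumes "invertible a" "invertible b"
  shows "cotangent_lift (a ** b) = cotangent_lift a ** cotangent_lift b"
  by (simp add: cotangent_lift_def block_mat_mult matrix_inv_mult assms adjoint_mat_mult)

lemma cotangent_lift_1: "cotangent_lift (mat 1) = mat 1"
  by (simp add: cotangent_lift_def matrix_inv_eqI mat_1_block)

lemma cotangent_lift_inverse:
  assumes "invertible a"
  shows "cotangent_lift a ** cotangent_lift (matrix_inv a) = mat 1"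
    and "cotangent_lift (matrix_inv a) ** cotangent_lift a = mat 1"
  using assms by (simp_all add: cotangent_lift_mult[symmetric] matrix_inv_invertible invertible_matrix_inv cotangent_lift_1)

lemma symplectic_cotangent_lift:
  assumes "invertible c"
  shows "symplectic (cotangent_lift c)"
proof -
  have "adjoint_mat c ** adjoint_mat (matrix_inv c) = mat 1"
    by (simp add: adjoint_mat_mult[symmetric] invertible_matrix_inv assms)
  then show ?thesis
    by (simp add: symplectic_def cotangent_lift_def Jmat_def adjoint_block_mat block_mat_mult matrix_mult_simps
        invertible_matrix_inv assms adjoint_mat_mult)
qed

lemma continuous_on_cotangent_lift:
  assumes "continuous_on S c" "\<And>p. p \<in> S \<Longrightarrow> invertible (c p)"
  shows "continuous_on S (\<lambda>p. cotangent_lift (c p))"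
  unfolding cotangent_lift_def by (intro continuous_intros assms)

definition transformed_boundary ::
  "complex ^ 'n::finite ^ 'n \<Rightarrow> complex ^ 'n ^ 'n \<Rightarrow> (complex ^ ('n + 'n)) set \<Rightarrow> (complex ^ ('n + 'n)) set" where
  "transformed_boundary a b R = {vjoin x y |x y. vjoin (a *v x) (b *v y) \<in> R}"

lemma vjoin_transformed_boundary_iff:
  "vjoin x y \<in> transformed_boundary a b R \<longleftrightarrow> vjoin (a *v x) (b *v y) \<in> R"
  unfolding transformed_boundary_def by auto

lemma transformed_boundary_1: "transformed_boundary (mat 1) (mat 1) R = R"
  unfolding transformed_boundary_def by (auto, metis vjoin_cases)

lemma subspace_transformed_boundary:
  assumes "vec.subspace R"
  shows "vec.subspace (transformed_boundary a b R)"
  unfolding vec.subspace_def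
proof (intro conjI ballI allI)
  show "0 \<in> transformed_boundary a b R"
    using vjoin_transformed_boundary_iff[of 0 0 a b R] vec.subspace_0[OF assms] by (simp add: vjoin_zero)
next
  fix v w assume vw: "v \<in> transformed_boundary a b R" "w \<in> transformed_boundary a b R"
  show "v + w \<in> transformed_boundary a b R"
    using vw vec.subspace_add[OF assms]
    by (cases v rule: vjoin_cases; cases w rule: vjoin_cases)
       (force simp: vjoin_transformed_boundary_iff vjoin_add vec.add)
next
  fix c v assume v: "v \<in> transformed_boundary a b R"
  show "c *s v \<in> transformed_boundary a b R"
    using v vec.subspace_scale[OF assms, of _ c]
    by (cases v rule: vjoin_cases) (force simp: vjoin_transformed_boundary_iff vjoin_scale vec.scale)
qed

lemma transformed_boundary_eq_image:
  assumes "invertible a" "invertible b"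
  shows "transformed_boundary a b R = (*v) (block_mat (matrix_inv a) 0 0 (matrix_inv b)) ` R"
proof (intro set_eqI iffI)
  fix v assume v: "v \<in> transformed_boundary a b R"
  then obtain x y where xy: "v = vjoin x y" "vjoin (a *v x) (b *v y) \<in> R"
    unfolding transformed_boundary_def by blast
  have "v = block_mat (matrix_inv a) 0 0 (matrix_inv b) *v vjoin (a *v x) (b *v y)"
    by (simp add: xy(1) block_mat_vjoin matrix_vector_mul_assoc invertible_matrix_inv assms)
  then show "v \<in> (*v) (block_mat (matrix_inv a) 0 0 (matrix_inv b)) ` R"
    using xy(2) by (rule image_eqI)
next
  fix v assume "v \<in> (*v) (block_mat (matrix_inv a) 0 0 (matrix_inv b)) ` R"
  then obtain r where r: "r \<in> R" "v = block_mat (matrix_inv a) 0 0 (matrix_inv b) *v r" by blast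
  show "v \<in> transformed_boundary a b R"
    using r by (cases r rule: vjoin_cases)
      (simp add: block_mat_vjoin vjoin_transformed_boundary_iff matrix_vector_mul_assoc invertible_matrix_inv assms)
qed

lemma dim_transformed_boundary:
  assumes "invertible a" "invertible b" "vec.subspace R"
  shows "vec.dim (transformed_boundary a b R) = vec.dim R"
  unfolding transformed_boundary_eq_image[OF assms(1,2)]
  by (intro dim_matrix_image assms(3) inj_on_subset[OF inj_matrix_mult] invertible_block_diagonal
      matrix_inv_invertible assms) auto

text \<open>Positions satisfy the transformed condition by definition; momenta do because the inverse adjoint
  carries the annihilator of the transformed space to the annihilator of \<open>R\<close>.\<close>

lemma WR_transformed_boundary:
  assumes a: "invertible a" and b: "invertible b"
  shows "WR (transformed_boundary a b R) =
    (*v) (block_mat (cotangent_lift (matrix_inv a)) 0 0 (cotangent_lift (matrix_inv b))) ` WR R" (is "_ = (*v) ?B ` _")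
proof -
  let ?C = "block_mat (cotangent_lift a) 0 0 (cotangent_lift b)"
  have orth: "vjoin (adjoint_mat (matrix_inv a) *v x) (- (adjoint_mat (matrix_inv b) *v z)) \<in> orth_compl R
      \<longleftrightarrow> vjoin x (- z) \<in> orth_compl (transformed_boundary a b R)" for x z
  proof -
    have "cinner (vjoin (adjoint_mat (matrix_inv a) *v x) (- (adjoint_mat (matrix_inv b) *v z))) r
        = cinner (vjoin x (- z)) (block_mat (matrix_inv a) 0 0 (matrix_inv b) *v r)" for r
      by (cases r rule: vjoin_cases)
         (simp add: block_mat_vjoin cinner_vjoin cinner_minus_left cinner_adjoint)
    then show ?thesis
      unfolding orth_compl_def transformed_boundary_eq_image[OF a b] by auto
  qed
  have iff: "v \<in> WR (transformed_boundary a b R) \<longleftrightarrow> ?C *v v \<in> WR R" for v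
  proof -
    obtain x y z u where v: "v = vjoin (vjoin x y) (vjoin z u)"
      by (metis vjoin_cases)
    show ?thesis
      unfolding v by (simp add: block_mat_vjoin cotangent_lift_def vjoin_WR_iff orth vjoin_transformed_boundary_iff)
  qed
  have inv: "?B ** ?C = mat 1" "?C ** ?B = mat 1"
    using a b by (simp_all add: block_mat_mult cotangent_lift_inverse mat_1_block)
  show ?thesis
  proof (intro set_eqI iffI)
    fix v assume "v \<in> WR (transformed_boundary a b R)"
    then have "?C *v v \<in> WR R" using iff by simp
    moreover have "v = ?B *v (?C *v v)" by (simp only: matrix_vector_mul_assoc inv matrix_vector_mul_lid)
    ultimately show "v \<in> (*v) ?B ` WR R" by blast
  next
    fix v assume "v \<in> (*v) ?B ` WR R"
    then obtain w where w: "w \<in> WR R" "v = ?B *v w" by blast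
    have "?C *v v = w" by (simp only: w(2) matrix_vector_mul_assoc inv matrix_vector_mul_lid)
    then show "v \<in> WR (transformed_boundary a b R)" using iff w(1) by simp
  qed
qed

lemma Gr_eq_image: "Gr M = (*v) (block_mat (mat 1) 0 0 M) ` Gr (mat 1)"
  unfolding Gr_def by (force simp: block_mat_vjoin image_iff)

lemma Gr_conjugate:
  assumes "A ** A' = mat 1"
  shows "Gr (B ** M ** A) = (*v) (block_mat A' 0 0 B) ` Gr M"
proof -
  have A'A: "A' ** A = mat 1"
    using assms by (simp add: matrix_left_right_inverse)
  show ?thesis
  proof (intro set_eqI iffI)
    fix z assume "z \<in> Gr (B ** M ** A)"
    then obtain v where v: "z = vjoin v (B ** M ** A *v v)" unfolding Gr_def by blast
    have "z = block_mat A' 0 0 B *v vjoin (A *v v) (M *v (A *v v))"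
      by (simp add: v block_mat_vjoin matrix_vector_mul_assoc A'A matrix_mul_assoc)
    then show "z \<in> (*v) (block_mat A' 0 0 B) ` Gr M"
      unfolding Gr_def by blast
  next
    fix z assume "z \<in> (*v) (block_mat A' 0 0 B) ` Gr M"
    then obtain v where v: "z = block_mat A' 0 0 B *v vjoin v (M *v v)" unfolding Gr_def by blast
    have "B ** M ** A ** A' = B ** M"
      by (simp add: assms flip: matrix_mul_assoc)
    then have "z = vjoin (A' *v v) (B ** M ** A *v (A' *v v))"
      by (simp add: v block_mat_vjoin matrix_vector_mul_assoc)
    then show "z \<in> Gr (B ** M ** A)"
      unfolding Gr_def by blast
  qed
qed

text \<open>Since the diagonal and \<open>W(R)\<close> split into momentum and position parts, their intersection is the
  direct sum of the annihilator of \<open>Gr (mat 1) + R\<close> and of \<open>Gr (mat 1) \<inter> R\<close>.\<close>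

lemma dim_Gr_id_Int_WR:
  fixes R :: "(complex ^ ('n::finite + 'n)) set"
  assumes R: "vec.subspace R"
  shows "int (vec.dim (Gr (mat 1) \<inter> WR R)) = int CARD('n) - int (vec.dim R) + 2 * int (vec.dim (Gr (mat 1) \<inter> R))"
proof -
  let ?G = "Gr (mat 1) :: (complex ^ ('n + 'n)) set"
  have G: "?G = range (\<lambda>v. vjoin v v)" unfolding Gr_def by auto
  have subG: "vec.subspace ?G"
    unfolding vec.subspace_def G by (auto simp: vjoin_add vjoin_scale vjoin_zero[symmetric] image_iff)
  have dimG: "vec.dim ?G = CARD('n)"
    unfolding G by (subst vec_dim_linear_image) (auto simp: vjoin_add vjoin_scale inj_def card_cart_basis)
  define A where "A = {x :: complex ^ 'n. vjoin x (- x) \<in> orth_compl R}"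
  define B where "B = {y :: complex ^ 'n. vjoin y y \<in> R}"
  have subA: "vec.subspace A"
    unfolding vec.subspace_def
  proof (intro conjI ballI allI)
    note sub = vec_subspace_orth_compl[of R]
    show "0 \<in> A"
      using vec.subspace_0[OF sub] by (simp add: A_def vjoin_zero)
    show "x + y \<in> A" if "x \<in> A" "y \<in> A" for x y
      using vec.subspace_add[OF sub, of "vjoin x (- x)" "vjoin y (- y)"] that by (simp add: A_def vjoin_add)
    show "c *s x \<in> A" if "x \<in> A" for c x
      using vec.subspace_scale[OF sub, of "vjoin x (- x)" c] that by (simp add: A_def vjoin_scale)
  qed
  have subB: "vec.subspace B"
    unfolding vec.subspace_def
  proof (intro conjI ballI allI)
    show "0 \<in> B"
      using vec.subspace_0[OF R] by (simp add: B_def vjoin_zero)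
    show "x + y \<in> B" if "x \<in> B" "y \<in> B" for x y
      using vec.subspace_add[OF R, of "vjoin x x" "vjoin y y"] that by (simp add: B_def vjoin_add)
    show "c *s x \<in> B" if "x \<in> B" for c x
      using vec.subspace_scale[OF R, of "vjoin x x" c] that by (simp add: B_def vjoin_scale)
  qed
  have dimB: "vec.dim B = vec.dim (?G \<inter> R)"
  proof -
    have "?G \<inter> R = (\<lambda>v. vjoin v v) ` B" unfolding G B_def by auto
    then show ?thesis
      by (simp add: vec_dim_linear_image vjoin_add vjoin_scale inj_def)
  qed
  have dimA: "vec.dim A + vec.dim R = CARD('n) + vec.dim (?G \<inter> R)"
  proof -
    let ?S = "{x + y |x y. x \<in> ?G \<and> y \<in> R}"
    have "(\<lambda>x. vjoin x (- x)) ` A = orth_compl ?S"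
    proof (intro set_eqI iffI)
      fix w assume "w \<in> (\<lambda>x. vjoin x (- x)) ` A"
      then show "w \<in> orth_compl ?S"
        unfolding A_def G orth_compl_def by (auto simp: cinner_add_right cinner_vjoin cinner_minus_left)
    next
      fix w assume w: "w \<in> orth_compl ?S"
      obtain p q where pq: "w = vjoin p q" by (metis vjoin_cases)
      have wG: "cinner w g = 0" if "g \<in> ?G" for g
        using w that vec.subspace_0[OF R] unfolding orth_compl_def by force
      have "cinner (p + q) v = 0" for v
        using wG[of "vjoin v v"] unfolding G pq by (simp add: cinner_vjoin cinner_add_left)
      then have "p + q = 0" using cinner_self_eq_0 by blast
      then have "w = vjoin p (- p)" by (simp add: pq eq_neg_iff_add_eq_0 add.commute)
      moreover have "w \<in> orth_compl R"
        using w vec.subspace_0[OF subG] unfolding orth_compl_def by force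
      ultimately show "w \<in> (\<lambda>x. vjoin x (- x)) ` A"
        unfolding A_def by auto
    qed
    then have "vec.dim A = vec.dim (orth_compl ?S)"
      by (subst vec_dim_linear_image[of "\<lambda>x. vjoin x (- x)" A, symmetric])
         (auto simp: vjoin_add vjoin_scale inj_def)
    moreover have "vec.dim ?S + vec.dim (orth_compl ?S) = CARD('n + 'n)"
      by (rule dim_orth_compl) (rule vec.subspace_sums[OF subG R])
    moreover have "vec.dim ?S + vec.dim (?G \<inter> R) = CARD('n) + vec.dim R"
      using vec.dim_sums_Int[OF subG R] dimG by simp
    ultimately show ?thesis by (simp add: card_UNIV_sum)
  qed
  define f where "f x = vjoin (vjoin x (0 :: complex ^ 'n)) (vjoin x (0 :: complex ^ 'n))" for x :: "complex ^ 'n"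
  define g where "g y = vjoin (vjoin (0 :: complex ^ 'n) y) (vjoin (0 :: complex ^ 'n) y)" for y :: "complex ^ 'n"
  have lin: "Vector_Spaces.linear (*s) (*s) f" "Vector_Spaces.linear (*s) (*s) g"
    by (rule vec_linearI; simp add: f_def g_def vjoin_add vjoin_scale)+
  have "Gr (mat 1) \<inter> WR R = {x + y |x y. x \<in> f ` A \<and> y \<in> g ` B}"
  proof (intro set_eqI iffI)
    fix z assume z: "z \<in> Gr (mat 1) \<inter> WR R"
    then obtain v where v: "z = vjoin v v" unfolding Gr_def by auto
    obtain x y where xy: "v = vjoin x y" by (metis vjoin_cases)
    have "x \<in> A" "y \<in> B" using z unfolding v xy A_def B_def by (auto simp: vjoin_WR_iff)
    moreover have "z = f x + g y" by (simp add: v xy f_def g_def vjoin_add)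
    ultimately show "z \<in> {x + y |x y. x \<in> f ` A \<and> y \<in> g ` B}" by blast
  next
    fix z assume "z \<in> {x + y |x y. x \<in> f ` A \<and> y \<in> g ` B}"
    then obtain x y where xy: "x \<in> A" "y \<in> B" "z = f x + g y" by blast
    then have "z = vjoin (vjoin x y) (vjoin x y)" by (simp add: f_def g_def vjoin_add)
    then show "z \<in> Gr (mat 1) \<inter> WR R"
      using xy unfolding A_def B_def Gr_def by (auto simp: vjoin_WR_iff)
  qed
  moreover have "f ` A \<inter> g ` B \<subseteq> {0}"
    by (auto simp: f_def g_def vjoin_zero)
  then have "vec.dim (f ` A \<inter> g ` B) = 0" by simp
  moreover have "vec.dim (f ` A) = vec.dim A" "vec.dim (g ` B) = vec.dim B"
    by (rule vec_dim_linear_image; auto simp: f_def g_def vjoin_add vjoin_scale inj_def)+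
  moreover have "vec.subspace (f ` A)" "vec.subspace (g ` B)"
    by (rule vec.linear_subspace_image[OF lin(1) subA], rule vec.linear_subspace_image[OF lin(2) subB])
  ultimately have "vec.dim (Gr (mat 1) \<inter> WR R) = vec.dim A + vec.dim B"
    using vec.dim_sums_Int[of "f ` A" "g ` B"] by (simp only:) simp
  then show ?thesis
    using dimA dimB by simp
qed

text \<open>The determinant of \<open>(1 - \<lambda>) A + \<lambda> B\<close> is a polynomial in \<open>\<lambda>\<close> that does not vanish at \<open>0\<close> and \<open>1\<close>,
  and a path in the plane can avoid its finitely many zeros.\<close>

lemma invertible_path_exists:
  fixes A B :: "complex ^ 'n::finite ^ 'n"
  assumes "invertible A" "invertible B"
  obtains c where "continuous_on {0..1::real} c" "\<And>s. s \<in> {0..1} \<Longrightarrow> invertible (c s)" "c 0 = A" "c 1 = B"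
proof -
  define M where "M z = (\<chi> i j. (1 - z) * A $ i $ j + z * B $ i $ j)" for z :: complex
  define q where "q = (\<Sum>p | p permutes (UNIV :: 'n set). of_int (sign p) *
      (\<Prod>i\<in>UNIV. [:A $ i $ p i, B $ i $ p i - A $ i $ p i:]))"
  have det: "poly q z = det (M z)" for z
    unfolding q_def det_def poly_sum poly_prod poly_mult M_def
    by (intro sum.cong refl arg_cong2[where f = "(*)"] prod.cong) (simp_all add: algebra_simps)
  have M01: "M 0 = A" "M 1 = B" by (simp_all add: M_def vec_eq_iff)
  have "poly q 0 \<noteq> 0" "poly q 1 \<noteq> 0"
    using assms by (simp_all add: det M01 invertible_det_nz)
  then have in01: "0 \<in> - {z. poly q z = 0}" "1 \<in> - {z. poly q z = 0}"
    by auto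
  then have "finite {z. poly q z = 0}"
    by (intro poly_roots_finite) auto
  then have "path_connected (- {z. poly q z = 0})"
    by (intro path_connected_complement_countable countable_finite) auto
  from this[unfolded path_connected_def, rule_format, OF in01] obtain g where g: "path g" "path_image g \<subseteq> - {z. poly q z = 0}" "pathstart g = 0" "pathfinish g = 1"
    by blast
  show thesis
  proof (rule that[of "\<lambda>s. M (g s)"])
    show "continuous_on {0..1} (\<lambda>s. M (g s))"
      using g(1) unfolding path_def M_def by (intro continuous_on_vec_lambda continuous_intros)
    show "invertible (M (g s))" if "s \<in> {0..1}" for s
    proof -
      have "g s \<in> - {z. poly q z = 0}"
        using g(2) that unfolding path_image_def by blast
      then show ?thesis by (simp add: invertible_det_nz det[symmetric])
    qed
  qed (use g(3,4) M01 in \<open>auto simp: pathstart_def pathfinish_def\<close>)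
qed

section \<open>Fundamental solutions\<close>

lemma adjoint_hamiltonian_mat:
  assumes "adjoint_mat p = p" "adjoint_mat r = r" "invertible p"
  shows "adjoint_mat (hamiltonian_mat p q r) = hamiltonian_mat p q r"
  using assms by (simp add: hamiltonian_mat_def adjoint_block_mat adjoint_mat_minus adjoint_mat_diff
      adjoint_mat_mult adjoint_mat_matrix_inv matrix_mul_assoc)

text \<open>The derivative of the pairing is \<open>Y\<^sup>* b J\<^sup>* J Z + Y\<^sup>* J J b Z\<close> because \<open>b\<close> is Hermitian, and
  \<open>J\<^sup>* J = mat 1\<close>, \<open>J J = - mat 1\<close> make the two terms cancel.\<close>

lemma symplectic_pairing_constant:
  fixes b Y Z :: "real \<Rightarrow> complex ^ ('n::finite + 'n) ^ ('n + 'n)"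
  assumes b: "\<And>t. t \<in> {0..T} \<Longrightarrow> adjoint_mat (b t) = b t"
    and Y: "\<And>t. t \<in> {0..T} \<Longrightarrow> (Y has_vector_derivative (Jmat ** b t) ** Y t) (at t within {0..T})"
    and Z: "\<And>t. t \<in> {0..T} \<Longrightarrow> (Z has_vector_derivative (Jmat ** b t) ** Z t) (at t within {0..T})"
    and t: "t \<in> {0..T}"
  shows "adjoint_mat (Y t) ** Jmat ** Z t = adjoint_mat (Y 0) ** Jmat ** Z 0"
proof -
  let ?f = "\<lambda>t. adjoint_mat (Y t) ** (Jmat ** Z t)"
  have "(?f has_vector_derivative 0) (at t within {0..T})" if t: "t \<in> {0..T}" for t
  proof -
    have "(?f has_vector_derivative adjoint_mat (Y t) ** (Jmat ** ((Jmat ** b t) ** Z t))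
        + adjoint_mat ((Jmat ** b t) ** Y t) ** (Jmat ** Z t)) (at t within {0..T})"
      by (intro bounded_bilinear.has_vector_derivative[OF bounded_bilinear_matrix_mult]
          bounded_linear.has_vector_derivative[OF bounded_linear_adjoint_mat]
          bounded_linear.has_vector_derivative[OF bounded_bilinear.bounded_linear_right[OF bounded_bilinear_matrix_mult]]
          Y Z t)
    also have "adjoint_mat (Y t) ** (Jmat ** ((Jmat ** b t) ** Z t)) = - (adjoint_mat (Y t) ** b t ** Z t)"
    proof -
      have "Jmat ** (Jmat ** b t ** Z t) = (Jmat ** Jmat) ** (b t ** Z t)"
        by (simp only: matrix_mul_assoc)
      then show ?thesis by (simp add: Jmat_Jmat matrix_mult_simps matrix_mul_assoc)
    qed
    also have "adjoint_mat ((Jmat ** b t) ** Y t) ** (Jmat ** Z t) = adjoint_mat (Y t) ** b t ** Z t"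
    proof -
      have "adjoint_mat (Jmat ** b t ** Y t) ** (Jmat ** Z t) = - (adjoint_mat (Y t) ** b t ** (Jmat ** Jmat) ** Z t)"
        by (simp add: adjoint_mat_mult b[OF t] adjoint_Jmat matrix_mult_simps matrix_mul_assoc)
      then show ?thesis by (simp add: Jmat_Jmat matrix_mult_simps)
    qed
    finally show ?thesis by simp
  qed
  then obtain c where c: "\<And>t. t \<in> {0..T} \<Longrightarrow> ?f t = c"
    using has_vector_derivative_zero_constant[of "{0..T}" ?f] by auto
  have "0 \<in> {0..T}" using t by auto
  then show ?thesis
    using c[OF t] c[of 0] by (simp add: matrix_mul_assoc)
qed

lemma fundamental_solution_symplectic:
  assumes "\<And>t. t \<in> {0..T} \<Longrightarrow> adjoint_mat (b t) = b t"
    and "fundamental_solution T (\<lambda>t. Jmat ** b t) \<gamma>" and "t \<in> {0..T}"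
  shows "symplectic (\<gamma> t)"
proof -
  have "adjoint_mat (\<gamma> t) ** Jmat ** \<gamma> t = adjoint_mat (\<gamma> 0) ** Jmat ** \<gamma> 0"
    using assms by (intro symplectic_pairing_constant[of T b]) (auto simp: fundamental_solution_def)
  then show ?thesis
    using assms(2) by (simp add: symplectic_def fundamental_solution_def)
qed

text \<open>If \<open>\<gamma>\<close> and \<open>\<gamma>'\<close> start at the identity, the constant pairing gives \<open>\<gamma>\<^sup>* J \<gamma>' = J = \<gamma>\<^sup>* J \<gamma>\<close>, and
  \<open>\<gamma>\<^sup>* J\<close> can be cancelled.\<close>

lemma fundamental_solution_unique:
  assumes "\<And>t. t \<in> {0..T} \<Longrightarrow> adjoint_mat (b t) = b t"
    and "fundamental_solution T (\<lambda>t. Jmat ** b t) \<gamma>" "fundamental_solution T (\<lambda>t. Jmat ** b t) \<gamma>'" and "t \<in> {0..T}"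
  shows "\<gamma> t = \<gamma>' t"
proof -
  have "adjoint_mat (\<gamma> t) ** Jmat ** \<gamma>' t = adjoint_mat (\<gamma> 0) ** Jmat ** \<gamma>' 0"
    using assms by (intro symplectic_pairing_constant[of T b]) (auto simp: fundamental_solution_def)
  also have "\<dots> = adjoint_mat (\<gamma> t) ** Jmat ** \<gamma> t"
    using fundamental_solution_symplectic[OF assms(1,2,4)] assms(2,3) by (simp add: symplectic_def fundamental_solution_def)
  finally have eq: "adjoint_mat (\<gamma> t) ** Jmat ** \<gamma>' t = adjoint_mat (\<gamma> t) ** Jmat ** \<gamma> t" .
  have inv: "\<gamma> t ** (- Jmat ** adjoint_mat (\<gamma> t) ** Jmat) = mat 1"
    using symplectic_left_inverse[OF fundamental_solution_symplectic[OF assms(1,2,4)]]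
    by (simp add: matrix_left_right_inverse)
  have "(\<gamma> t ** (- Jmat ** adjoint_mat (\<gamma> t) ** Jmat)) ** \<gamma>' t = \<gamma> t ** (- Jmat ** (adjoint_mat (\<gamma> t) ** Jmat ** \<gamma>' t))"
    by (simp only: matrix_mul_assoc)
  also have "\<dots> = (\<gamma> t ** (- Jmat ** adjoint_mat (\<gamma> t) ** Jmat)) ** \<gamma> t"
    by (simp only: eq matrix_mul_assoc)
  finally show ?thesis
    unfolding inv by simp
qed

lemma fundamental_solution_continuous:
  assumes "fundamental_solution T b \<gamma>"
  shows "continuous_on {0..T} \<gamma>"
  using assms unfolding fundamental_solution_def by (intro continuous_on_vector_derivative) blast

lemma has_vector_derivative_block_diagonal:
  fixes A :: "real \<Rightarrow> complex ^ 'k::finite ^ 'k" and D :: "real \<Rightarrow> complex ^ 'l::finite ^ 'l"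
  assumes "(A has_vector_derivative A') F" "(D has_vector_derivative D') F"
  shows "((\<lambda>t. block_mat (A t) 0 0 (D t)) has_vector_derivative block_mat A' 0 0 D') F"
proof -
  have lin: "bounded_linear (\<lambda>A :: complex ^ 'k ^ 'k. block_mat A 0 0 (0 :: complex ^ 'l ^ 'l))"
    "bounded_linear (\<lambda>D :: complex ^ 'l ^ 'l. block_mat (0 :: complex ^ 'k ^ 'k) 0 0 D)"
    unfolding linear_conv_bounded_linear[symmetric]
    by (auto intro!: linearI simp: mat_sum_eq_iff)
  have "((\<lambda>t. block_mat (A t) 0 0 0 + block_mat 0 0 0 (D t)) has_vector_derivative
      (block_mat A' 0 0 0 + block_mat 0 0 0 D')) F"
    by (intro has_vector_derivative_add bounded_linear.has_vector_derivative[OF lin(1)]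
        bounded_linear.has_vector_derivative[OF lin(2)] assms)
  then show ?thesis by (simp add: block_mat_add)
qed

text \<open>With \<open>L = cotangent_lift (matrix_inv a)\<close> this is the relation \<open>L' + L J b = J b' L\<close>, which says that
  \<open>L\<close> carries solutions of the system with \<open>b\<close> to solutions of the system with \<open>b'\<close>. All four blocks
  follow from \<open>(a\<^sup>* p a)\<^sup>-\<^sup>1 = a\<^sup>-\<^sup>1 p\<^sup>-\<^sup>1 a\<^sup>*\<^sup>-\<^sup>1\<close>.\<close>

lemma hamiltonian_mat_transform:
  fixes a da p q r :: "complex ^ 'n::finite ^ 'n"
  assumes a: "invertible a" and p: "invertible p" "adjoint_mat p = p"
  defines "p' \<equiv> adjoint_mat a ** p ** a"
    and "q' \<equiv> adjoint_mat a ** p ** da + adjoint_mat a ** q ** a"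
    and "r' \<equiv> adjoint_mat da ** p ** da + adjoint_mat da ** q ** a
              + adjoint_mat a ** adjoint_mat q ** da + adjoint_mat a ** r ** a"
  shows "block_mat (adjoint_mat da) 0 0 (- (matrix_inv a ** da ** matrix_inv a))
      + cotangent_lift (matrix_inv a) ** (Jmat ** hamiltonian_mat p q r)
    = (Jmat ** hamiltonian_mat p' q' r') ** cotangent_lift (matrix_inv a)"
proof -
  define ai as asi pi where "ai = matrix_inv a" "as = adjoint_mat a" "asi = adjoint_mat (matrix_inv a)" "pi = matrix_inv p"
  have inv: "a ** ai = mat 1" "ai ** a = mat 1" "p ** pi = mat 1" "pi ** p = mat 1"
    by (simp_all add: ai_as_asi_pi_def invertible_matrix_inv a p)
  have inv': "as ** asi = mat 1" "asi ** as = mat 1"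
    by (simp_all add: ai_as_asi_pi_def adjoint_mat_mult[symmetric] invertible_matrix_inv a)
  have c: "X ** a ** ai = X" "X ** ai ** a = X" "X ** p ** pi = X" "X ** pi ** p = X" "X ** as ** asi = X" "X ** asi ** as = X"
    for X :: "complex ^ 'n ^ 'n"
    by (simp_all add: inv inv' flip: matrix_mul_assoc)
  note fold = ai_as_asi_pi_def[symmetric]
  have p'i: "matrix_inv p' = ai ** pi ** asi"
    by (rule matrix_inv_eqI) (simp add: p'_def fold matrix_mul_assoc c inv inv')
  have q's: "adjoint_mat q' = adjoint_mat da ** p ** a + as ** adjoint_mat q ** a"
    by (simp add: q'_def fold adjoint_mat_add adjoint_mat_mult p(2) matrix_mul_assoc) (simp add: ai_as_asi_pi_def)
  have lift: "cotangent_lift ai = block_mat as 0 0 ai"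
    unfolding cotangent_lift_def by (simp add: ai_as_asi_pi_def matrix_inv_matrix_inv a)
  show ?thesis
    unfolding hamiltonian_mat_def p'i q's fold lift Jmat_def
    by (simp add: block_mat_mult block_mat_add matrix_mult_simps matrix_mul_assoc c inv inv'
        q'_def r'_def fold)
qed

lemma fundamental_solution_transform:
  fixes a :: "real \<Rightarrow> complex ^ 'n::finite ^ 'n"
  assumes T: "0 < T" and a: "\<And>t. t \<in> {0..T} \<Longrightarrow> (a has_vector_derivative da t) (at t within {0..T})"
    and a_inv: "\<And>t. t \<in> {0..T} \<Longrightarrow> invertible (a t)"
    and p: "\<And>t. t \<in> {0..T} \<Longrightarrow> invertible (p t)" "\<And>t. t \<in> {0..T} \<Longrightarrow> adjoint_mat (p t) = p t"
    and p': "\<And>t. t \<in> {0..T} \<Longrightarrow> p' t = adjoint_mat (a t) ** p t ** a t"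
    and q': "\<And>t. t \<in> {0..T} \<Longrightarrow>
        q' t = adjoint_mat (a t) ** p t ** da t + adjoint_mat (a t) ** q t ** a t"
    and r': "\<And>t. t \<in> {0..T} \<Longrightarrow>
        r' t = adjoint_mat (da t) ** p t ** da t + adjoint_mat (da t) ** q t ** a t
              + adjoint_mat (a t) ** adjoint_mat (q t) ** da t + adjoint_mat (a t) ** r t ** a t"
    and \<gamma>: "fundamental_solution T (\<lambda>t. Jmat ** hamiltonian_mat (p t) (q t) (r t)) \<gamma>"
  shows "fundamental_solution T (\<lambda>t. Jmat ** hamiltonian_mat (p' t) (q' t) (r' t))
     (\<lambda>t. cotangent_lift (matrix_inv (a t)) ** \<gamma> t ** cotangent_lift (a 0))"
  unfolding fundamental_solution_def
proof (intro conjI ballI)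
  have "0 \<in> {0..T}" using T by simp
  then show "cotangent_lift (matrix_inv (a 0)) ** \<gamma> 0 ** cotangent_lift (a 0) = mat 1"
    using \<gamma> a_inv by (simp add: fundamental_solution_def cotangent_lift_inverse)
next
  fix t assume t: "t \<in> {0..T}"
  let ?L = "\<lambda>t. cotangent_lift (matrix_inv (a t))"
  let ?b = "Jmat ** hamiltonian_mat (p t) (q t) (r t)" and ?b' = "Jmat ** hamiltonian_mat (p' t) (q' t) (r' t)"
  let ?L' = "block_mat (adjoint_mat (da t)) 0 0 (- (matrix_inv (a t) ** da t ** matrix_inv (a t)))"
  have "continuous_on {0..T} a"
    by (rule continuous_on_vector_derivative[OF a])
  then have "((\<lambda>t. block_mat (adjoint_mat (a t)) 0 0 (matrix_inv (a t))) has_vector_derivative ?L') (at t within {0..T})"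
    by (intro has_vector_derivative_block_diagonal has_vector_derivative_matrix_inv t a a_inv
        bounded_linear.has_vector_derivative[OF bounded_linear_adjoint_mat])
  then have L: "(?L has_vector_derivative ?L') (at t within {0..T})"
    by (rule has_vector_derivative_transform_within[OF _ zero_less_one t])
       (simp add: cotangent_lift_def matrix_inv_matrix_inv a_inv)
  have "(\<gamma> has_vector_derivative (?b ** \<gamma> t)) (at t within {0..T})"
    using \<gamma> t by (simp add: fundamental_solution_def)
  then have "((\<lambda>t. ?L t ** \<gamma> t ** cotangent_lift (a 0)) has_vector_derivative
      (?L t ** (?b ** \<gamma> t) + ?L' ** \<gamma> t) ** cotangent_lift (a 0)) (at t within {0..T})"
    by (intro bounded_linear.has_vector_derivative[OF bounded_bilinear.bounded_linear_left[OF bounded_bilinear_matrix_mult]]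
        bounded_bilinear.has_vector_derivative[OF bounded_bilinear_matrix_mult] L)
  also have "(?L t ** (?b ** \<gamma> t) + ?L' ** \<gamma> t) ** cotangent_lift (a 0) = (?L' + ?L t ** ?b) ** (\<gamma> t ** cotangent_lift (a 0))"
    by (simp add: matrix_mult_simps matrix_mul_assoc add.commute)
  also have "?L' + ?L t ** ?b = ?b' ** ?L t"
    unfolding p'[OF t] q'[OF t] r'[OF t] by (rule hamiltonian_mat_transform[OF a_inv[OF t] p[OF t]])
  also have "?b' ** ?L t ** (\<gamma> t ** cotangent_lift (a 0)) = ?b' ** (?L t ** \<gamma> t ** cotangent_lift (a 0))"
    by (simp only: matrix_mul_assoc)
  finally show "((\<lambda>t. ?L t ** \<gamma> t ** cotangent_lift (a 0)) has_vector_derivative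
      ?b' ** (?L t ** \<gamma> t ** cotangent_lift (a 0))) (at t within {0..T})" .
qed

section \<open>The index under a change of coordinates\<close>

text \<open>Reversing momenta changes the sign of the symplectic form, while \<open>Gr (mat 1)\<close> and every \<open>W(R)\<close> are
  invariant since they impose separate linear conditions on positions and momenta. This is the symmetry
  behind the conjugation-symmetric spectrum on the edge \<open>t = 0\<close>.\<close>

definition momentum_reversal :: "complex ^ (('n::finite + 'n) + ('n + 'n)) ^ (('n + 'n) + ('n + 'n))" where
  "momentum_reversal = (let S = block_mat (- mat 1) 0 0 (mat 1) in block_mat S 0 0 S)"

lemma momentum_reversal_vjoin:
  "momentum_reversal *v vjoin (vjoin x y) (vjoin z u) = vjoin (vjoin (- x) y) (vjoin (- z) u)"
  by (simp add: momentum_reversal_def Let_def block_mat_vjoin uminus_matrix_vector_mult)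

lemma momentum_reversal_square: "momentum_reversal ** momentum_reversal = mat 1"
  by (simp add: momentum_reversal_def Let_def block_mat_mult matrix_mult_simps mat_1_block)

lemma momentum_reversal_antisymplectic:
  "momentum_reversal ** block_mat (- Jmat) 0 0 Jmat = - (block_mat (- Jmat) 0 0 Jmat ** momentum_reversal)"
  by (simp add: momentum_reversal_def Let_def block_mat_mult block_mat_minus matrix_mult_simps Jmat_def)

lemma momentum_reversal_Gr_id: "z \<in> Gr (mat 1) \<Longrightarrow> momentum_reversal *v z \<in> Gr (mat 1)"
proof -
  assume "z \<in> Gr (mat 1)"
  then obtain v where v: "z = vjoin v v" unfolding Gr_def by auto
  obtain x y where "v = vjoin x y" by (metis vjoin_cases)
  then show "momentum_reversal *v z \<in> Gr (mat 1)"
    unfolding Gr_def by (auto simp: v momentum_reversal_vjoin)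
qed

lemma momentum_reversal_WR:
  assumes "vec.subspace R" "z \<in> WR R"
  shows "momentum_reversal *v z \<in> WR R"
proof -
  obtain x y w u where z: "z = vjoin (vjoin x y) (vjoin w u)" "vjoin x (- w) \<in> orth_compl R" "vjoin y u \<in> R"
    using assms(2) unfolding WR_def by blast
  have "- vjoin x (- w) \<in> orth_compl R"
    using vec.subspace_neg[OF vec_subspace_orth_compl z(2)] .
  then show ?thesis
    using z by (simp add: momentum_reversal_vjoin vjoin_WR_iff vjoin_minus)
qed

text \<open>Deform the coordinate change to the identity, carrying the boundary condition along. At the final
  time all pairs of Lagrange subspaces are symplectic images of a single one; at the initial time the
  first Lagrange subspace is the diagonal.\<close>

lemma maslov_type_index_transform:
  fixes a :: "real \<Rightarrow> complex ^ 'n::finite ^ 'n" and \<gamma> \<gamma>' :: "real \<Rightarrow> complex ^ ('n + 'n) ^ ('n + 'n)"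
  assumes T: "0 < T" and R: "vec.subspace R"
    and a: "continuous_on {0..T} a" "\<And>t. t \<in> {0..T} \<Longrightarrow> invertible (a t)"
    and \<gamma>: "continuous_on {0..T} \<gamma>" "\<And>t. t \<in> {0..T} \<Longrightarrow> symplectic (\<gamma> t)" "\<gamma> 0 = mat 1"
    and \<gamma>': "\<And>t. t \<in> {0..T} \<Longrightarrow> \<gamma>' t = cotangent_lift (matrix_inv (a t)) ** \<gamma> t ** cotangent_lift (a 0)"
  shows "maslov_type_index T (WR (transformed_boundary (a 0) (a T) R)) \<gamma>' - maslov_type_index T (WR R) \<gamma>
    = int (vec.dim (Gr (mat 1) \<inter> transformed_boundary (a 0) (a T) R)) - int (vec.dim (Gr (mat 1) \<inter> R))"
proof -
  have T0: "0 \<in> {0..T}" "T \<in> {0..T}" using T by auto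
  obtain c where c: "continuous_on {0..1::real} c" "\<And>s. s \<in> {0..1} \<Longrightarrow> invertible (c s)" "c 0 = a 0" "c 1 = mat 1"
    using invertible_path_exists[OF a(2)[OF T0(1)], of "mat 1"] by (auto simp: invertible_def)
  \<comment> \<open>\<open>\<alpha>\<close> contracts the path \<open>a\<close> to its initial point while \<open>c\<close> moves that point to \<open>mat 1\<close>.\<close>
  define \<alpha> where "\<alpha> p = a ((1 - fst p) * snd p) ** matrix_inv (a 0) ** c (fst p)" for p
  define D where "D = {0..1::real} \<times> {0..T}"
  have in_D: "(1 - fst p) * snd p \<in> {0..T}" "fst p \<in> {0..1}" if "p \<in> D" for p
    using that mult_right_mono[of "1 - fst p" 1 "snd p"] by (auto simp: D_def)
  have \<alpha>_inv: "invertible (\<alpha> p)" if "p \<in> D" for p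
    unfolding \<alpha>_def using in_D[OF that] T0 by (intro invertible_mult matrix_inv_invertible a(2) c(2)) auto
  have \<alpha>_cont: "continuous_on D \<alpha>"
    unfolding \<alpha>_def
    by (intro continuous_intros continuous_on_compose2[OF a(1)] continuous_on_compose2[OF c(1)]) (use in_D in auto)
  have \<alpha>0: "\<alpha> (0, t) = a t" if "t \<in> {0..T}" for t
    using invertible_matrix_inv(2)[OF a(2)[OF T0(1)]] by (simp add: \<alpha>_def c(3) flip: matrix_mul_assoc)
  have \<alpha>1: "\<alpha> (1, t) = mat 1" for t
    using invertible_matrix_inv(1)[OF a(2)[OF T0(1)]] by (simp add: \<alpha>_def c(4))
  define L where "L p = cotangent_lift (matrix_inv (\<alpha> p))" for p
  define A where "A p = block_mat (mat 1 :: complex ^ ('n + 'n) ^ ('n + 'n)) 0 0 (L p ** \<gamma> (snd p) ** cotangent_lift (\<alpha> (fst p, 0)))" for p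
  define C where "C p = block_mat (L (fst p, 0)) 0 0 (L (fst p, T))" for p :: "real \<times> real"
  have edge: "(fst p, 0) \<in> D" "(fst p, T) \<in> D" "snd p \<in> {0..T}" if "p \<in> D" for p
    using that T by (auto simp: D_def)
  have L_symp: "symplectic (L p)" if "p \<in> D" for p
    unfolding L_def by (intro symplectic_cotangent_lift matrix_inv_invertible \<alpha>_inv that)
  have L_cont: "continuous_on D L"
    unfolding L_def by (intro continuous_on_cotangent_lift continuous_intros \<alpha>_cont \<alpha>_inv matrix_inv_invertible)
  have M_symp: "symplectic (L p ** \<gamma> (snd p) ** cotangent_lift (\<alpha> (fst p, 0)))" if "p \<in> D" for p
    by (intro symplectic_mult L_symp \<gamma>(2) symplectic_cotangent_lift \<alpha>_inv edge that)
  have A_image: "(*v) (A p) ` Gr (mat 1) = Gr (L p ** \<gamma> (snd p) ** cotangent_lift (\<alpha> (fst p, 0)))" for p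
    unfolding A_def by (rule Gr_eq_image[symmetric])
  have C_image: "(*v) (C p) ` WR R = WR (transformed_boundary (\<alpha> (fst p, 0)) (\<alpha> (fst p, T)) R)" if "p \<in> D" for p
    unfolding C_def L_def by (rule WR_transformed_boundary[symmetric]) (rule \<alpha>_inv edge that)+
  have cA: "continuous_on D A"
    unfolding A_def
    by (intro continuous_intros continuous_on_cotangent_lift continuous_on_compose2[OF \<gamma>(1)] L_cont
        continuous_on_compose2[OF \<alpha>_cont] \<alpha>_inv edge) (use edge in auto)
  have cC: "continuous_on D C"
    unfolding C_def by (intro continuous_intros continuous_on_compose2[OF L_cont]) (use edge in auto)
  define h where "h s = vec.dim (Gr (mat 1) \<inter> transformed_boundary (\<alpha> (s, 0)) (\<alpha> (s, T)) R)" for s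
  have start: "(*v) (A (s, 0)) ` Gr (mat 1) = Gr (mat 1)" if "s \<in> {0..1}" for s
    unfolding A_image using that T by (simp add: L_def \<gamma>(3) cotangent_lift_inverse \<alpha>_inv D_def)
  have "maslov_index (block_mat (- Jmat) 0 0 Jmat) (\<lambda>t. Gr (\<gamma> t)) (\<lambda>_. WR R) 0 T
      - maslov_index (block_mat (- Jmat) 0 0 Jmat) (\<lambda>t. Gr (\<gamma>' t)) (\<lambda>_. WR (transformed_boundary (a 0) (a T) R)) 0 T
      = int (h 1) - int (h 0)"
  proof (rule phase_sum.maslov_index_homotopy[where A = A and C = C and L = "Gr (mat 1)" and M = "WR R"
        and S = momentum_reversal and r = "vec.dim (Gr (\<gamma> T) \<inter> WR R)" and l = "int CARD('n) - int (vec.dim R)"])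
    fix s :: real assume s: "s \<in> {0..1}"
    then have sD: "(s, 0) \<in> D" "(s, T) \<in> D" using T by (auto simp: D_def)
    let ?R = "transformed_boundary (\<alpha> (s, 0)) (\<alpha> (s, T)) R"
    have subR: "vec.subspace ?R" by (rule subspace_transformed_boundary[OF R])
    show "vec.dim ((*v) (A (s, T)) ` Gr (mat 1) \<inter> (*v) (C (s, T)) ` WR R) = vec.dim (Gr (\<gamma> T) \<inter> WR R)"
    proof -
      have "(*v) (A (s, T)) ` Gr (mat 1) = (*v) (C (s, T)) ` Gr (\<gamma> T)"
        unfolding A_image C_def fst_conv snd_conv
        by (rule Gr_conjugate) (simp add: L_def cotangent_lift_inverse \<alpha>_inv sD)
      moreover have inj: "inj ((*v) (C (s, T)))"
        unfolding C_def fst_conv by (intro inj_matrix_mult invertible_block_diagonal symplectic_invertible L_symp sD)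
      ultimately have eq: "(*v) (A (s, T)) ` Gr (mat 1) \<inter> (*v) (C (s, T)) ` WR R = (*v) (C (s, T)) ` (Gr (\<gamma> T) \<inter> WR R)"
        by (simp add: image_Int)
      have "vec.subspace (Gr (\<gamma> T) \<inter> WR R)"
        using T0 by (intro vec.subspace_inter phase_sum.lagrangian_subspace lagrangian_Gr lagrangian_WR \<gamma>(2) R) auto
      then show ?thesis
        unfolding eq by (rule dim_matrix_image) (rule inj_on_subset[OF inj], simp)
    qed
    show "int (vec.dim ((*v) (A (s, 0)) ` Gr (mat 1) \<inter> (*v) (C (s, 0)) ` WR R)) =
        int CARD('n) - int (vec.dim R) + 2 * int (h s)"
      unfolding start[OF s] C_image[OF sD(1)] h_def fst_conv dim_Gr_id_Int_WR[OF subR]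
      by (simp only: dim_transformed_boundary[OF \<alpha>_inv[OF sD(1)] \<alpha>_inv[OF sD(2)] R])
    show "momentum_reversal *v z \<in> (*v) (A (s, 0)) ` Gr (mat 1)" if "z \<in> (*v) (A (s, 0)) ` Gr (mat 1)" for z
      using that unfolding start[OF s] by (rule momentum_reversal_Gr_id)
    show "momentum_reversal *v z \<in> (*v) (C (s, 0)) ` WR R" if "z \<in> (*v) (C (s, 0)) ` WR R" for z
      using that unfolding C_image[OF sD(1)] fst_conv by (rule momentum_reversal_WR[OF subR])
  next
    fix t assume t: "t \<in> {0..T}"
    have D01: "(0, t) \<in> D" "(1, t) \<in> D" "(0, 0) \<in> D" using t T by (auto simp: D_def)
    show "Gr (\<gamma>' t) = (*v) (A (0, t)) ` Gr (mat 1)"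
      unfolding A_image L_def fst_conv snd_conv \<alpha>0[OF t] \<alpha>0[OF T0(1)] \<gamma>'[OF t] ..
    show "Gr (\<gamma> t) = (*v) (A (1, t)) ` Gr (mat 1)"
      unfolding A_image L_def fst_conv snd_conv \<alpha>1 by (simp add: matrix_inv_eqI cotangent_lift_1)
    show "WR (transformed_boundary (a 0) (a T) R) = (*v) (C (0, t)) ` WR R"
      unfolding C_image[OF D01(1)] fst_conv \<alpha>0[OF T0(1)] \<alpha>0[OF T0(2)] ..
    show "WR R = (*v) (C (1, t)) ` WR R"
      unfolding C_image[OF D01(2)] fst_conv \<alpha>1 transformed_boundary_1 ..
  next
    fix p :: "real \<times> real" assume "p \<in> {0..1} \<times> {0..T}"
    then have p: "p \<in> D" by (simp add: D_def)
    show "invertible (A p)"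
      unfolding A_def
    proof (rule invertible_block_diagonal)
      show "invertible (mat 1 :: complex ^ ('n + 'n) ^ ('n + 'n))"
        by (simp add: invertible_def)
    qed (rule symplectic_invertible[OF M_symp[OF p]])
    show "invertible (C p)"
      unfolding C_def by (intro invertible_block_diagonal symplectic_invertible L_symp edge p)
    show "phase_sum.lagrangian ((*v) (A p) ` Gr (mat 1))"
      unfolding A_image by (intro lagrangian_Gr M_symp p)
    show "phase_sum.lagrangian ((*v) (C p) ` WR R)"
      unfolding C_image[OF p] by (intro lagrangian_WR subspace_transformed_boundary R)
  qed (use T cA cC in \<open>auto simp: D_def momentum_reversal_square momentum_reversal_antisymplectic\<close>)
  moreover have "h 0 = vec.dim (Gr (mat 1) \<inter> transformed_boundary (a 0) (a T) R)"
    "h 1 = vec.dim (Gr (mat 1) \<inter> R)"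
    unfolding h_def by (simp_all only: \<alpha>0[OF T0(1)] \<alpha>0[OF T0(2)] \<alpha>1 transformed_boundary_1)
  ultimately show ?thesis
    unfolding maslov_type_index_def by linarith
qed

lemma H1_bc_mult:
  assumes a: "C1_on {0..T} a" and x: "x \<in> H1_bc T (transformed_boundary (a 0) (a T) R)"
  shows "(\<lambda>t. a t *v x t) \<in> H1_bc T R"
proof -
  obtain g where "has_L2_derivative T x g"
    using x by (auto simp: H1_bc_def H1_def)
  then have "has_L2_derivative T (\<lambda>t. a t *v x t) (\<lambda>t. vector_derivative a (at t within {0..T}) *v x t + a t *v g t)"
    using a by (intro has_L2_derivative_mult C1_on_has_vector_derivative) (auto simp: C1_on_def)
  then show ?thesis
    using x by (auto simp: H1_bc_def H1_def vjoin_transformed_boundary_iff)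
qed

theorem theorem1p3:
  fixes T :: real
    and p1 q1 r1 a da p1' q1' r1' :: "real \<Rightarrow> complex ^ 'n::finite ^ 'n"
    and R R' :: "(complex ^ ('n + 'n)) set"
    and \<gamma>1 \<gamma>1' :: "real \<Rightarrow> complex ^ ('n + 'n) ^ ('n + 'n)"
  assumes T: "0 < T"
    and p1: "C1_on {0..T} p1"
    and q1: "continuous_on {0..T} q1"
    and r1: "continuous_on {0..T} r1"
    and p1_herm: "\<And>t. t \<in> {0..T} \<Longrightarrow> p1 t = adjoint_mat (p1 t)"
    and p1_inv: "\<And>t. t \<in> {0..T} \<Longrightarrow> invertible (p1 t)"
    and r1_herm: "\<And>t. t \<in> {0..T} \<Longrightarrow> r1 t = adjoint_mat (r1 t)"
    and R: "vec.subspace R"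
    and a: "C1_on {0..T} a"
    and a_inv: "\<And>t. t \<in> {0..T} \<Longrightarrow> invertible (a t)"
    and da: "\<And>t. t \<in> {0..T} \<Longrightarrow> da t = vector_derivative a (at t within {0..T})"
    and R': "R' = {vjoin x y | x y. vjoin (a 0 *v x) (a T *v y) \<in> R}"
    and p1': "\<And>t. t \<in> {0..T} \<Longrightarrow> p1' t = adjoint_mat (a t) ** p1 t ** a t"
    and q1': "\<And>t. t \<in> {0..T} \<Longrightarrow>
        q1' t = adjoint_mat (a t) ** p1 t ** da t + adjoint_mat (a t) ** q1 t ** a t"
    and r1': "\<And>t. t \<in> {0..T} \<Longrightarrow>
        r1' t = adjoint_mat (da t) ** p1 t ** da t + adjoint_mat (da t) ** q1 t ** a t
              + adjoint_mat (a t) ** adjoint_mat (q1 t) ** da t + adjoint_mat (a t) ** r1 t ** a t"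
    and \<gamma>1: "fundamental_solution T (\<lambda>t. Jmat ** hamiltonian_mat (p1 t) (q1 t) (r1 t)) \<gamma>1"
    and \<gamma>1': "fundamental_solution T (\<lambda>t. Jmat ** hamiltonian_mat (p1' t) (q1' t) (r1' t)) \<gamma>1'"
  shows "(\<forall>x \<in> H1_bc T R'. (\<lambda>t. a t *v x t) \<in> H1_bc T R) \<and>
         (\<forall>x \<in> H1_bc T R'. \<forall>y \<in> H1_bc T R'.
            index_form T p1 q1 r1 (\<lambda>t. a t *v x t) (\<lambda>t. a t *v y t) = index_form T p1' q1' r1' x y) \<and>
         maslov_type_index T (WR R') \<gamma>1' - maslov_type_index T (WR R) \<gamma>1
           = int (vec.dim (Gr (mat 1) \<inter> R')) - int (vec.dim (Gr (mat 1) \<inter> R))"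
proof (intro conjI ballI)
  have R'_eq: "R' = transformed_boundary (a 0) (a T) R"
    by (simp add: R' transformed_boundary_def)
  have a_der: "(a has_vector_derivative da t) (at t within {0..T})" if "t \<in> {0..T}" for t
    unfolding da[OF that] by (rule C1_on_has_vector_derivative[OF a that])
  have a_cont: "continuous_on {0..T} a" and p1_cont: "continuous_on {0..T} p1"
    by (rule C1_on_imp_continuous_on[OF a], rule C1_on_imp_continuous_on[OF p1])
  show "(\<lambda>t. a t *v x t) \<in> H1_bc T R" if "x \<in> H1_bc T R'" for x
    using that unfolding R'_eq by (rule H1_bc_mult[OF a])
  show "index_form T p1 q1 r1 (\<lambda>t. a t *v x t) (\<lambda>t. a t *v y t) = index_form T p1' q1' r1' x y"
    if "x \<in> H1_bc T R'" "y \<in> H1_bc T R'" for x y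
    using that by (intro index_form_transform[OF a da p1_cont q1 r1 p1_herm p1' q1' r1']) (auto simp: H1_bc_def)
  let ?b = "\<lambda>t. hamiltonian_mat (p1 t) (q1 t) (r1 t)" and ?b' = "\<lambda>t. hamiltonian_mat (p1' t) (q1' t) (r1' t)"
  have b: "adjoint_mat (?b t) = ?b t" if "t \<in> {0..T}" for t
    using p1_herm[OF that] r1_herm[OF that] p1_inv[OF that] by (intro adjoint_hamiltonian_mat) auto
  have b': "adjoint_mat (?b' t) = ?b' t" if t: "t \<in> {0..T}" for t
  proof (rule adjoint_hamiltonian_mat)
    have herm: "adjoint_mat (p1 t) = p1 t" "adjoint_mat (r1 t) = r1 t"
      using p1_herm[OF t] r1_herm[OF t] by auto
    show "adjoint_mat (p1' t) = p1' t"
      by (simp add: p1'[OF t] adjoint_mat_mult herm matrix_mul_assoc)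
    show "adjoint_mat (r1' t) = r1' t"
      by (simp add: r1'[OF t] adjoint_mat_add adjoint_mat_mult herm matrix_mul_assoc add_ac)
    show "invertible (p1' t)"
      unfolding p1'[OF t] by (intro invertible_mult adjoint_mat_invertible a_inv p1_inv t)
  qed
  have "fundamental_solution T (\<lambda>t. Jmat ** ?b' t) (\<lambda>t. cotangent_lift (matrix_inv (a t)) ** \<gamma>1 t ** cotangent_lift (a 0))"
    by (rule fundamental_solution_transform[OF T a_der a_inv p1_inv p1_herm[symmetric] p1' q1' r1' \<gamma>1])
  then have eq: "\<gamma>1' t = cotangent_lift (matrix_inv (a t)) ** \<gamma>1 t ** cotangent_lift (a 0)" if "t \<in> {0..T}" for t
    using fundamental_solution_unique[OF b' \<gamma>1' _ that] by blast
  show "maslov_type_index T (WR R') \<gamma>1' - maslov_type_index T (WR R) \<gamma>1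
           = int (vec.dim (Gr (mat 1) \<inter> R')) - int (vec.dim (Gr (mat 1) \<inter> R))"
    unfolding R'_eq
  proof (rule maslov_type_index_transform[OF T R a_cont a_inv fundamental_solution_continuous[OF \<gamma>1] _ _ eq])
    show "symplectic (\<gamma>1 t)" if "t \<in> {0..T}" for t
      by (rule fundamental_solution_symplectic[OF b \<gamma>1 that])
    show "\<gamma>1 0 = mat 1"
      using \<gamma>1 by (simp add: fundamental_solution_def)
  qed
qed

end
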